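(* The functor $\beta_{\mathbf{L}}\colon\mathsf{Set}_{\mathbf{L}}\to\mathsf{Stone}_{\mathbf{L}}$, defined on objects by $\beta_{\mathbf{L}}(X,v)=(\beta(X),\tilde{\mathbf{v}})$ and on morphisms by $f\mapsto\beta f$, is the dual of the inclusion functor $\iota_c\colon\mathsf{CA}\mathcal{A}\to\mathcal{A}$ (the right adjoint of the canonical extension functor $(-)^\delta\colon\mathcal{A}\to\mathsf{CA}\mathcal{A}$); that is, $\Pi_{\mathbf{L}}\circ\beta_{\mathbf{L}}$ and $\iota_c\circ\Pi^{d}_{\mathbf{L}}$ are naturally isomorphic (contravariant) functors $\mathsf{Set}_{\mathbf{L}}\to\mathcal{A}$.
   Context: Setting: $\mathbf{L}$ is a finite algebra with an underlying bounded lattice $(L,\wedge,\vee,0,1)$, $0\neq 1$ (the lattice operations and the bounds belong to the signature of $\mathbf{L}$, so every subalgebra contains $0,1$), and $\mathbf{L}$ is semi-primal: for every $n\ge 1$, every function $f\colon L^n\to L$ that preserves subalgebras (meaning $f(a_1,\dots,a_n)$ always lies in the subalgebra generated by $a_1,\dots,a_n$) is term-definable in $\mathbf{L}$. $\mathcal{A}=\mathbb{HSP}(\mathbf{L})$ is the variety generated by $\mathbf{L}$, considered as a category with homomorphisms. $\mathbb{S}(\mathbf{L})$ is the finite lattice of subalgebras of $\mathbf{L}$ ordered by inclusion. $\mathsf{Set}_{\mathbf{L}}$: objects $(X,v)$ with $X$ a set and $v\colon X\to\mathbb{S}(\mathbf{L})$ any map; morphisms $(X,v)\to(Y,w)$ are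 maps $m\colon X\to Y$ with $w(m(x))\le v(x)$ for all $x$. $\mathsf{Stone}_{\mathbf{L}}$: objects $(X,\mathbf{v})$ with $X$ a Stone space and $\mathbf{v}\colon X\to\mathbb{S}(\mathbf{L})$ such that $\mathbf{v}^{-1}(\{\mathbf{S}'\mid\mathbf{S}'\le\mathbf{S}\})$ is closed for every $\mathbf{S}\le\mathbf{L}$; morphisms $(X,\mathbf{v})\to(Y,\mathbf{w})$ are continuous maps $m$ with $\mathbf{w}(m(x))\le\mathbf{v}(x)$ for all $x$. $\beta(X)$ is the Stone–Čech compactification of the discrete space $X$, $\beta f$ is the induced continuous map, and $\tilde{\mathbf{v}}\colon\beta(X)\to\mathbb{S}(\mathbf{L})$ is the unique continuous extension of $v\colon X\to\mathbb{S}(\mathbf{L})$, where $\mathbb{S}(\mathbf{L})$ is discrete. $\Pi_{\mathbf{L}}\colon\mathsf{Stone}_{\mathbf{L}}\to\mathcal{A}$ is the contravariant functor (a dual equivalence) sending $(X,\mathbf{v})$ to the algebra of all continuous maps $g\colon X\to L$ ($L$ discrete) with $g(x)\in\mathbf{v}(x)$ for all $x$, with pointwise operations, and acting on morphisms by precomposition. $\mathsf{CA}\mathcal{A}$ is the category of algebras $\mathbf{A}\in\mathcal{A}$ with complete lattice reduct whose Boolean skeleton $\mathfrak{S}(\mathbf{A})$ is a complete atomic Boolean algebra, with complete homomorphisms (preserving arbitrary joins and meets) as morphisms; here $\mathfrak{S}(\mathbf{A})$ is the Boolean algebra on $\{a\in A\mid T_1(a)=a\}$ with $\wedge,\vee,0,1$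 inherited and complement $T_0$, where $T_\ell$ is the term(-operation) which on $\mathbf{L}$ is the characteristic function of $\{\ell\}$ with values in $\{0,1\}$. $\Pi^{d}_{\mathbf{L}}\colon\mathsf{Set}_{\mathbf{L}}\to\mathsf{CA}\mathcal{A}$ is the contravariant functor (a dual equivalence) sending $(X,v)$ to $\prod_{x\in X}v(x)$, i.e. to the algebra of all maps $g\colon X\to L$ with $g(x)\in v(x)$ for all $x$, and acting on morphisms by precomposition. The canonical extension functor $(-)^\delta$ is the dual of the functor $\mathsf{Stone}_{\mathbf{L}}\to\mathsf{Set}_{\mathbf{L}}$ forgetting the topology. *)

theory Defs
  imports "HOL-Analysis.Analysis" "HOL-Algebra.Complete_Lattice"
begin

section \<open>Universal algebra over a signature with bounded lattice symbols\<close>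

record 'op lat_signature =
  arity :: "'op \<Rightarrow> nat"
  meet_sym :: 'op
  join_sym :: 'op
  bot_sym :: 'op
  top_sym :: 'op

record ('a, 'op) op_algebra = "'a partial_object" +
  interp :: "'op \<Rightarrow> 'a list \<Rightarrow> 'a"

definition lat_signature_ok :: "'op lat_signature \<Rightarrow> bool" where
  "lat_signature_ok Sg \<longleftrightarrow> arity Sg (meet_sym Sg) = 2 \<and> arity Sg (join_sym Sg) = 2
     \<and> arity Sg (bot_sym Sg) = 0 \<and> arity Sg (top_sym Sg) = 0"

definition alg_meet :: "'op lat_signature \<Rightarrow> ('a, 'op) op_algebra \<Rightarrow> 'a \<Rightarrow> 'a \<Rightarrow> 'a" where
  "alg_meet Sg A x y = interp A (meet_sym Sg) [x, y]"

definition alg_join :: "'op lat_signature \<Rightarrow> ('a, 'op) op_algebra \<Rightarrow> 'a \<Rightarrow> 'a \<Rightarrow> 'a" where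
  "alg_join Sg A x y = interp A (join_sym Sg) [x, y]"

definition alg_bot :: "'op lat_signature \<Rightarrow> ('a, 'op) op_algebra \<Rightarrow> 'a" where
  "alg_bot Sg A = interp A (bot_sym Sg) []"

definition alg_top :: "'op lat_signature \<Rightarrow> ('a, 'op) op_algebra \<Rightarrow> 'a" where
  "alg_top Sg A = interp A (top_sym Sg) []"

definition closed_under_ops :: "'op lat_signature \<Rightarrow> ('a, 'op) op_algebra \<Rightarrow> 'a set \<Rightarrow> bool" where
  "closed_under_ops Sg A S \<longleftrightarrow>
     (\<forall>f as. length as = arity Sg f \<and> set as \<subseteq> S \<longrightarrow> interp A f as \<in> S)"

definition is_algebra :: "'op lat_signature \<Rightarrow> ('a, 'op) op_algebra \<Rightarrow> bool" where
  "is_algebra Sg A \<longleftrightarrow> closed_under_ops Sg A (carrier A)"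

text \<open>A subalgebra is represented by its universe, so the order of the lattice of
  subalgebras is set inclusion.\<close>

definition subalgebras :: "'op lat_signature \<Rightarrow> ('a, 'op) op_algebra \<Rightarrow> 'a set set" where
  "subalgebras Sg A = {S. S \<subseteq> carrier A \<and> closed_under_ops Sg A S}"

definition generated_subalgebra ::
    "'op lat_signature \<Rightarrow> ('a, 'op) op_algebra \<Rightarrow> 'a set \<Rightarrow> 'a set" where
  "generated_subalgebra Sg A X = \<Inter>{S \<in> subalgebras Sg A. X \<subseteq> S}"

text \<open>Homomorphisms are extensional (undefined off the carrier), so that equality of
  functions is equality of morphisms. The same convention is used in all categories below.\<close>

definition homs ::
    "'op lat_signature \<Rightarrow> ('a, 'op) op_algebra \<Rightarrow> ('b, 'op) op_algebra \<Rightarrow> ('a \<Rightarrow> 'b) set" where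
  "homs Sg A B = {h \<in> carrier A \<rightarrow>\<^sub>E carrier B.
     \<forall>f as. length as = arity Sg f \<and> set as \<subseteq> carrier A
       \<longrightarrow> h (interp A f as) = interp B f (map h as)}"

definition isos ::
    "'op lat_signature \<Rightarrow> ('a, 'op) op_algebra \<Rightarrow> ('b, 'op) op_algebra \<Rightarrow> ('a \<Rightarrow> 'b) set" where
  "isos Sg A B = {h \<in> homs Sg A B. bij_betw h (carrier A) (carrier B)}"

definition alg_power :: "('a, 'op) op_algebra \<Rightarrow> 'i set \<Rightarrow> ('i \<Rightarrow> 'a, 'op) op_algebra" where
  "alg_power A I = \<lparr>carrier = I \<rightarrow>\<^sub>E carrier A,
     interp = (\<lambda>f gs. \<lambda>i\<in>I. interp A f (map (\<lambda>g. g i) gs))\<rparr>"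

text \<open>Membership in HSP(L): homomorphic images of subalgebras of powers of L. Restricting
  the exponent to sets of functions from the type of A to that of L loses nothing: every A
  in HSP(L) is an image of the free algebra over its own carrier, which is a
  subalgebra of the power of L with exponent the set of all maps from A to L.\<close>

definition in_HSP ::
    "'op lat_signature \<Rightarrow> ('l, 'op) op_algebra \<Rightarrow> ('a, 'op) op_algebra \<Rightarrow> bool" where
  "in_HSP Sg L A \<longleftrightarrow> is_algebra Sg A \<and>
     (\<exists>(I :: ('a \<Rightarrow> 'l) set). \<exists>S \<in> subalgebras Sg (alg_power L I).
        \<exists>h \<in> homs Sg ((alg_power L I)\<lparr>carrier := S\<rparr>) A. h ` S = carrier A)"

subsection \<open>Terms and semi-primality\<close>

datatype 'op trm = Var nat | App 'op "'op trm list"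

primrec eval_trm :: "('a, 'op) op_algebra \<Rightarrow> (nat \<Rightarrow> 'a) \<Rightarrow> 'op trm \<Rightarrow> 'a" where
  "eval_trm A \<rho> (Var i) = \<rho> i"
| "eval_trm A \<rho> (App f ts) = interp A f (map (eval_trm A \<rho>) ts)"

fun wf_trm :: "'op lat_signature \<Rightarrow> nat \<Rightarrow> 'op trm \<Rightarrow> bool" where
  "wf_trm Sg n (Var i) \<longleftrightarrow> i < n"
| "wf_trm Sg n (App f ts) \<longleftrightarrow> length ts = arity Sg f \<and> (\<forall>t\<in>set ts. wf_trm Sg n t)"

definition term_definable ::
    "'op lat_signature \<Rightarrow> ('a, 'op) op_algebra \<Rightarrow> nat \<Rightarrow> ('a list \<Rightarrow> 'a) \<Rightarrow> bool" where
  "term_definable Sg A n F \<longleftrightarrow> (\<exists>t. wf_trm Sg n t \<and>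
     (\<forall>as. length as = n \<and> set as \<subseteq> carrier A \<longrightarrow> eval_trm A ((!) as) t = F as))"

definition preserves_subalgebras ::
    "'op lat_signature \<Rightarrow> ('a, 'op) op_algebra \<Rightarrow> nat \<Rightarrow> ('a list \<Rightarrow> 'a) \<Rightarrow> bool" where
  "preserves_subalgebras Sg A n F \<longleftrightarrow>
     (\<forall>as. length as = n \<and> set as \<subseteq> carrier A \<longrightarrow> F as \<in> generated_subalgebra Sg A (set as))"

text \<open>Note that preservation of subalgebras already forces F to map tuples over the
  carrier into the carrier.\<close>

definition semi_primal :: "'op lat_signature \<Rightarrow> ('a, 'op) op_algebra \<Rightarrow> bool" where
  "semi_primal Sg A \<longleftrightarrow>
     (\<forall>n\<ge>1. \<forall>F. preserves_subalgebras Sg A n F \<longrightarrow> term_definable Sg A n F)"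

definition bounded_lattice_algebra :: "'op lat_signature \<Rightarrow> ('a, 'op) op_algebra \<Rightarrow> bool" where
  "bounded_lattice_algebra Sg A \<longleftrightarrow> is_algebra Sg A \<and>
     (\<forall>x\<in>carrier A. \<forall>y\<in>carrier A. \<forall>z\<in>carrier A.
        alg_meet Sg A x y = alg_meet Sg A y x \<and>
        alg_join Sg A x y = alg_join Sg A y x \<and>
        alg_meet Sg A (alg_meet Sg A x y) z = alg_meet Sg A x (alg_meet Sg A y z) \<and>
        alg_join Sg A (alg_join Sg A x y) z = alg_join Sg A x (alg_join Sg A y z) \<and>
        alg_meet Sg A x (alg_join Sg A x y) = x \<and>
        alg_join Sg A x (alg_meet Sg A x y) = x \<and>
        alg_meet Sg A x (alg_top Sg A) = x \<and>
        alg_join Sg A x (alg_bot Sg A) = x)"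

text \<open>T_l: a unary term which on L is the characteristic function of l. Any two choices agree
  on all of HSP(L).\<close>

definition char_trm :: "'op lat_signature \<Rightarrow> ('l, 'op) op_algebra \<Rightarrow> 'l \<Rightarrow> 'op trm" where
  "char_trm Sg L l = (SOME t. wf_trm Sg 1 t \<and>
     (\<forall>a\<in>carrier L. eval_trm L (\<lambda>_. a) t = (if a = l then alg_top Sg L else alg_bot Sg L)))"

definition char_op ::
    "'op lat_signature \<Rightarrow> ('l, 'op) op_algebra \<Rightarrow> ('a, 'op) op_algebra \<Rightarrow> 'l \<Rightarrow> 'a \<Rightarrow> 'a" where
  "char_op Sg L A l a = eval_trm A (\<lambda>_. a) (char_trm Sg L l)"

section \<open>Complete atomic Boolean skeletons\<close>

definition meet_order :: "'a set \<Rightarrow> ('a \<Rightarrow> 'a \<Rightarrow> 'a) \<Rightarrow> 'a gorder" where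
  "meet_order B m = \<lparr>carrier = B, eq = (=), le = (\<lambda>x y. m x y = x)\<rparr>"

definition lat_reduct :: "'op lat_signature \<Rightarrow> ('a, 'op) op_algebra \<Rightarrow> 'a gorder" where
  "lat_reduct Sg A = meet_order (carrier A) (alg_meet Sg A)"

text \<open>The one-element Boolean algebra is allowed.\<close>

definition boolean_algebra_on ::
    "'a set \<Rightarrow> ('a \<Rightarrow> 'a \<Rightarrow> 'a) \<Rightarrow> ('a \<Rightarrow> 'a \<Rightarrow> 'a) \<Rightarrow> ('a \<Rightarrow> 'a) \<Rightarrow> 'a \<Rightarrow> 'a \<Rightarrow> bool" where
  "boolean_algebra_on B m j c z e \<longleftrightarrow> z \<in> B \<and> e \<in> B \<and>
     (\<forall>x\<in>B. \<forall>y\<in>B. m x y \<in> B \<and> j x y \<in> B \<and> m x y = m y x \<and> j x y = j y x) \<and>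
     (\<forall>x\<in>B. \<forall>y\<in>B. \<forall>w\<in>B. m x (j y w) = j (m x y) (m x w) \<and> j x (m y w) = m (j x y) (j x w)) \<and>
     (\<forall>x\<in>B. m x e = x \<and> j x z = x \<and> c x \<in> B \<and> m x (c x) = z \<and> j x (c x) = e)"

definition atom_on :: "'a set \<Rightarrow> ('a \<Rightarrow> 'a \<Rightarrow> 'a) \<Rightarrow> 'a \<Rightarrow> 'a \<Rightarrow> bool" where
  "atom_on B m z a \<longleftrightarrow> a \<in> B \<and> a \<noteq> z \<and> (\<forall>b\<in>B. m b a = b \<longrightarrow> b = z \<or> b = a)"

definition complete_atomic_boolean_on ::
    "'a set \<Rightarrow> ('a \<Rightarrow> 'a \<Rightarrow> 'a) \<Rightarrow> ('a \<Rightarrow> 'a \<Rightarrow> 'a) \<Rightarrow> ('a \<Rightarrow> 'a) \<Rightarrow> 'a \<Rightarrow> 'a \<Rightarrow> bool" where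
  "complete_atomic_boolean_on B m j c z e \<longleftrightarrow> boolean_algebra_on B m j c z e \<and>
     complete_lattice (meet_order B m) \<and>
     (\<forall>b\<in>B. b \<noteq> z \<longrightarrow> (\<exists>a. atom_on B m z a \<and> m a b = a))"

definition skeleton ::
    "'op lat_signature \<Rightarrow> ('l, 'op) op_algebra \<Rightarrow> ('a, 'op) op_algebra \<Rightarrow> 'a set" where
  "skeleton Sg L A = {a \<in> carrier A. char_op Sg L A (alg_top Sg L) a = a}"

definition in_CAA ::
    "'op lat_signature \<Rightarrow> ('l, 'op) op_algebra \<Rightarrow> ('a, 'op) op_algebra \<Rightarrow> bool" where
  "in_CAA Sg L A \<longleftrightarrow> in_HSP Sg L A \<and> complete_lattice (lat_reduct Sg A) \<and>
     complete_atomic_boolean_on (skeleton Sg L A) (alg_meet Sg A) (alg_join Sg A)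
       (char_op Sg L A (alg_bot Sg L)) (alg_bot Sg A) (alg_top Sg A)"

definition complete_homs ::
    "'op lat_signature \<Rightarrow> ('a, 'op) op_algebra \<Rightarrow> ('b, 'op) op_algebra \<Rightarrow> ('a \<Rightarrow> 'b) set" where
  "complete_homs Sg A B = {h \<in> homs Sg A B. \<forall>S s. S \<subseteq> carrier A \<longrightarrow>
     (is_lub (lat_reduct Sg A) s S \<longrightarrow> is_lub (lat_reduct Sg B) (h s) (h ` S)) \<and>
     (is_glb (lat_reduct Sg A) s S \<longrightarrow> is_glb (lat_reduct Sg B) (h s) (h ` S))}"

section \<open>Concrete categories and functors\<close>

text \<open>Morphisms are extensional functions between underlying sets; composition and
  identities are those of functions.\<close>

record ('o, 'e) concrete_category =
  Obj :: "'o set"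
  Und :: "'o \<Rightarrow> 'e set"
  Hom :: "'o \<Rightarrow> 'o \<Rightarrow> ('e \<Rightarrow> 'e) set"

definition ident :: "('o, 'e) concrete_category \<Rightarrow> 'o \<Rightarrow> 'e \<Rightarrow> 'e" where
  "ident C X = (\<lambda>x\<in>Und C X. x)"

text \<open>In a functor record, the first two arguments of \<open>on_mor\<close> are the domain and the
  codomain of the given morphism of the source category, also for contravariant functors.\<close>

record ('o, 'e, 'p, 'f) functr =
  on_obj :: "'o \<Rightarrow> 'p"
  on_mor :: "'o \<Rightarrow> 'o \<Rightarrow> ('e \<Rightarrow> 'e) \<Rightarrow> 'f \<Rightarrow> 'f"

definition covariant_functor ::
    "('o, 'e) concrete_category \<Rightarrow> ('p, 'f) concrete_category \<Rightarrow> ('o, 'e, 'p, 'f) functr \<Rightarrow> bool"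
  where
  "covariant_functor C D F \<longleftrightarrow>
     (\<forall>X\<in>Obj C. on_obj F X \<in> Obj D \<and> on_mor F X X (ident C X) = ident D (on_obj F X)) \<and>
     (\<forall>X\<in>Obj C. \<forall>Y\<in>Obj C. \<forall>f\<in>Hom C X Y.
        on_mor F X Y f \<in> Hom D (on_obj F X) (on_obj F Y)) \<and>
     (\<forall>X\<in>Obj C. \<forall>Y\<in>Obj C. \<forall>Z\<in>Obj C. \<forall>f\<in>Hom C X Y. \<forall>g\<in>Hom C Y Z.
        on_mor F X Z (compose (Und C X) g f)
          = compose (Und D (on_obj F X)) (on_mor F Y Z g) (on_mor F X Y f))"

definition contravariant_functor ::
    "('o, 'e) concrete_category \<Rightarrow> ('p, 'f) concrete_category \<Rightarrow> ('o, 'e, 'p, 'f) functr \<Rightarrow> bool"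
  where
  "contravariant_functor C D F \<longleftrightarrow>
     (\<forall>X\<in>Obj C. on_obj F X \<in> Obj D \<and> on_mor F X X (ident C X) = ident D (on_obj F X)) \<and>
     (\<forall>X\<in>Obj C. \<forall>Y\<in>Obj C. \<forall>f\<in>Hom C X Y.
        on_mor F X Y f \<in> Hom D (on_obj F Y) (on_obj F X)) \<and>
     (\<forall>X\<in>Obj C. \<forall>Y\<in>Obj C. \<forall>Z\<in>Obj C. \<forall>f\<in>Hom C X Y. \<forall>g\<in>Hom C Y Z.
        on_mor F X Z (compose (Und C X) g f)
          = compose (Und D (on_obj F Z)) (on_mor F X Y f) (on_mor F Y Z g))"

definition after_covariant ::
    "('p, 'f, 'q, 'g) functr \<Rightarrow> ('o, 'e, 'p, 'f) functr \<Rightarrow> ('o, 'e, 'q, 'g) functr" where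
  "after_covariant G F = \<lparr>on_obj = (\<lambda>X. on_obj G (on_obj F X)),
     on_mor = (\<lambda>X Y f. on_mor G (on_obj F X) (on_obj F Y) (on_mor F X Y f))\<rparr>"

definition after_contravariant ::
    "('p, 'f, 'q, 'g) functr \<Rightarrow> ('o, 'e, 'p, 'f) functr \<Rightarrow> ('o, 'e, 'q, 'g) functr" where
  "after_contravariant G F = \<lparr>on_obj = (\<lambda>X. on_obj G (on_obj F X)),
     on_mor = (\<lambda>X Y f. on_mor G (on_obj F Y) (on_obj F X) (on_mor F X Y f))\<rparr>"

definition Var_cat ::
    "'op lat_signature \<Rightarrow> ('l, 'op) op_algebra \<Rightarrow> (('a, 'op) op_algebra, 'a) concrete_category" where
  "Var_cat Sg L = \<lparr>Obj = {A. in_HSP Sg L A}, Und = carrier, Hom = homs Sg\<rparr>"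

definition CAA_cat ::
    "'op lat_signature \<Rightarrow> ('l, 'op) op_algebra \<Rightarrow> (('a, 'op) op_algebra, 'a) concrete_category" where
  "CAA_cat Sg L = \<lparr>Obj = {A. in_CAA Sg L A}, Und = carrier, Hom = complete_homs Sg\<rparr>"

definition iota_c :: "(('a, 'op) op_algebra, 'a, ('a, 'op) op_algebra, 'a) functr" where
  "iota_c = \<lparr>on_obj = (\<lambda>A. A), on_mor = (\<lambda>A B h. h)\<rparr>"

definition SetL_cat ::
    "'op lat_signature \<Rightarrow> ('l, 'op) op_algebra
       \<Rightarrow> ('x set \<times> ('x \<Rightarrow> 'l set), 'x) concrete_category" where
  "SetL_cat Sg L = \<lparr>Obj = {(X, v). v \<in> X \<rightarrow>\<^sub>E subalgebras Sg L}, Und = fst,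
     Hom = (\<lambda>(X, v) (Y, w). {m \<in> X \<rightarrow>\<^sub>E Y. \<forall>x\<in>X. w (m x) \<subseteq> v x})\<rparr>"

definition stone_space :: "'y topology \<Rightarrow> bool" where
  "stone_space T \<longleftrightarrow> compact_space T \<and> Hausdorff_space T \<and> T dim_le 0"

definition StoneL_cat ::
    "'op lat_signature \<Rightarrow> ('l, 'op) op_algebra
       \<Rightarrow> ('y topology \<times> ('y \<Rightarrow> 'l set), 'y) concrete_category" where
  "StoneL_cat Sg L = \<lparr>Obj = {(T, v). stone_space T \<and> v \<in> topspace T \<rightarrow>\<^sub>E subalgebras Sg L \<and>
       (\<forall>S\<in>subalgebras Sg L. closedin T {x \<in> topspace T. v x \<subseteq> S})},
     Und = (\<lambda>(T, v). topspace T),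
     Hom = (\<lambda>(T, v) (U, w). {m \<in> topspace T \<rightarrow>\<^sub>E topspace U.
       continuous_map T U m \<and> (\<forall>x\<in>topspace T. w (m x) \<subseteq> v x)})\<rparr>"

section \<open>The dualities\<close>

definition PiL_obj ::
    "('l, 'op) op_algebra \<Rightarrow> 'y topology \<times> ('y \<Rightarrow> 'l set) \<Rightarrow> ('y \<Rightarrow> 'l, 'op) op_algebra" where
  "PiL_obj L = (\<lambda>(T, v). (alg_power L (topspace T))\<lparr>carrier :=
     {g \<in> Pi\<^sub>E (topspace T) v. continuous_map T (discrete_topology (carrier L)) g}\<rparr>)"

definition PiL ::
    "('l, 'op) op_algebra
       \<Rightarrow> ('y topology \<times> ('y \<Rightarrow> 'l set), 'y, ('y \<Rightarrow> 'l, 'op) op_algebra, 'y \<Rightarrow> 'l) functr" where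
  "PiL L = \<lparr>on_obj = PiL_obj L,
     on_mor = (\<lambda>X Y m. \<lambda>g\<in>carrier (PiL_obj L Y). compose (topspace (fst X)) g m)\<rparr>"

definition PiD_obj ::
    "('l, 'op) op_algebra \<Rightarrow> 'x set \<times> ('x \<Rightarrow> 'l set) \<Rightarrow> ('x \<Rightarrow> 'l, 'op) op_algebra" where
  "PiD_obj L = (\<lambda>(X, v). (alg_power L X)\<lparr>carrier := Pi\<^sub>E X v\<rparr>)"

definition PiD ::
    "('l, 'op) op_algebra
       \<Rightarrow> ('x set \<times> ('x \<Rightarrow> 'l set), 'x, ('x \<Rightarrow> 'l, 'op) op_algebra, 'x \<Rightarrow> 'l) functr" where
  "PiD L = \<lparr>on_obj = PiD_obj L,
     on_mor = (\<lambda>X Y m. \<lambda>g\<in>carrier (PiD_obj L Y). compose (fst X) g m)\<rparr>"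

text \<open>The quasi-inverse of \<open>PiL\<close>: A is sent to the space of homomorphisms from A to L
  with the topology of pointwise convergence, where h is labelled by its image.\<close>

definition SigmaL ::
    "'op lat_signature \<Rightarrow> ('l, 'op) op_algebra
       \<Rightarrow> (('a, 'op) op_algebra, 'a, ('a \<Rightarrow> 'l) topology \<times> (('a \<Rightarrow> 'l) \<Rightarrow> 'l set), 'a \<Rightarrow> 'l) functr"
  where
  "SigmaL Sg L = \<lparr>on_obj = (\<lambda>A.
       (subtopology (product_topology (\<lambda>_. discrete_topology (carrier L)) (carrier A)) (homs Sg A L),
        \<lambda>h\<in>homs Sg A L. h ` carrier A)),
     on_mor = (\<lambda>A B f. \<lambda>h\<in>homs Sg B L. compose (carrier A) h f)\<rparr>"

definition forget_topology ::
    "('y topology \<times> ('y \<Rightarrow> 'l set), 'y, 'y set \<times> ('y \<Rightarrow> 'l set), 'y) functr" where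
  "forget_topology = \<lparr>on_obj = (\<lambda>(T, v). (topspace T, v)), on_mor = (\<lambda>X Y m. m)\<rparr>"

definition canonical_extension ::
    "'op lat_signature \<Rightarrow> ('l, 'op) op_algebra
       \<Rightarrow> (('a, 'op) op_algebra, 'a, (('a \<Rightarrow> 'l) \<Rightarrow> 'l, 'op) op_algebra, ('a \<Rightarrow> 'l) \<Rightarrow> 'l) functr"
  where
  "canonical_extension Sg L =
     after_contravariant (PiD L) (after_contravariant forget_topology (SigmaL Sg L))"

text \<open>Natural isomorphism of contravariant functors into the variety. The values of the two
  functors may be algebras on different types.\<close>

definition naturally_isomorphic ::
    "'op lat_signature \<Rightarrow> ('l, 'op) op_algebra \<Rightarrow> ('o, 'e) concrete_category
       \<Rightarrow> ('o, 'e, ('a, 'op) op_algebra, 'a) functr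
       \<Rightarrow> ('o, 'e, ('b, 'op) op_algebra, 'b) functr \<Rightarrow> bool" where
  "naturally_isomorphic Sg L C F G \<longleftrightarrow>
     contravariant_functor C (Var_cat Sg L) F \<and> contravariant_functor C (Var_cat Sg L) G \<and>
     (\<exists>\<phi>. (\<forall>X\<in>Obj C. \<phi> X \<in> isos Sg (on_obj F X) (on_obj G X)) \<and>
       (\<forall>X\<in>Obj C. \<forall>Y\<in>Obj C. \<forall>f\<in>Hom C X Y.
          compose (carrier (on_obj F Y)) (\<phi> X) (on_mor F X Y f)
            = compose (carrier (on_obj F Y)) (on_mor G X Y f) (\<phi> Y)))"

text \<open>F, from the variety to \<open>CAA_cat\<close>, is left adjoint to G: bijections
  \<open>CAA(F A, B) \<rightarrow> Var(A, G B)\<close>, natural in A and in B. The objects A and B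
  may live on different types.\<close>

definition left_adjoint ::
    "'op lat_signature \<Rightarrow> ('l, 'op) op_algebra
       \<Rightarrow> (('a, 'op) op_algebra, 'a, ('c, 'op) op_algebra, 'c) functr
       \<Rightarrow> (('b, 'op) op_algebra, 'b, ('b, 'op) op_algebra, 'b) functr \<Rightarrow> bool" where
  "left_adjoint Sg L F G \<longleftrightarrow>
     covariant_functor (Var_cat Sg L) (CAA_cat Sg L) F \<and>
     covariant_functor (CAA_cat Sg L) (Var_cat Sg L) G \<and>
     (\<exists>\<Phi>. (\<forall>A B. in_HSP Sg L A \<and> in_CAA Sg L B \<longrightarrow>
              bij_betw (\<Phi> A B) (complete_homs Sg (on_obj F A) B) (homs Sg A (on_obj G B))) \<and>
        (\<forall>A A' B f k. in_HSP Sg L A \<and> in_HSP Sg L A' \<and> in_CAA Sg L B \<and>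
              f \<in> homs Sg A' A \<and> k \<in> complete_homs Sg (on_obj F A) B \<longrightarrow>
              \<Phi> A' B (compose (carrier (on_obj F A')) k (on_mor F A' A f))
                = compose (carrier A') (\<Phi> A B k) f) \<and>
        (\<forall>A B B' g k. in_HSP Sg L A \<and> in_CAA Sg L B \<and> in_CAA Sg L B' \<and>
              g \<in> complete_homs Sg B B' \<and> k \<in> complete_homs Sg (on_obj F A) B \<longrightarrow>
              \<Phi> A B' (compose (carrier (on_obj F A)) g k)
                = compose (carrier A) (on_mor G B B' g) (\<Phi> A B k)))"

section \<open>The Stone-Cech compactification of a discrete space\<close>

text \<open>Points are the ultrafilters on X. The lemmas at the end of this theory show
  that this is the Stone-Cech compactification in the sense of the universal property.\<close>

definition ultrafilters_on :: "'x set \<Rightarrow> 'x set set set" where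
  "ultrafilters_on X = {U. U \<subseteq> Pow X \<and> X \<in> U \<and> {} \<notin> U \<and>
     (\<forall>A\<in>U. \<forall>B\<in>U. A \<inter> B \<in> U) \<and>
     (\<forall>A\<in>U. \<forall>B. A \<subseteq> B \<and> B \<subseteq> X \<longrightarrow> B \<in> U) \<and>
     (\<forall>A. A \<subseteq> X \<longrightarrow> A \<in> U \<or> X - A \<in> U)}"

definition stone_cech :: "'x set \<Rightarrow> 'x set set topology" where
  "stone_cech X = topology_generated_by ((\<lambda>A. {U \<in> ultrafilters_on X. A \<in> U}) ` Pow X)"

definition stone_cech_unit :: "'x set \<Rightarrow> 'x \<Rightarrow> 'x set set" where
  "stone_cech_unit X = (\<lambda>x\<in>X. {A. A \<subseteq> X \<and> x \<in> A})"

definition stone_cech_ext ::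
    "'x set \<Rightarrow> 'k topology \<Rightarrow> ('x \<Rightarrow> 'k) \<Rightarrow> 'x set set \<Rightarrow> 'k" where
  "stone_cech_ext X T f = (THE g. g \<in> extensional (topspace (stone_cech X)) \<and>
     continuous_map (stone_cech X) T g \<and> (\<forall>x\<in>X. g (stone_cech_unit X x) = f x))"

definition betaL ::
    "'op lat_signature \<Rightarrow> ('l, 'op) op_algebra
       \<Rightarrow> ('x set \<times> ('x \<Rightarrow> 'l set), 'x,
           'x set set topology \<times> ('x set set \<Rightarrow> 'l set), 'x set set) functr" where
  "betaL Sg L = \<lparr>on_obj = (\<lambda>(X, v).
       (stone_cech X, stone_cech_ext X (discrete_topology (subalgebras Sg L)) v)),
     on_mor = (\<lambda>X Y f. stone_cech_ext (fst X) (stone_cech (fst Y))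
       (\<lambda>x. stone_cech_unit (fst Y) (f x)))\<rparr>"

lemma ultrafilters_onD:
  assumes "U \<in> ultrafilters_on X"
  shows "U \<subseteq> Pow X" "X \<in> U" "{} \<notin> U"
    and "\<And>A B. A \<in> U \<Longrightarrow> B \<in> U \<Longrightarrow> A \<inter> B \<in> U"
    and "\<And>A B. A \<in> U \<Longrightarrow> A \<subseteq> B \<Longrightarrow> B \<subseteq> X \<Longrightarrow> B \<in> U"
    and "\<And>A. A \<subseteq> X \<Longrightarrow> A \<in> U \<or> X - A \<in> U"
proof -
  note c = assms[unfolded ultrafilters_on_def, THEN CollectD]
  show "U \<subseteq> Pow X" using c by (elim conjE)
  show "X \<in> U" using c by (elim conjE)
  show "{} \<notin> U" using c by (elim conjE)
  show "A \<in> U \<Longrightarrow> B \<in> U \<Longrightarrow> A \<inter> B \<in> U" for A B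
    using c by (elim conjE) (drule (1) bspec, drule (1) bspec, assumption)
  show "A \<in> U \<Longrightarrow> A \<subseteq> B \<Longrightarrow> B \<subseteq> X \<Longrightarrow> B \<in> U" for A B
    using c by metis
  show "A \<subseteq> X \<Longrightarrow> A \<in> U \<or> X - A \<in> U" for A
    using c by metis
qed

lemma topspace_stone_cech: "topspace (stone_cech X) = ultrafilters_on X"
proof -
  have "\<And>U. U \<in> ultrafilters_on X \<Longrightarrow> X \<in> U"
    by (simp add: ultrafilters_on_def)
  then show ?thesis
    unfolding stone_cech_def topology_generated_by_topspace by blast
qed

lemma openin_stone_cech_basic:
  assumes "A \<subseteq> X"
  shows "openin (stone_cech X) {U \<in> ultrafilters_on X. A \<in> U}"
  unfolding stone_cech_def
  by (rule topology_generated_by_Basis, rule imageI, rule PowI, rule assms)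

lemma openin_stone_cech_base:
  assumes "openin (stone_cech X) W" "U \<in> W"
  shows "\<exists>A. A \<subseteq> X \<and> A \<in> U \<and> {V \<in> ultrafilters_on X. A \<in> V} \<subseteq> W"
proof -
  let ?P = "\<lambda>W U. U \<in> ultrafilters_on X \<longrightarrow>
    (\<exists>A. A \<subseteq> X \<and> A \<in> U \<and> {V \<in> ultrafilters_on X. A \<in> V} \<subseteq> W)"
  have uf: "W \<subseteq> ultrafilters_on X"
    using assms(1) openin_subset topspace_stone_cech by metis
  have "generate_topology_on ((\<lambda>A. {U \<in> ultrafilters_on X. A \<in> U}) ` Pow X) W"
    using assms(1) by (simp add: stone_cech_def openin_topology_generated_by_iff)
  then have "\<forall>U\<in>W. ?P W U"
  proof (rule generate_topology_on.induct[where P = "\<lambda>W. \<forall>U\<in>W. ?P W U"])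
    fix a b assume a: "\<forall>U\<in>a. ?P a U" and b: "\<forall>U\<in>b. ?P b U"
    show "\<forall>U\<in>a \<inter> b. ?P (a \<inter> b) U"
    proof (intro ballI impI)
      fix U assume U: "U \<in> a \<inter> b" "U \<in> ultrafilters_on X"
      obtain A where A: "A \<subseteq> X" "A \<in> U" "{V \<in> ultrafilters_on X. A \<in> V} \<subseteq> a"
        using bspec[OF a IntD1[OF U(1)], THEN mp, OF U(2)] by (elim exE conjE)
      obtain B where B: "B \<subseteq> X" "B \<in> U" "{V \<in> ultrafilters_on X. B \<in> V} \<subseteq> b"
        using bspec[OF b IntD2[OF U(1)], THEN mp, OF U(2)] by (elim exE conjE)
      have AB: "A \<inter> B \<in> U"
        using U(2) A(2) B(2) by (rule ultrafilters_onD(4))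
      have "A \<in> V" "B \<in> V" if V: "V \<in> ultrafilters_on X" "A \<inter> B \<in> V" for V
      proof -
        show "A \<in> V" using ultrafilters_onD(5)[OF V Int_lower1 A(1)] .
        show "B \<in> V" using ultrafilters_onD(5)[OF V Int_lower2 B(1)] .
      qed
      then have "{V \<in> ultrafilters_on X. A \<inter> B \<in> V} \<subseteq> a \<inter> b"
        using A(3) B(3) by blast
      moreover have "A \<inter> B \<subseteq> X" using A(1) by (rule le_infI1)
      ultimately show "\<exists>A. A \<subseteq> X \<and> A \<in> U \<and> {V \<in> ultrafilters_on X. A \<in> V} \<subseteq> a \<inter> b"
        using AB by (intro exI[of _ "A \<inter> B"] conjI)
    qed
  next
    fix K assume K: "\<And>k. k \<in> K \<Longrightarrow> \<forall>U\<in>k. ?P k U"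
    show "\<forall>U\<in>\<Union>K. ?P (\<Union>K) U"
    proof (intro ballI impI)
      fix U assume U: "U \<in> \<Union>K" "U \<in> ultrafilters_on X"
      then obtain k where k: "k \<in> K" "U \<in> k" by blast
      obtain A where A: "A \<subseteq> X" "A \<in> U" "{V \<in> ultrafilters_on X. A \<in> V} \<subseteq> k"
        using bspec[OF K[OF k(1)] k(2), THEN mp, OF U(2)] by (elim exE conjE)
      have "k \<subseteq> \<Union>K" using k(1) by (rule Union_upper)
      with A(3) have "{V \<in> ultrafilters_on X. A \<in> V} \<subseteq> \<Union>K" by (rule subset_trans)
      with A(1,2) show "\<exists>A. A \<subseteq> X \<and> A \<in> U \<and> {V \<in> ultrafilters_on X. A \<in> V} \<subseteq> \<Union>K"
        by (intro exI[of _ A] conjI)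
    qed
  next
    fix s assume "s \<in> (\<lambda>A. {U \<in> ultrafilters_on X. A \<in> U}) ` Pow X"
    then obtain A where A: "A \<subseteq> X" "s = {U \<in> ultrafilters_on X. A \<in> U}" by blast
    show "\<forall>U\<in>s. ?P s U"
    proof (intro ballI impI exI[of _ A] conjI)
      fix U assume "U \<in> s"
      then show "A \<in> U" using A(2) by simp
    qed (use A in simp_all)
  qed simp
  then have "?P W U" using assms(2) by (rule bspec)
  then show ?thesis using subsetD[OF uf assms(2)] by (rule mp)
qed

lemma ultrafilter_exists:
  assumes sub: "\<F> \<subseteq> Pow X"
    and fip: "\<And>\<G>. finite \<G> \<Longrightarrow> \<G> \<subseteq> \<F> \<Longrightarrow> X \<inter> \<Inter>\<G> \<noteq> {}"
  shows "\<exists>U \<in> ultrafilters_on X. \<F> \<subseteq> U"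
proof -
  define FIP where "FIP = {\<H>. \<F> \<subseteq> \<H> \<and> \<H> \<subseteq> Pow X \<and>
    (\<forall>\<G>. finite \<G> \<and> \<G> \<subseteq> \<H> \<longrightarrow> X \<inter> \<Inter>\<G> \<noteq> {})}"
  have FIPI: "\<H> \<in> FIP" if "\<F> \<subseteq> \<H>" "\<H> \<subseteq> Pow X"
      "\<And>\<G>. finite \<G> \<Longrightarrow> \<G> \<subseteq> \<H> \<Longrightarrow> X \<inter> \<Inter>\<G> \<noteq> {}" for \<H>
  proof -
    have "\<forall>\<G>. finite \<G> \<and> \<G> \<subseteq> \<H> \<longrightarrow> X \<inter> \<Inter>\<G> \<noteq> {}"
      using that(3) by metis
    then show ?thesis using that(1,2) by (simp only: FIP_def mem_Collect_eq)
  qed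
  have FIPD1: "\<F> \<subseteq> \<H>" and FIPD2: "\<H> \<subseteq> Pow X"
    and FIPD3: "\<forall>\<G>. finite \<G> \<and> \<G> \<subseteq> \<H> \<longrightarrow> X \<inter> \<Inter>\<G> \<noteq> {}" if "\<H> \<in> FIP" for \<H>
  proof -
    have "\<F> \<subseteq> \<H> \<and> \<H> \<subseteq> Pow X \<and> (\<forall>\<G>. finite \<G> \<and> \<G> \<subseteq> \<H> \<longrightarrow> X \<inter> \<Inter>\<G> \<noteq> {})"
      using that unfolding FIP_def by (rule CollectD)
    note c = this
    show "\<F> \<subseteq> \<H>" by (rule c[THEN conjunct1])
    show "\<H> \<subseteq> Pow X" by (rule c[THEN conjunct2, THEN conjunct1])
    show "\<forall>\<G>. finite \<G> \<and> \<G> \<subseteq> \<H> \<longrightarrow> X \<inter> \<Inter>\<G> \<noteq> {}"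
      by (rule c[THEN conjunct2, THEN conjunct2])
  qed
  have "\<F> \<in> FIP" by (rule FIPI[OF subset_refl sub fip])
  have "\<exists>M\<in>FIP. \<forall>H\<in>FIP. M \<subseteq> H \<longrightarrow> H = M"
  proof (rule subset_Zorn_nonempty)
    show "FIP \<noteq> {}" using \<open>\<F> \<in> FIP\<close> by blast
    fix \<C> assume C: "\<C> \<noteq> {}" "subset.chain FIP \<C>"
    have CF: "\<C> \<subseteq> FIP" using C(2) by (simp add: subset.chain_def)
    have fin: "X \<inter> \<Inter>\<G> \<noteq> {}" if "finite \<G>" "\<G> \<subseteq> \<Union>\<C>" for \<G>
    proof -
      have "\<exists>H\<in>\<C>. \<G> \<subseteq> H"
        using finite_subset_Union_chain[OF that C] by blast
      then obtain H where "H \<in> \<C>" "\<G> \<subseteq> H" by blast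
      moreover have "H \<in> FIP" using CF \<open>H \<in> \<C>\<close> by (rule subsetD)
      ultimately show ?thesis using that(1) FIPD3 by simp
    qed
    have "\<F> \<subseteq> \<Union>\<C>" using C(1) CF FIPD1 by blast
    moreover have "\<Union>\<C> \<subseteq> Pow X" using CF FIPD2 by blast
    ultimately show "\<Union>\<C> \<in> FIP" using fin by (rule FIPI)
  qed
  then obtain M where M: "M \<in> FIP" and max: "\<And>H. H \<in> FIP \<Longrightarrow> M \<subseteq> H \<Longrightarrow> H = M" by blast
  have MX: "M \<subseteq> Pow X" and FM: "\<F> \<subseteq> M"
    and Mf: "\<And>\<G>. finite \<G> \<Longrightarrow> \<G> \<subseteq> M \<Longrightarrow> X \<inter> \<Inter>\<G> \<noteq> {}"
    using FIPD1[OF M] FIPD2[OF M] FIPD3[OF M] by simp_all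
  have mem: "A \<in> M"
    if AX: "A \<subseteq> X" and A: "\<And>\<G>. finite \<G> \<Longrightarrow> \<G> \<subseteq> M \<Longrightarrow> A \<inter> \<Inter>\<G> \<noteq> {}" for A
  proof -
    have "X \<inter> \<Inter>\<G> \<noteq> {}" if G: "finite \<G>" "\<G> \<subseteq> insert A M" for \<G>
    proof -
      have "finite (\<G> - {A})" "\<G> - {A} \<subseteq> M" using G by auto
      then have "A \<inter> \<Inter>(\<G> - {A}) \<noteq> {}" by (rule A)
      moreover have "A \<inter> \<Inter>(\<G> - {A}) \<subseteq> X \<inter> \<Inter>\<G>" using AX by blast
      ultimately show ?thesis by blast
    qed
    moreover have "\<F> \<subseteq> insert A M" "insert A M \<subseteq> Pow X" using MX FM AX by auto
    ultimately have "insert A M \<in> FIP" by (intro FIPI)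
    then show ?thesis using max by blast
  qed
  have inter: "\<exists>\<G>. finite \<G> \<and> \<G> \<subseteq> M \<and> X \<inter> \<Inter>\<G> \<subseteq> X - A" if A: "A \<subseteq> X" "A \<notin> M" for A
  proof -
    obtain \<G> where G: "finite \<G>" "\<G> \<subseteq> M" "A \<inter> \<Inter>\<G> = {}" using mem[OF A(1)] A(2) by metis
    from G(3) have "X \<inter> \<Inter>\<G> \<subseteq> X - A" by blast
    with G show ?thesis by (intro exI[of _ \<G>] conjI)
  qed
  have up: "A \<in> M" if A: "A \<subseteq> X" "finite \<G>" "\<G> \<subseteq> M" "X \<inter> \<Inter>\<G> \<subseteq> A" for A \<G>
  proof (rule ccontr)
    assume "A \<notin> M"
    then obtain \<H> where H: "finite \<H>" "\<H> \<subseteq> M" "X \<inter> \<Inter>\<H> \<subseteq> X - A" using inter[OF A(1)] by metis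
    have "finite (\<G> \<union> \<H>)" "\<G> \<union> \<H> \<subseteq> M" using A(2,3) H(1,2) by simp_all
    then have "X \<inter> \<Inter>(\<G> \<union> \<H>) \<noteq> {}" by (rule Mf)
    then show False using A(4) H(3) by blast
  qed
  have "M \<in> ultrafilters_on X"
    unfolding ultrafilters_on_def
  proof (intro CollectI conjI ballI allI impI)
    show "M \<subseteq> Pow X" by (rule MX)
    show "X \<in> M" using up[of X "{}"] by simp
    show "{} \<notin> M"
    proof
      assume "{} \<in> M"
      then show False using Mf[of "{{}}"] by simp
    qed
    show "A \<inter> B \<in> M" if "A \<in> M" "B \<in> M" for A B
    proof (rule up[of _ "{A, B}"])
      show "A \<inter> B \<subseteq> X" using that(1) MX by blast
      show "X \<inter> \<Inter>{A, B} \<subseteq> A \<inter> B" by auto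
    qed (use that in simp_all)
    show "B \<in> M" if "A \<in> M" "A \<subseteq> B \<and> B \<subseteq> X" for A B
    proof (rule up[of _ "{A}"])
      show "X \<inter> \<Inter>{A} \<subseteq> B" using that(2) by auto
    qed (use that in simp_all)
    show "A \<in> M \<or> X - A \<in> M" if "A \<subseteq> X" for A
    proof (rule disjCI)
      assume "X - A \<notin> M"
      then have "A \<notin> M \<Longrightarrow> False" using inter[OF that] up[of "X - A"] by (metis Diff_subset)
      then show "A \<in> M" by blast
    qed
  qed
  then show ?thesis using FM by blast
qed

lemma ultrafilter_Int_closed:
  assumes U: "U \<in> ultrafilters_on X" and "finite \<G>" "\<G> \<subseteq> U"
  shows "X \<inter> \<Inter>\<G> \<in> U"
  using assms(2,3)
proof (induction rule: finite_induct)
  case empty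
  then show ?case using U by (simp add: ultrafilters_on_def)
next
  case (insert A \<G>)
  then have "A \<inter> (X \<inter> \<Inter>\<G>) \<in> U" using U by (simp add: ultrafilters_on_def)
  moreover have "A \<inter> (X \<inter> \<Inter>\<G>) = X \<inter> \<Inter>(insert A \<G>)" by blast
  ultimately show ?case by simp
qed

lemma ultrafilter_Compl_iff:
  assumes "U \<in> ultrafilters_on X" "A \<subseteq> X"
  shows "X - A \<in> U \<longleftrightarrow> A \<notin> U"
proof -
  have "A \<inter> (X - A) = {}" by blast
  then have "\<not> (A \<in> U \<and> X - A \<in> U)"
    using ultrafilters_onD(3)[OF assms(1)] ultrafilters_onD(4)[OF assms(1), of A "X - A"] by metis
  then show ?thesis using ultrafilters_onD(6)[OF assms] by blast
qed

lemma compact_space_stone_cech: "compact_space (stone_cech X)"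
  unfolding compact_space_alt
proof (intro allI impI)
  fix \<U> assume "(\<forall>W\<in>\<U>. openin (stone_cech X) W) \<and> topspace (stone_cech X) \<subseteq> \<Union>\<U>"
  then have op: "\<And>W. W \<in> \<U> \<Longrightarrow> openin (stone_cech X) W"
    and cov: "ultrafilters_on X \<subseteq> \<Union>\<U>" by (auto simp: topspace_stone_cech)
  let ?B = "\<lambda>A. {V \<in> ultrafilters_on X. A \<in> V}"
  define \<A> where "\<A> = {A. A \<subseteq> X \<and> (\<exists>W\<in>\<U>. ?B A \<subseteq> W)}"
  have "\<not> (\<forall>\<G>. finite \<G> \<and> \<G> \<subseteq> (\<lambda>A. X - A) ` \<A> \<longrightarrow> X \<inter> \<Inter>\<G> \<noteq> {})"
  proof
    assume "\<forall>\<G>. finite \<G> \<and> \<G> \<subseteq> (\<lambda>A. X - A) ` \<A> \<longrightarrow> X \<inter> \<Inter>\<G> \<noteq> {}"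
    then obtain U where U: "U \<in> ultrafilters_on X" "(\<lambda>A. X - A) ` \<A> \<subseteq> U"
      using ultrafilter_exists[of "(\<lambda>A. X - A) ` \<A>" X] by blast
    obtain W where W: "W \<in> \<U>" "U \<in> W" using U(1) cov by blast
    obtain A where A: "A \<subseteq> X" "A \<in> U" "?B A \<subseteq> W"
      using openin_stone_cech_base[OF op[OF W(1)] W(2)] by blast
    then have "A \<in> \<A>" using W(1) by (auto simp: \<A>_def)
    then show False using U ultrafilter_Compl_iff[OF U(1) A(1)] A(2) by blast
  qed
  then obtain \<G> where "finite \<G>" "\<G> \<subseteq> (\<lambda>A. X - A) ` \<A>" and e: "X \<inter> \<Inter>\<G> = {}" by blast
  then obtain \<K> where K: "\<K> \<subseteq> \<A>" "finite \<K>" "\<G> = (\<lambda>A. X - A) ` \<K>"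
    by (meson finite_subset_image)
  have "\<forall>A\<in>\<K>. \<exists>W\<in>\<U>. ?B A \<subseteq> W" using K(1) by (auto simp: \<A>_def)
  then obtain w where w: "\<And>A. A \<in> \<K> \<Longrightarrow> w A \<in> \<U> \<and> ?B A \<subseteq> w A" by metis
  have "ultrafilters_on X \<subseteq> \<Union>(w ` \<K>)"
  proof
    fix U assume U: "U \<in> ultrafilters_on X"
    have "\<not> \<G> \<subseteq> U"
    proof
      assume "\<G> \<subseteq> U"
      then have "{} \<in> U" using ultrafilter_Int_closed[OF U \<open>finite \<G>\<close>] e by simp
      then show False using U by (simp add: ultrafilters_on_def)
    qed
    then obtain A where A: "A \<in> \<K>" "X - A \<notin> U" using K(3) by blast
    then have "A \<subseteq> X" using K(1) by (auto simp: \<A>_def)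
    then have "A \<in> U" using A(2) ultrafilter_Compl_iff[OF U] by blast
    then show "U \<in> \<Union>(w ` \<K>)" using w[OF A(1)] A(1) U by blast
  qed
  then have "topspace (stone_cech X) \<subseteq> \<Union>(w ` \<K>)" by (simp only: topspace_stone_cech)
  moreover have "finite (w ` \<K>)" using K(2) by (rule finite_imageI)
  moreover have "w ` \<K> \<subseteq> \<U>"
  proof
    fix W assume "W \<in> w ` \<K>"
    then obtain A where "A \<in> \<K>" "W = w A" by (rule imageE)
    then show "W \<in> \<U>" using w[of A] by simp
  qed
  ultimately show "\<exists>\<F>. finite \<F> \<and> \<F> \<subseteq> \<U> \<and> topspace (stone_cech X) \<subseteq> \<Union>\<F>"
    by (intro exI[of _ "w ` \<K>"] conjI)
qed

lemma Hausdorff_space_stone_cech: "Hausdorff_space (stone_cech X)"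
  unfolding Hausdorff_space_def topspace_stone_cech
proof (intro allI impI)
  fix U V assume "U \<in> ultrafilters_on X \<and> V \<in> ultrafilters_on X \<and> U \<noteq> V"
  then have U: "U \<in> ultrafilters_on X" and V: "V \<in> ultrafilters_on X" and ne: "U \<noteq> V" by auto
  have UX: "U \<subseteq> Pow X" and VX: "V \<subseteq> Pow X" using U V by (auto simp: ultrafilters_on_def)
  have "\<exists>A\<subseteq>X. A \<in> U \<and> A \<notin> V"
  proof (rule ccontr)
    assume c: "\<not> ?thesis"
    then have sub: "U \<subseteq> V" using UX by blast
    moreover have "V \<subseteq> U"
    proof
      fix A assume "A \<in> V"
      then have "A \<subseteq> X" using VX by blast
      show "A \<in> U"
      proof (rule ccontr)
        assume "A \<notin> U"
        then have "X - A \<in> V" using ultrafilter_Compl_iff[OF U \<open>A \<subseteq> X\<close>] sub by blast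
        then show False using ultrafilter_Compl_iff[OF V \<open>A \<subseteq> X\<close>] \<open>A \<in> V\<close> by blast
      qed
    qed
    ultimately show False using ne by blast
  qed
  then obtain A where A: "A \<subseteq> X" "A \<in> U" "A \<notin> V" by blast
  let ?B = "\<lambda>A. {W \<in> ultrafilters_on X. A \<in> W}"
  have "disjnt (?B A) (?B (X - A))"
    using ultrafilter_Compl_iff[OF _ A(1)] by (fastforce simp: disjnt_iff)
  moreover have "V \<in> ?B (X - A)" using A(3) V ultrafilter_Compl_iff[OF V A(1)] by simp
  moreover have "U \<in> ?B A" using U A(2) by simp
  ultimately show "\<exists>W W'. openin (stone_cech X) W \<and> openin (stone_cech X) W' \<and>
      U \<in> W \<and> V \<in> W' \<and> disjnt W W'"
    using openin_stone_cech_basic[OF A(1)] openin_stone_cech_basic[OF Diff_subset[of X A]]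
    by (intro exI[of _ "?B A"] exI[of _ "?B (X - A)"] conjI)
qed

lemma stone_cech_unit_in:
  assumes "x \<in> X"
  shows "stone_cech_unit X x \<in> ultrafilters_on X"
  unfolding ultrafilters_on_def
  by (intro CollectI conjI ballI allI impI) (use assms in \<open>auto simp: stone_cech_unit_def\<close>)

lemma stone_cech_unit_dense:
  "stone_cech X closure_of (stone_cech_unit X ` X) = topspace (stone_cech X)"
proof (rule antisym)
  show "stone_cech X closure_of (stone_cech_unit X ` X) \<subseteq> topspace (stone_cech X)"
    by (rule closure_of_subset_topspace)
  show "topspace (stone_cech X) \<subseteq> stone_cech X closure_of (stone_cech_unit X ` X)"
  proof
    fix U assume U: "U \<in> topspace (stone_cech X)"
    have "\<exists>y\<in>stone_cech_unit X ` X. y \<in> W" if W: "U \<in> W" "openin (stone_cech X) W" for W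
    proof -
      obtain A where A: "A \<subseteq> X" "A \<in> U" "{V \<in> ultrafilters_on X. A \<in> V} \<subseteq> W"
        using openin_stone_cech_base[OF W(2,1)] by blast
      have "A \<noteq> {}" using A(2) U by (auto simp: topspace_stone_cech ultrafilters_on_def)
      then obtain x where x: "x \<in> A" by blast
      then have "A \<in> stone_cech_unit X x" using A(1) by (auto simp: stone_cech_unit_def)
      then show ?thesis using A x stone_cech_unit_in[of x X] by blast
    qed
    then show "U \<in> stone_cech X closure_of (stone_cech_unit X ` X)"
      using U by (auto simp: in_closure_of)
  qed
qed

lemma stone_cech_universal_property:
  assumes comp: "compact_space T" and haus: "Hausdorff_space T"
    and f: "\<And>x. x \<in> X \<Longrightarrow> f x \<in> topspace T"
  shows "\<exists>!g. g \<in> extensional (topspace (stone_cech X)) \<and>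
     continuous_map (stone_cech X) T g \<and> (\<forall>x\<in>X. g (stone_cech_unit X x) = f x)"
proof -
  have reg: "regular_space T"
    using comp haus compact_Hausdorff_imp_regular_space by blast
  have ex: "\<exists>y\<in>topspace T. \<forall>A\<in>U. y \<in> T closure_of (f ` A)" if U: "U \<in> ultrafilters_on X" for U
  proof -
    let ?\<C> = "(\<lambda>A. T closure_of (f ` A)) ` U"
    have UX: "U \<subseteq> Pow X" using U by (simp add: ultrafilters_on_def)
    have "X \<in> U" using U by (simp add: ultrafilters_on_def)
    have "\<forall>C\<in>?\<C>. closedin T C" by simp
    moreover have "\<Inter>\<F> \<noteq> {}" if fin: "finite \<F>" "\<F> \<subseteq> ?\<C>" for \<F>
    proof -
      obtain \<G> where G: "finite \<G>" "\<G> \<subseteq> U" "\<F> = (\<lambda>A. T closure_of (f ` A)) ` \<G>"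
        using finite_subset_image[OF fin] by metis
      have "X \<inter> \<Inter>\<G> \<in> U" by (rule ultrafilter_Int_closed[OF U G(1,2)])
      moreover have "{} \<notin> U" using U by (simp add: ultrafilters_on_def)
      ultimately have "X \<inter> \<Inter>\<G> \<noteq> {}" by metis
      then obtain x where x: "x \<in> X" "x \<in> \<Inter>\<G>" by blast
      have "f x \<in> T closure_of (f ` A)" if "A \<in> \<G>" for A
      proof -
        have "A \<subseteq> X" using that G(2) UX by blast
        then have "f ` A \<subseteq> topspace T" using f by blast
        then show ?thesis using closure_of_subset[of "f ` A" T] x(2) that by blast
      qed
      then show ?thesis using G(3) by blast
    qed
    ultimately have "\<Inter>?\<C> \<noteq> {}" using comp[unfolded compact_space_fip] by meson
    then obtain y where y: "\<forall>A\<in>U. y \<in> T closure_of (f ` A)" by blast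
    then have "y \<in> topspace T" using \<open>X \<in> U\<close> closure_of_subset_topspace by fast
    then show ?thesis using y by blast
  qed
  then obtain g0 where g0: "\<And>U. U \<in> ultrafilters_on X \<Longrightarrow>
      g0 U \<in> topspace T \<and> (\<forall>A\<in>U. g0 U \<in> T closure_of (f ` A))" by metis
  define g where "g = restrict g0 (ultrafilters_on X)"
  have g1: "g U \<in> topspace T" and g2: "\<And>A. A \<in> U \<Longrightarrow> g U \<in> T closure_of (f ` A)"
    if "U \<in> ultrafilters_on X" for U
    using g0[OF that] that by (auto simp: g_def)
  have cont: "continuous_map (stone_cech X) T g"
    unfolding continuous_map_def
  proof (intro conjI allI impI)
    show "g \<in> topspace (stone_cech X) \<rightarrow> topspace T"
      using g1 by (auto simp: topspace_stone_cech)
    fix W assume W: "openin T W"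
    show "openin (stone_cech X) {U \<in> topspace (stone_cech X). g U \<in> W}"
    proof (subst openin_subopen, intro ballI)
      fix U assume "U \<in> {U \<in> topspace (stone_cech X). g U \<in> W}"
      then have U: "U \<in> ultrafilters_on X" and gU: "g U \<in> W" by (auto simp: topspace_stone_cech)
      have UX: "X \<in> U" using U by (simp add: ultrafilters_on_def)
      obtain V C where V: "openin T V" "closedin T C" "g U \<in> V" "V \<subseteq> C" "C \<subseteq> W"
        using reg W gU unfolding neighbourhood_base_of_closedin[symmetric] neighbourhood_base_of
        by metis
      define A where "A = {x \<in> X. f x \<in> V}"
      have AX: "A \<subseteq> X" by (auto simp: A_def)
      have "A \<in> U"
      proof (rule ccontr)
        assume "A \<notin> U"
        then have "X - A \<in> U" using ultrafilter_Compl_iff[OF U AX] by blast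
        then have "g U \<in> T closure_of (f ` (X - A))" by (rule g2[OF U])
        then have "\<exists>y\<in>f ` (X - A). y \<in> V" using V(1,3) by (auto simp: in_closure_of)
        then show False by (auto simp: A_def)
      qed
      have "g U' \<in> W" if "U' \<in> ultrafilters_on X" "A \<in> U'" for U'
      proof -
        have "f ` A \<subseteq> C" using V(4) by (auto simp: A_def)
        then have "T closure_of (f ` A) \<subseteq> C" by (rule closure_of_minimal) (rule V(2))
        then show ?thesis using g2[OF that] V(5) by blast
      qed
      then show "\<exists>N. openin (stone_cech X) N \<and> U \<in> N \<and>
          N \<subseteq> {U \<in> topspace (stone_cech X). g U \<in> W}"
        using openin_stone_cech_basic[OF AX] U \<open>A \<in> U\<close>
        by (intro exI[of _ "{V \<in> ultrafilters_on X. A \<in> V}"]) (auto simp: topspace_stone_cech)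
    qed
  qed
  have val: "g (stone_cech_unit X x) = f x" if x: "x \<in> X" for x
  proof -
    have "{x} \<in> stone_cech_unit X x" using x by (simp add: stone_cech_unit_def)
    then have "g (stone_cech_unit X x) \<in> T closure_of {f x}"
      using g2[OF stone_cech_unit_in[OF x], of "{x}"] by simp
    moreover have "closedin T {f x}"
      using haus f[OF x] by (simp add: closedin_Hausdorff_sing_eq)
    ultimately show ?thesis by (simp add: closure_of_closedin)
  qed
  show ?thesis
  proof (rule ex1I[of _ g], intro conjI ballI)
    show "g \<in> extensional (topspace (stone_cech X))" by (simp add: g_def topspace_stone_cech)
    show "continuous_map (stone_cech X) T g" by (rule cont)
    show "g (stone_cech_unit X x) = f x" if "x \<in> X" for x by (rule val[OF that])
    fix h assume h: "h \<in> extensional (topspace (stone_cech X)) \<and>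
      continuous_map (stone_cech X) T h \<and> (\<forall>x\<in>X. h (stone_cech_unit X x) = f x)"
    have "h U = g U" if "U \<in> topspace (stone_cech X)" for U
    proof (rule forall_in_closure_of_eq[where f = h and g = g, OF _ haus])
      show "U \<in> stone_cech X closure_of (stone_cech_unit X ` X)"
        using that by (simp add: stone_cech_unit_dense)
      show "continuous_map (stone_cech X) T h" using h by blast
      show "continuous_map (stone_cech X) T g" by (rule cont)
      show "h y = g y" if "y \<in> stone_cech_unit X ` X" for y using that h val by auto
    qed
    then show "h = g"
      using h by (intro extensionalityI[of h "topspace (stone_cech X)" g])
        (auto simp: g_def topspace_stone_cech)
  qed
qed

lemma stone_cech_ext:
  assumes "compact_space T" "Hausdorff_space T" "\<And>x. x \<in> X \<Longrightarrow> f x \<in> topspace T"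
  shows "stone_cech_ext X T f \<in> extensional (topspace (stone_cech X))"
    and "continuous_map (stone_cech X) T (stone_cech_ext X T f)"
    and "\<And>x. x \<in> X \<Longrightarrow> stone_cech_ext X T f (stone_cech_unit X x) = f x"
proof -
  note c = theI'[OF stone_cech_universal_property[of T X f, OF assms], folded stone_cech_ext_def]
  show "stone_cech_ext X T f \<in> extensional (topspace (stone_cech X))"
    by (rule conjunct1[OF c])
  show "continuous_map (stone_cech X) T (stone_cech_ext X T f)"
    by (rule conjunct1[OF conjunct2[OF c]])
  show "stone_cech_ext X T f (stone_cech_unit X x) = f x" if "x \<in> X" for x
    using conjunct2[OF conjunct2[OF c]] that by (rule bspec)
qed

end

theory Submission
  imports Defs
begin

text \<open>Continuous sections over the Stone-Cech compactification of a discrete space X are, by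
  the universal property and density of X, the same as arbitrary sections over X; restriction
  along the unit of the compactification is therefore the natural isomorphism.

  For the adjunction, quasi-identities of L pass to every algebra in the variety by
  semi-primality, and ultrafilter limits turn this into the statement that the homomorphisms to L
  separate points. An algebra B with complete atomic skeleton is then the product, over the atoms
  x of its skeleton, of the images of the homomorphisms to L which map x to 1. Complete
  homomorphisms between such products are given by reindexing, since the singletons have
  supremum 1. So a complete homomorphism from the canonical extension of A to the product B amounts
  to a family of homomorphisms from A to L with values in the factors, that is, to a
  homomorphism from A to B.\<close>

section \<open>Homomorphisms, powers and terms\<close>

text \<open>An object of the variety is presented as a quotient of a subalgebra of a power of L,
  whereas atoms and coordinates are computed at homomorphisms to L. The obstacle is therefore HSP(L)
  = ISP(L). It rests on one operation, switching on equality: it returns one of two arguments, so it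
  preserves subalgebras and is a term operation. The converse, from separation of points back to
  membership, is what places products and algebras of continuous sections in the variety. Finiteness
  of L acts in three ways. Limits of L-valued functions along ultrafilters exist. Suprema and infima
  in a sublattice are finite joins and meets, hence the same as in L. Finally, L and its set of
  subalgebras are compact as discrete spaces, so sections and labels extend to all ultrafilters;
  since a relation between discrete-valued continuous maps is a closed condition, density then
  settles the inclusions and memberships that involve extended labels.\<close>

lemma homs_closed: "h \<in> homs Sg A B \<Longrightarrow> a \<in> carrier A \<Longrightarrow> h a \<in> carrier B"
  by (auto simp: homs_def)

lemma homs_interp:
  "h \<in> homs Sg A B \<Longrightarrow> length as = arity Sg f \<Longrightarrow> set as \<subseteq> carrier A
    \<Longrightarrow> h (interp A f as) = interp B f (map h as)"
  by (auto simp: homs_def)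

lemma homs_eqI:
  assumes "h \<in> homs Sg A B" "k \<in> homs Sg A C" "\<And>a. a \<in> carrier A \<Longrightarrow> h a = k a"
  shows "h = k"
  using assms unfolding homs_def by (intro extensionalityI[of h "carrier A" k]) (auto simp: PiE_def)

lemma is_algebra_interp:
  "is_algebra Sg A \<Longrightarrow> length as = arity Sg f \<Longrightarrow> set as \<subseteq> carrier A \<Longrightarrow> interp A f as \<in> carrier A"
  by (auto simp: is_algebra_def closed_under_ops_def)

lemma homs_compose:
  assumes A: "is_algebra Sg A" and h: "h \<in> homs Sg A B" and k: "k \<in> homs Sg B C"
  shows "compose (carrier A) k h \<in> homs Sg A C"
  unfolding homs_def
proof (intro CollectI conjI allI impI)
  show "compose (carrier A) k h \<in> carrier A \<rightarrow>\<^sub>E carrier C"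
    using homs_closed[OF h] homs_closed[OF k] by (auto simp: compose_def)
  fix f as assume as: "length as = arity Sg f \<and> set as \<subseteq> carrier A"
  then have "set (map h as) \<subseteq> carrier B" using homs_closed[OF h] by auto
  then have "k (h (interp A f as)) = interp C f (map k (map h as))"
    using as homs_interp[OF h] homs_interp[OF k, of "map h as"] by simp
  moreover have "map k (map h as) = map (compose (carrier A) k h) as"
    using as by (auto simp: compose_def)
  ultimately show "compose (carrier A) k h (interp A f as) = interp C f (map (compose (carrier A) k h) as)"
    using as is_algebra_interp[OF A] by (simp only: compose_eq)
qed

lemma isos_inverse:
  assumes A: "is_algebra Sg A" and h: "h \<in> isos Sg A B"
  shows "restrict (inv_into (carrier A) h) (carrier B) \<in> isos Sg B A"
proof -
  let ?k = "restrict (inv_into (carrier A) h) (carrier B)"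
  have hom: "h \<in> homs Sg A B" and bij: "bij_betw h (carrier A) (carrier B)"
    using h by (auto simp: isos_def)
  have kb: "?k b \<in> carrier A" "h (?k b) = b" if "b \<in> carrier B" for b
    using that bij by (auto simp: bij_betw_def f_inv_into_f inv_into_into)
  have kh: "?k (h a) = a" if "a \<in> carrier A" for a
    using that bij by (auto simp: bij_betw_def)
  have "?k \<in> homs Sg B A"
    unfolding homs_def
  proof (intro CollectI conjI allI impI)
    show "?k \<in> carrier B \<rightarrow>\<^sub>E carrier A"
      by (intro restrict_PiE_iff[THEN iffD2] ballI) (use kb in auto)
    fix f bs assume bs: "length bs = arity Sg f \<and> set bs \<subseteq> carrier B"
    then have c: "set (map ?k bs) \<subseteq> carrier A" using kb by auto
    have "map h (map ?k bs) = bs"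
      using bs kb(2) unfolding map_map by (intro map_idI) auto
    then have "h (interp A f (map ?k bs)) = interp B f bs"
      using homs_interp[OF hom _ c] bs by simp
    moreover have "interp A f (map ?k bs) \<in> carrier A"
      by (rule is_algebra_interp[OF A _ c]) (use bs in simp)
    ultimately show "?k (interp B f bs) = interp A f (map ?k bs)" using kh by metis
  qed
  moreover have "bij_betw ?k (carrier B) (carrier A)"
    by (rule bij_betw_byWitness[where f' = h]) (use kb kh homs_closed[OF hom] in auto)
  ultimately show ?thesis by (simp add: isos_def)
qed

lemma eval_trm_closed:
  assumes "is_algebra Sg A" "\<And>i. i < n \<Longrightarrow> \<rho> i \<in> carrier A" "wf_trm Sg n t"
  shows "eval_trm A \<rho> t \<in> carrier A"
  using assms(3)
proof (induction t)
  case (App f ts)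
  then show ?case by (auto intro!: is_algebra_interp[OF assms(1)])
qed (use assms(2) in simp)

lemma eval_trm_hom:
  assumes A: "is_algebra Sg A" and h: "h \<in> homs Sg A B"
    and \<rho>: "\<And>i. i < n \<Longrightarrow> \<rho> i \<in> carrier A" and "wf_trm Sg n t"
  shows "h (eval_trm A \<rho> t) = eval_trm B (\<lambda>i. h (\<rho> i)) t"
  using assms(4)
proof (induction t)
  case (App f ts)
  have "set (map (eval_trm A \<rho>) ts) \<subseteq> carrier A"
    using eval_trm_closed[where \<rho> = \<rho>, OF A \<rho>] App.prems by auto
  then have "h (interp A f (map (eval_trm A \<rho>) ts)) = interp B f (map h (map (eval_trm A \<rho>) ts))"
    using App.prems by (intro homs_interp[OF h]) auto
  moreover have "map h (map (eval_trm A \<rho>) ts) = map (eval_trm B (\<lambda>i. h (\<rho> i))) ts"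
    using App by auto
  ultimately show ?case by (simp only: eval_trm.simps)
qed simp

lemma eval_trm_cong:
  assumes "\<And>i. i < n \<Longrightarrow> \<rho> i = \<sigma> i" "wf_trm Sg n t"
  shows "eval_trm A \<rho> t = eval_trm A \<sigma> t"
  using assms(2)
proof (induction t)
  case (App f ts)
  then have "map (eval_trm A \<rho>) ts = map (eval_trm A \<sigma>) ts" by auto
  then show ?case by (simp only: eval_trm.simps)
qed (use assms(1) in simp)

lemma is_algebra_carrier_update: "S \<in> subalgebras Sg A \<Longrightarrow> is_algebra Sg (A\<lparr>carrier := S\<rparr>)"
  by (auto simp: subalgebras_def is_algebra_def closed_under_ops_def)

lemma proj_homs:
  assumes "S \<subseteq> I \<rightarrow>\<^sub>E carrier A" "closed_under_ops Sg (alg_power A I) S" "i \<in> I"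
  shows "(\<lambda>g\<in>S. g i) \<in> homs Sg ((alg_power A I)\<lparr>carrier := S\<rparr>) A"
  unfolding homs_def
proof (intro CollectI conjI allI impI)
  let ?p = "\<lambda>g\<in>S. g i"
  show "?p \<in> carrier ((alg_power A I)\<lparr>carrier := S\<rparr>) \<rightarrow>\<^sub>E carrier A"
    using assms by auto
  fix f gs assume gs: "length gs = arity Sg f \<and> set gs \<subseteq> carrier ((alg_power A I)\<lparr>carrier := S\<rparr>)"
  then have "interp (alg_power A I) f gs \<in> S" using assms(2) by (auto simp: closed_under_ops_def)
  then have "?p (interp ((alg_power A I)\<lparr>carrier := S\<rparr>) f gs) = interp A f (map (\<lambda>g. g i) gs)"
    using assms(3) by (simp add: alg_power_def)
  moreover have "map (\<lambda>g. g i) gs = map ?p gs" using gs by auto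
  ultimately show "?p (interp ((alg_power A I)\<lparr>carrier := S\<rparr>) f gs) = interp A f (map ?p gs)"
    by (simp only:)
qed

lemma homs_image_subalgebra:
  assumes A: "is_algebra Sg A" and h: "h \<in> homs Sg A B"
  shows "h ` carrier A \<in> subalgebras Sg B"
  unfolding subalgebras_def closed_under_ops_def
proof (intro CollectI conjI allI impI)
  show "h ` carrier A \<subseteq> carrier B" using homs_closed[OF h] by blast
  fix f bs assume bs: "length bs = arity Sg f \<and> set bs \<subseteq> h ` carrier A"
  define as where "as = map (inv_into (carrier A) h) bs"
  have as: "set as \<subseteq> carrier A" using bs by (auto simp: as_def inv_into_into)
  have "bs = map h as"
    unfolding as_def map_map using bs by (intro map_idI[symmetric]) (auto simp: f_inv_into_f)
  then have "interp B f bs = h (interp A f as)" "length as = arity Sg f"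
    using homs_interp[OF h _ as] bs by auto
  then show "interp B f bs \<in> h ` carrier A" using is_algebra_interp[OF A _ as] by simp
qed

text \<open>Universal property of products. The target carrier \<open>S\<close> is a parameter
  because it is in turn a full product, the image of an embedding, or a set of continuous
  sections.\<close>

lemma tuple_homs:
  assumes A: "is_algebra Sg A" and u: "\<And>x. x \<in> X \<Longrightarrow> u x \<in> homs Sg A B"
    and S: "\<And>a. a \<in> carrier A \<Longrightarrow> (\<lambda>x\<in>X. u x a) \<in> S"
  shows "(\<lambda>a\<in>carrier A. \<lambda>x\<in>X. u x a) \<in> homs Sg A ((alg_power B X)\<lparr>carrier := S\<rparr>)"
    (is "?t \<in> _")
  unfolding homs_def
proof (intro CollectI conjI allI impI)
  show "?t \<in> carrier A \<rightarrow>\<^sub>E carrier ((alg_power B X)\<lparr>carrier := S\<rparr>)" using S by simp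
  fix f as assume as: "length as = arity Sg f \<and> set as \<subseteq> carrier A"
  have "?t (interp A f as) = (\<lambda>x\<in>X. u x (interp A f as))"
    using is_algebra_interp[OF A] as by simp
  also have "\<dots> = (\<lambda>x\<in>X. interp B f (map (\<lambda>g. g x) (map ?t as)))"
  proof (rule restrict_ext)
    fix x assume x: "x \<in> X"
    have "map (u x) as = map (\<lambda>g. g x) (map ?t as)" using as x by auto
    then show "u x (interp A f as) = interp B f (map (\<lambda>g. g x) (map ?t as))"
      using homs_interp[OF u[OF x]] as by (simp only:)
  qed
  also have "\<dots> = interp ((alg_power B X)\<lparr>carrier := S\<rparr>) f (map ?t as)"
    by (simp only: alg_power_def) simp
  finally show "?t (interp A f as) = interp ((alg_power B X)\<lparr>carrier := S\<rparr>) f (map ?t as)" .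
qed

text \<open>Coordinate \<open>x\<close> of the reindexed tuple is the projection to
  \<open>m x\<close>, so this is a tuple of projections. Both dual functors on morphisms and the
  restriction to points are instances.\<close>

lemma reindex_homs:
  assumes A: "is_algebra Sg A"
    and S: "S \<subseteq> Y \<rightarrow>\<^sub>E carrier A" "closed_under_ops Sg (alg_power A Y) S"
    and m: "\<And>x. x \<in> X \<Longrightarrow> m x \<in> Y" and S': "\<And>g. g \<in> S \<Longrightarrow> compose X g m \<in> S'"
  shows "(\<lambda>g\<in>S. compose X g m)
    \<in> homs Sg ((alg_power A Y)\<lparr>carrier := S\<rparr>) ((alg_power A X)\<lparr>carrier := S'\<rparr>)"
proof -
  let ?B = "(alg_power A Y)\<lparr>carrier := S\<rparr>"
  have "is_algebra Sg ?B"
    using S by (intro is_algebra_carrier_update) (auto simp: subalgebras_def alg_power_def)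
  then have "(\<lambda>g\<in>carrier ?B. \<lambda>x\<in>X. (\<lambda>g\<in>S. g (m x)) g)
      \<in> homs Sg ?B ((alg_power A X)\<lparr>carrier := S'\<rparr>)"
    using S' by (intro tuple_homs proj_homs[OF S m]) (simp_all add: compose_def)
  moreover have "(\<lambda>g\<in>carrier ?B. \<lambda>x\<in>X. (\<lambda>g\<in>S. g (m x)) g) = (\<lambda>g\<in>S. compose X g m)"
    by (simp add: compose_def cong: restrict_cong)
  ultimately show ?thesis by simp
qed

section \<open>Standing assumptions and the terms supplied by semi-primality\<close>

locale semi_primal_lattice_algebra =
  fixes Sg :: "'op lat_signature" and L :: "('l, 'op) op_algebra"
  assumes signature: "lat_signature_ok Sg"
    and bounded_lattice: "bounded_lattice_algebra Sg L"
    and finite_carrier: "finite (carrier L)"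
    and bot_neq_top: "alg_bot Sg L \<noteq> alg_top Sg L"
    and semi_primal: "semi_primal Sg L"
begin

abbreviation "zero \<equiv> alg_bot Sg L"
abbreviation "one \<equiv> alg_top Sg L"

lemma is_algebra_L: "is_algebra Sg L"
  using bounded_lattice by (simp add: bounded_lattice_algebra_def)

lemma carrier_subalgebra: "carrier L \<in> subalgebras Sg L"
  using is_algebra_L by (simp add: subalgebras_def is_algebra_def)

lemma finite_subalgebras: "finite (subalgebras Sg L)"
  by (rule finite_subset[of _ "Pow (carrier L)"]) (auto simp: subalgebras_def finite_carrier)

lemma closed_lattice_ops:
  assumes "closed_under_ops Sg A S"
  shows "alg_bot Sg A \<in> S" "alg_top Sg A \<in> S"
    and "a \<in> S \<Longrightarrow> b \<in> S \<Longrightarrow> alg_meet Sg A a b \<in> S"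
    and "a \<in> S \<Longrightarrow> b \<in> S \<Longrightarrow> alg_join Sg A a b \<in> S"
  using assms signature
  by (auto simp: closed_under_ops_def lat_signature_ok_def alg_bot_def alg_top_def alg_meet_def
      alg_join_def)

lemmas subalgebra_lattice_ops = closed_lattice_ops[of L S for S]
lemmas algebra_lattice_ops = closed_lattice_ops[of A "carrier A" for A, folded is_algebra_def]

lemma hom_bot: "u \<in> homs Sg A B \<Longrightarrow> u (alg_bot Sg A) = alg_bot Sg B"
  and hom_top: "u \<in> homs Sg A B \<Longrightarrow> u (alg_top Sg A) = alg_top Sg B"
  and hom_meet: "u \<in> homs Sg A B \<Longrightarrow> a \<in> carrier A \<Longrightarrow> b \<in> carrier A
    \<Longrightarrow> u (alg_meet Sg A a b) = alg_meet Sg B (u a) (u b)"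
  and hom_join: "u \<in> homs Sg A B \<Longrightarrow> a \<in> carrier A \<Longrightarrow> b \<in> carrier A
    \<Longrightarrow> u (alg_join Sg A a b) = alg_join Sg B (u a) (u b)"
  using signature
  by (simp_all add: homs_interp lat_signature_ok_def alg_bot_def alg_top_def alg_meet_def
      alg_join_def)

lemma lattice_L:
  assumes "x \<in> carrier L" "y \<in> carrier L" "z \<in> carrier L"
  shows "alg_meet Sg L x y = alg_meet Sg L y x" "alg_join Sg L x y = alg_join Sg L y x"
    and "alg_meet Sg L (alg_meet Sg L x y) z = alg_meet Sg L x (alg_meet Sg L y z)"
    and "alg_join Sg L (alg_join Sg L x y) z = alg_join Sg L x (alg_join Sg L y z)"
    and "alg_meet Sg L x (alg_join Sg L x y) = x" "alg_join Sg L x (alg_meet Sg L x y) = x"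
    and "alg_meet Sg L x one = x" "alg_join Sg L x zero = x"
  using assms bounded_lattice unfolding bounded_lattice_algebra_def by blast+

text \<open>Quantifying over all subalgebras that contain the arguments replaces generated
  subalgebras by a membership check.\<close>

lemma semi_primal_term:
  assumes "n \<ge> 1"
    and "\<And>as S. length as = n \<Longrightarrow> S \<in> subalgebras Sg L \<Longrightarrow> set as \<subseteq> S \<Longrightarrow> F as \<in> S"
  obtains t where "wf_trm Sg n t"
    and "\<And>as. length as = n \<Longrightarrow> set as \<subseteq> carrier L \<Longrightarrow> eval_trm L ((!) as) t = F as"
proof -
  have "preserves_subalgebras Sg L n F"
    using assms(2) by (auto simp: preserves_subalgebras_def generated_subalgebra_def)
  then show thesis
    using semi_primal assms(1) that unfolding semi_primal_def term_definable_def by blast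
qed

text \<open>Characteristic functions take values in {0, 1}, which every subalgebra contains, so
  semi-primality provides the term that the choice operator in \<open>char_trm\<close>
  picks.\<close>

lemma char_trm:
  shows "wf_trm Sg 1 (char_trm Sg L l)"
    and "\<And>a. a \<in> carrier L \<Longrightarrow>
      eval_trm L (\<lambda>_. a) (char_trm Sg L l) = (if a = l then one else zero)"
proof -
  obtain t where t: "wf_trm Sg 1 t" and ev: "\<And>as. length as = 1 \<Longrightarrow> set as \<subseteq> carrier L \<Longrightarrow>
      eval_trm L ((!) as) t = (if as ! 0 = l then one else zero)"
    using subalgebra_lattice_ops(1,2)
    by (rule_tac semi_primal_term[of 1 "\<lambda>as. if as ! 0 = l then one else zero"])
      (auto simp: subalgebras_def)
  \<comment> \<open>The only variable that occurs has index 0, where the constant assignment and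
    \<open>(!) [a]\<close> agree.\<close>
  have "eval_trm L (\<lambda>_. a) t = (if a = l then one else zero)" if "a \<in> carrier L" for a
  proof -
    have "eval_trm L (\<lambda>_. a) t = eval_trm L ((!) [a]) t"
      by (rule eval_trm_cong[OF _ t]) simp
    then show ?thesis using ev[of "[a]"] that by simp
  qed
  then have "\<exists>t. wf_trm Sg 1 t \<and>
      (\<forall>a\<in>carrier L. eval_trm L (\<lambda>_. a) t = (if a = l then one else zero))"
    using t by blast
  note c = someI_ex[OF this, folded char_trm_def]
  show "wf_trm Sg 1 (char_trm Sg L l)" using c by blast
  show "eval_trm L (\<lambda>_. a) (char_trm Sg L l) = (if a = l then one else zero)"
    if "a \<in> carrier L" for a using c that by blast
qed

lemma char_op_closed:
  "is_algebra Sg A \<Longrightarrow> a \<in> carrier A \<Longrightarrow> char_op Sg L A l a \<in> carrier A"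
  unfolding char_op_def by (rule eval_trm_closed[OF _ _ char_trm(1)])

text \<open>Homomorphisms commute with terms, so through each of them \<open>T_l\<close> is again a
  test for \<open>l\<close>. This carries computations in L over to algebras where
  \<open>T_l\<close> is only a term.\<close>

lemma char_op_hom:
  assumes "is_algebra Sg A" "u \<in> homs Sg A L" "a \<in> carrier A"
  shows "u (char_op Sg L A l a) = (if u a = l then one else zero)"
  unfolding char_op_def
  using eval_trm_hom[OF assms(1,2) _ char_trm(1), of "\<lambda>_. a"] assms(3)
    char_trm(2)[OF homs_closed[OF assms(2,3)]] by simp

text \<open>The result is always one of the first two arguments, hence stays in every subalgebra.
  This is the switching term of discriminator varieties, with the condition placed on the last two
  arguments.\<close>

lemma switching_term:
  obtains t where "wf_trm Sg 4 t"
    and "\<And>a b c d. {a, b, c, d} \<subseteq> carrier L \<Longrightarrow>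
      eval_trm L ((!) [a, b, c, d]) t = (if c = d then a else b)"
proof -
  obtain t where t: "wf_trm Sg 4 t" and ev: "\<And>as. length as = 4 \<Longrightarrow> set as \<subseteq> carrier L \<Longrightarrow>
      eval_trm L ((!) as) t = (if as ! 2 = as ! 3 then as ! 0 else as ! 1)"
    by (rule semi_primal_term[of 4 "\<lambda>as. if as ! 2 = as ! 3 then as ! 0 else as ! 1"]) auto
  have "eval_trm L ((!) [a, b, c, d]) t = (if c = d then a else b)"
    if "{a, b, c, d} \<subseteq> carrier L" for a b c d
    using ev[of "[a, b, c, d]"] that by simp
  with t show thesis by (rule that)
qed

end

section \<open>Separating homomorphisms\<close>

text \<open>Otherwise the ultrafilter contains the complements of all fibres of \<open>g\<close>;
  these are finitely many sets with empty intersection.\<close>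

lemma ultrafilter_finite_valued:
  assumes U: "U \<in> ultrafilters_on I" and "finite C" and g: "\<And>i. i \<in> I \<Longrightarrow> g i \<in> C"
  shows "\<exists>c\<in>C. {i \<in> I. g i = c} \<in> U"
proof (rule ccontr)
  assume neg: "\<not> ?thesis"
  define \<G> where "\<G> = (\<lambda>c. I - {i \<in> I. g i = c}) ` C"
  have "\<G> \<subseteq> U"
    using neg ultrafilter_Compl_iff[OF U, of "{i \<in> I. g i = c}" for c] by (auto simp: \<G>_def)
  moreover have "finite \<G>" using assms(2) by (simp add: \<G>_def)
  ultimately have "I \<inter> \<Inter>\<G> \<in> U" by (intro ultrafilter_Int_closed[OF U])
  moreover have "I \<inter> \<Inter>\<G> = {}" using g by (auto simp: \<G>_def)
  ultimately show False using ultrafilters_onD(3)[OF U] by simp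
qed

lemma ultrafilter_finite_meets:
  assumes U: "U \<in> ultrafilters_on I" and "finite \<G>" "\<G> \<subseteq> U"
  shows "\<exists>i\<in>I. \<forall>G\<in>\<G>. i \<in> G"
proof -
  have "I \<inter> \<Inter>\<G> \<in> U" using assms by (rule ultrafilter_Int_closed)
  then have "I \<inter> \<Inter>\<G> \<noteq> {}" using ultrafilters_onD(3)[OF U] by metis
  then show ?thesis by blast
qed

context semi_primal_lattice_algebra
begin

text \<open>The congruence of a quotient of a subalgebra of a power of L satisfies all
  quasi-identities of L: a premise that holds in the quotient is discharged by passing from p
  to the element which agrees with p where the premise holds and with q elsewhere.\<close>

lemma quasi_identity_transfer:
  assumes S: "S \<subseteq> I \<rightarrow>\<^sub>E carrier L" "closed_under_ops Sg (alg_power L I) S"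
    and h: "h \<in> homs Sg ((alg_power L I)\<lparr>carrier := S\<rparr>) B"
    and "finite P" "\<And>g g'. (g, g') \<in> P \<Longrightarrow> g \<in> S \<and> g' \<in> S \<and> h g = h g'"
    and "p \<in> S" "q \<in> S"
    and "\<And>i. i \<in> I \<Longrightarrow> (\<And>g g'. (g, g') \<in> P \<Longrightarrow> g i = g' i) \<Longrightarrow> p i = q i"
  shows "h p = h q"
  using assms(4-)
proof (induction arbitrary: p rule: finite_induct)
  case empty
  then have "p i = q i" if "i \<in> I" for i using that by simp
  moreover have "p \<in> I \<rightarrow>\<^sub>E carrier L" "q \<in> I \<rightarrow>\<^sub>E carrier L" using S(1) empty by auto
  ultimately have "p = q" by (auto intro: PiE_ext)
  then show ?case by simp
next
  case (insert e P)
  let ?A = "(alg_power L I)\<lparr>carrier := S\<rparr>"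
  obtain c d where e: "e = (c, d)" by (cases e)
  have cd: "c \<in> S" "d \<in> S" "h c = h d" using insert.prems(1)[of c d] e by auto
  have alg: "is_algebra Sg ?A"
    using S by (intro is_algebra_carrier_update) (auto simp: subalgebras_def alg_power_def)
  obtain t where t: "wf_trm Sg 4 t"
    and ev: "\<And>a b c d. {a, b, c, d} \<subseteq> carrier L \<Longrightarrow>
      eval_trm L ((!) [a, b, c, d]) t = (if c = d then a else b)"
    using switching_term by blast
  have nth: "[a, b, c, d] ! i \<in> S" if "{a, b, c, d} \<subseteq> S" "i < 4" for a b c d i
    using that by (auto simp: less_Suc_eq numeral_eq_Suc)
  have val: "eval_trm ?A ((!) [a, b, c, d]) t i = (if c i = d i then a i else b i)"
    if abcd: "{a, b, c, d} \<subseteq> S" and i: "i \<in> I" for a b c d i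
  proof -
    let ?p = "\<lambda>g\<in>S. g i"
    have p: "?p \<in> homs Sg ?A L" by (rule proj_homs[OF S i])
    have "eval_trm ?A ((!) [a, b, c, d]) t \<in> S"
      using eval_trm_closed[OF alg _ t, of "(!) [a, b, c, d]"] nth[OF abcd] by simp
    then have "eval_trm ?A ((!) [a, b, c, d]) t i = ?p (eval_trm ?A ((!) [a, b, c, d]) t)" by simp
    also have "\<dots> = eval_trm L (\<lambda>j. ?p ([a, b, c, d] ! j)) t"
      using nth[OF abcd] by (intro eval_trm_hom[OF alg p _ t]) simp
    also have "\<dots> = eval_trm L ((!) [a i, b i, c i, d i]) t"
      using abcd by (intro eval_trm_cong[OF _ t]) (auto simp: less_Suc_eq numeral_eq_Suc)
    also have "\<dots> = (if c i = d i then a i else b i)"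
      using abcd S(1) i by (intro ev) auto
    finally show ?thesis .
  qed
  have hval: "h (eval_trm ?A ((!) [a, b, c, d]) t) = eval_trm B ((!) [h a, h b, h c, h d]) t"
    if abcd: "{a, b, c, d} \<subseteq> S" for a b c d
  proof -
    have "h (eval_trm ?A ((!) [a, b, c, d]) t) = eval_trm B (\<lambda>j. h ([a, b, c, d] ! j)) t"
      using nth[OF abcd] by (intro eval_trm_hom[OF alg h _ t]) simp
    also have "\<dots> = eval_trm B ((!) [h a, h b, h c, h d]) t"
      by (intro eval_trm_cong[OF _ t]) (auto simp: less_Suc_eq numeral_eq_Suc)
    finally show ?thesis .
  qed
  define p' where "p' = eval_trm ?A ((!) [p, q, c, d]) t"
  have in_S: "{p, q, c, d} \<subseteq> S" "{p, q, c, c} \<subseteq> S" using insert.prems cd by auto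
  have ev_S: "eval_trm ?A ((!) [p, q, c, d']) t \<in> S" if "d' \<in> S" for d'
    using eval_trm_closed[OF alg _ t, of "(!) [p, q, c, d']"] nth[of p q c d'] in_S that by simp
  \<comment> \<open>With equal last arguments the term returns \<open>p\<close>. Since
    \<open>h c = h d\<close>, replacing the last \<open>c\<close> by \<open>d\<close> does not
    change the image under \<open>h\<close>, so \<open>h p = h p'\<close>.\<close>
  have "eval_trm ?A ((!) [p, q, c, c]) t = p"
    using ev_S[OF cd(1)] in_S(2) S(1) val[OF in_S(2)]
    by (intro PiE_ext[of _ I "\<lambda>_. carrier L"]) auto
  then have "h p = h p'"
    using hval[OF in_S(1)] hval[OF in_S(2)] cd(3) by (simp add: p'_def)
  also have "h p' = h q"
  \<comment> \<open>Where \<open>c\<close> and \<open>d\<close> differ, \<open>p'\<close> already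
    equals \<open>q\<close>; where they agree, the remaining premises give \<open>p i = q i\<close>.
    The pair \<open>(c, d)\<close> is thus no longer a premise for \<open>p'\<close>.\<close>
  proof (rule insert.IH)
    show "g \<in> S \<and> g' \<in> S \<and> h g = h g'" if "(g, g') \<in> P" for g g'
      using insert.prems(1)[of g g'] that by simp
    show "p' \<in> S" unfolding p'_def by (rule ev_S[OF cd(2)])
    show "q \<in> S" by (rule insert.prems(3))
    show "p' i = q i" if "i \<in> I" "\<And>g g'. (g, g') \<in> P \<Longrightarrow> g i = g' i" for i
      using val[OF in_S(1) that(1)] insert.prems(4)[OF that(1)] that(2) e
      by (auto simp: p'_def)
  qed
  finally show ?case .
qed

text \<open>Limits along a suitable ultrafilter on the exponent of the power turn the transferred
  quasi-identities into separating homomorphisms.\<close>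

lemma in_HSP_separated:
  fixes B :: "('b, 'op) op_algebra"
  assumes B: "in_HSP Sg L B" and b: "b \<in> carrier B" "c \<in> carrier B" "b \<noteq> c"
  shows "\<exists>u\<in>homs Sg B L. u b \<noteq> u c"
proof -
  obtain I :: "('b \<Rightarrow> 'l) set" and S h where "S \<in> subalgebras Sg (alg_power L I)"
    and h: "h \<in> homs Sg ((alg_power L I)\<lparr>carrier := S\<rparr>) B" and img: "h ` S = carrier B"
    using B by (auto simp: in_HSP_def)
  then have S: "S \<subseteq> I \<rightarrow>\<^sub>E carrier L" "closed_under_ops Sg (alg_power L I) S"
    by (auto simp: subalgebras_def alg_power_def)
  \<comment> \<open>A choice of representatives, not a homomorphism. The failure is measured by
    pairs in the kernel of \<open>h\<close>, and the ultrafilter below contains the equalizer of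
    every such pair.\<close>
  define r where "r = inv_into S h"
  have r: "r b \<in> S" "h (r b) = b" if "b \<in> carrier B" for b
    using that img by (auto simp: r_def inv_into_into f_inv_into_f)
  define E where "E = (\<lambda>(g, g' :: ('b \<Rightarrow> 'l) \<Rightarrow> 'l). {i \<in> I. g i = g' i})"
  define K where "K = {(g, g'). g \<in> S \<and> g' \<in> S \<and> h g = h g'}"
  define N where "N = {i \<in> I. r b i \<noteq> r c i}"
  have "\<exists>U \<in> ultrafilters_on I. insert N (E ` K) \<subseteq> U"
  proof (rule ultrafilter_exists)
    show "insert N (E ` K) \<subseteq> Pow I" by (auto simp: N_def E_def)
    fix \<G> assume G: "finite \<G>" "\<G> \<subseteq> insert N (E ` K)"
    then have "finite (\<G> - {N})" "\<G> - {N} \<subseteq> E ` K" by auto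
    then obtain P where P: "P \<subseteq> K" "finite P" "\<G> - {N} = E ` P" by (meson finite_subset_image)
    have "h (r b) \<noteq> h (r c)" using b r by simp
    \<comment> \<open>Without such a coordinate, the quasi-identity with premises \<open>P\<close>
      and conclusion \<open>r b = r c\<close> would hold at every coordinate and transfer to
      \<open>h (r b) = h (r c)\<close>.\<close>
    then have "\<exists>i\<in>I. (\<forall>(g, g')\<in>P. g i = g' i) \<and> r b i \<noteq> r c i"
      using quasi_identity_transfer[OF S h P(2) _ r(1)[OF b(1)] r(1)[OF b(2)]] P(1)
      unfolding K_def by blast
    then obtain i where "i \<in> I" "\<forall>(g, g')\<in>P. g i = g' i" "r b i \<noteq> r c i" by blast
    then have "i \<in> I \<inter> \<Inter>(insert N (E ` P))" by (auto simp: N_def E_def)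
    moreover have "\<G> \<subseteq> insert N (E ` P)" using P(3) by blast
    ultimately show "I \<inter> \<Inter>\<G> \<noteq> {}" by blast
  qed
  then obtain U where U: "U \<in> ultrafilters_on I" and sub: "N \<in> U" "E ` K \<subseteq> U" by blast
  have rL: "r a i \<in> carrier L" if "a \<in> carrier B" "i \<in> I" for a i
    using r(1)[OF that(1)] S(1) that(2) by auto
  \<comment> \<open>The limit of the coordinates of \<open>r a\<close> along \<open>U\<close>; it
    exists because L is finite.\<close>
  have "\<exists>l\<in>carrier L. {i \<in> I. r a i = l} \<in> U" if "a \<in> carrier B" for a
    using ultrafilter_finite_valued[OF U finite_carrier, of "r a"] rL[OF that] by blast
  then obtain u0 where u0: "\<And>a. a \<in> carrier B \<Longrightarrow> u0 a \<in> carrier L \<and> {i \<in> I. r a i = u0 a} \<in> U"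
    by metis
  define D where "D = (\<lambda>a. {i \<in> I. r a i = u0 a})"
  have "restrict u0 (carrier B) \<in> homs Sg B L"
    unfolding homs_def
  proof (intro CollectI conjI allI impI)
    show "restrict u0 (carrier B) \<in> carrier B \<rightarrow>\<^sub>E carrier L" using u0 by auto
    fix f as assume as: "length as = arity Sg f \<and> set as \<subseteq> carrier B"
    let ?a = "interp B f as" and ?g = "interp (alg_power L I) f (map r as)"
    have a: "?a \<in> carrier B"
      by (rule is_algebra_interp) (use B as in \<open>auto simp: in_HSP_def\<close>)
    have rS: "set (map r as) \<subseteq> S" using as r(1) by auto
    then have g: "?g \<in> S" using S(2) as by (auto simp: closed_under_ops_def)
    have "map h (map r as) = as" using as r(2) unfolding map_map by (intro map_idI) auto
    then have "h ?g = ?a" using homs_interp[OF h, of "map r as" f] as rS by simp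
    then have "E (r ?a, ?g) \<in> U" using sub(2) r[OF a] g by (auto simp: K_def)
    \<comment> \<open>Finitely many members of \<open>U\<close> have a common coordinate. There the
      representative of the result is the result of the representatives, and all of them take their
      limit values.\<close>
    then have "insert (E (r ?a, ?g)) (insert (D ?a) (D ` set as)) \<subseteq> U"
      using u0 a as by (auto simp: D_def)
    then obtain i where i: "i \<in> I" "r ?a i = ?g i" "r ?a i = u0 ?a"
        and ri: "\<And>a. a \<in> set as \<Longrightarrow> r a i = u0 a"
      using ultrafilter_finite_meets[OF U, of "insert (E (r ?a, ?g)) (insert (D ?a) (D ` set as))"]
      by (auto simp: D_def E_def)
    have "u0 ?a = interp L f (map (\<lambda>a. r a i) as)"
      using i by (simp add: alg_power_def comp_def)
    moreover have "map (\<lambda>a. r a i) as = map (restrict u0 (carrier B)) as"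
      using ri as by auto
    ultimately show "restrict u0 (carrier B) ?a = interp L f (map (restrict u0 (carrier B)) as)"
      using a by (simp only: restrict_apply')
  qed
  moreover have "u0 b \<noteq> u0 c"
  proof -
    have "{N, D b, D c} \<subseteq> U" using u0 b sub by (auto simp: D_def)
    then obtain i where "i \<in> N" "i \<in> D b" "i \<in> D c"
      using ultrafilter_finite_meets[OF U, of "{N, D b, D c}"] by auto
    then show ?thesis by (auto simp: N_def D_def)
  qed
  ultimately show ?thesis using b by (intro bexI[of _ "restrict u0 (carrier B)"]) auto
qed

text \<open>Evaluation at all homomorphisms embeds A in a power of L, and the inverse of the
  embedding exhibits A as an image. The exponent \<open>homs Sg A L\<close> has exactly the type
  that \<open>in_HSP\<close> prescribes.\<close>

lemma in_HSP_if_separated: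
  fixes A :: "('a, 'op) op_algebra"
  assumes A: "is_algebra Sg A"
    and sep: "\<And>a b. a \<in> carrier A \<Longrightarrow> b \<in> carrier A \<Longrightarrow> (\<And>u. u \<in> homs Sg A L \<Longrightarrow> u a = u b) \<Longrightarrow> a = b"
  shows "in_HSP Sg L A"
proof -
  let ?I = "homs Sg A L"
  define e where "e = (\<lambda>a\<in>carrier A. \<lambda>u\<in>?I. u a)"
  have hom: "e \<in> homs Sg A ((alg_power L ?I)\<lparr>carrier := S\<rparr>)" if "e ` carrier A \<subseteq> S" for S
    unfolding e_def by (rule tuple_homs[OF A]) (use that in \<open>auto simp: e_def\<close>)
  have "e ` carrier A \<subseteq> ?I \<rightarrow>\<^sub>E carrier L" by (auto simp: e_def homs_closed)
  from homs_image_subalgebra[OF A hom[OF this]]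
  have S: "e ` carrier A \<in> subalgebras Sg (alg_power L ?I)"
    by (simp add: subalgebras_def alg_power_def closed_under_ops_def)
  have "inj_on e (carrier A)"
  proof (rule inj_onI)
    fix a b assume ab: "a \<in> carrier A" "b \<in> carrier A" "e a = e b"
    have "u a = u b" if u: "u \<in> ?I" for u
    proof -
      have "e a u = u a" "e b u = u b" using u ab(1,2) by (simp_all add: e_def)
      then show ?thesis using ab(3) by metis
    qed
    then show "a = b" by (rule sep[OF ab(1,2)])
  qed
  then have "e \<in> isos Sg A ((alg_power L ?I)\<lparr>carrier := e ` carrier A\<rparr>)"
    using hom by (simp add: isos_def bij_betw_def)
  from isos_inverse[OF A this]
  obtain h where "h \<in> isos Sg ((alg_power L ?I)\<lparr>carrier := e ` carrier A\<rparr>) A"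
    by blast
  then have "h \<in> homs Sg ((alg_power L ?I)\<lparr>carrier := e ` carrier A\<rparr>) A" "h ` e ` carrier A = carrier A"
    by (auto simp: isos_def bij_betw_def)
  then show ?thesis using A S unfolding in_HSP_def by blast
qed

end

section \<open>Bounds in products of finite lattices\<close>

text \<open>Order notions are treated together with their duals: the flag d selects the order
  of the semilattice m or its converse, so that \<open>is_bound B m d s S\<close> says that s is the
  supremum (d true) or infimum (d false) of S in B.\<close>

definition ord :: "('a \<Rightarrow> 'a \<Rightarrow> 'a) \<Rightarrow> bool \<Rightarrow> 'a \<Rightarrow> 'a \<Rightarrow> bool" where
  "ord m d x y \<longleftrightarrow> (if d then m x y = x else m y x = y)"

definition is_bound :: "'a set \<Rightarrow> ('a \<Rightarrow> 'a \<Rightarrow> 'a) \<Rightarrow> bool \<Rightarrow> 'a \<Rightarrow> 'a set \<Rightarrow> bool" where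
  "is_bound B m d s S \<longleftrightarrow> s \<in> B \<and> (\<forall>f\<in>S. ord m d f s) \<and>
     (\<forall>c\<in>B. (\<forall>f\<in>S. ord m d f c) \<longrightarrow> ord m d s c)"

definition semilattice_on :: "'a set \<Rightarrow> ('a \<Rightarrow> 'a \<Rightarrow> 'a) \<Rightarrow> bool" where
  "semilattice_on B m \<longleftrightarrow> (\<forall>x\<in>B. \<forall>y\<in>B. \<forall>z\<in>B.
     m x y \<in> B \<and> m x x = x \<and> m x y = m y x \<and> m (m x y) z = m x (m y z))"

text \<open>\<open>Upper\<close> and \<open>Lower\<close> look only at the part of S inside the
  carrier, hence the inclusion hypothesis here and in the dual statement.\<close>

lemma is_lub_iff_is_bound: "S \<subseteq> B \<Longrightarrow> is_lub (meet_order B m) s S \<longleftrightarrow> is_bound B m True s S"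
  by (simp add: Int_absorb2 least_def Upper_def is_bound_def ord_def meet_order_def) auto

lemma is_glb_iff_is_bound: "S \<subseteq> B \<Longrightarrow> is_glb (meet_order B m) s S \<longleftrightarrow> is_bound B m False s S"
  by (simp add: Int_absorb2 greatest_def Lower_def is_bound_def ord_def meet_order_def) auto

lemma semilattice_onD:
  assumes "semilattice_on B m"
  shows "x \<in> B \<Longrightarrow> y \<in> B \<Longrightarrow> m x y \<in> B"
    and "x \<in> B \<Longrightarrow> m x x = x"
    and "x \<in> B \<Longrightarrow> y \<in> B \<Longrightarrow> m x y = m y x"
    and "x \<in> B \<Longrightarrow> y \<in> B \<Longrightarrow> z \<in> B \<Longrightarrow> m (m x y) z = m x (m y z)"
  using assms unfolding semilattice_on_def by blast+

lemma ord_refl: "semilattice_on B m \<Longrightarrow> x \<in> B \<Longrightarrow> ord m d x x"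
  by (simp add: ord_def semilattice_onD(2))

lemma ord_antisym:
  assumes "semilattice_on B m" "x \<in> B" "y \<in> B" "ord m d x y" "ord m d y x"
  shows "x = y"
proof -
  have "m x y = m y x" using assms(1-3) by (rule semilattice_onD(3))
  then show ?thesis using assms(4,5) unfolding ord_def by (metis (full_types))
qed

lemma ord_trans:
  assumes m: "semilattice_on B m" and "x \<in> B" "y \<in> B" "z \<in> B" and "ord m d x y" "ord m d y z"
  shows "ord m d x z"
proof (cases d)
  case True
  then show ?thesis
    using assms(5,6) semilattice_onD(4)[OF m assms(2,3,4)] by (simp add: ord_def)
next
  case False
  then show ?thesis
    using assms(5,6) semilattice_onD(4)[OF m assms(4,3,2)] by (simp add: ord_def)
qed

lemma is_bound_unique:
  assumes "semilattice_on B m" "is_bound B m d s S" "is_bound B m d t S"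
  shows "s = t"
  by (rule ord_antisym[OF assms(1), of _ _ d]) (use assms(2,3) in \<open>auto simp: is_bound_def\<close>)

lemma complete_lattice_meet_order:
  assumes m: "semilattice_on B m" and ex: "\<And>S d. S \<subseteq> B \<Longrightarrow> \<exists>s. is_bound B m d s S"
  shows "complete_lattice (meet_order B m)"
proof -
  have le: "le (meet_order B m) x y \<longleftrightarrow> ord m True x y" for x y
    by (simp add: meet_order_def ord_def)
  have [simp]: "carrier (meet_order B m) = B" "eq (meet_order B m) = (=)"
    by (simp_all add: meet_order_def)
  show ?thesis
  proof (unfold_locales, simp_all add: le)
    show "x \<in> B \<Longrightarrow> ord m True x x" for x by (rule ord_refl[OF m])
    show "ord m True x y \<Longrightarrow> ord m True y x \<Longrightarrow> x \<in> B \<Longrightarrow> y \<in> B \<Longrightarrow> x = y" for x y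
      by (rule ord_antisym[OF m])
    show "ord m True x y \<Longrightarrow> ord m True y z \<Longrightarrow> x \<in> B \<Longrightarrow> y \<in> B \<Longrightarrow> z \<in> B \<Longrightarrow> ord m True x z" for x y z
      by (rule ord_trans[OF m])
    show "S \<subseteq> B \<Longrightarrow> \<exists>s. is_lub (meet_order B m) s S" for S
      using ex[of S True] by (simp add: is_lub_iff_is_bound)
    show "S \<subseteq> B \<Longrightarrow> \<exists>s. is_glb (meet_order B m) s S" for S
      using ex[of S False] by (simp add: is_glb_iff_is_bound)
  qed
qed

lemma complete_homs_iff:
  "h \<in> complete_homs Sg A B \<longleftrightarrow> h \<in> homs Sg A B \<and>
     (\<forall>S s d. S \<subseteq> carrier A \<longrightarrow> is_bound (carrier A) (alg_meet Sg A) d s S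
       \<longrightarrow> is_bound (carrier B) (alg_meet Sg B) d (h s) (h ` S))"
  (is "?l \<longleftrightarrow> ?r")
proof -
  have sub: "h ` S \<subseteq> carrier B" if "h \<in> homs Sg A B" "S \<subseteq> carrier A" for S
    using homs_closed[OF that(1)] that(2) by blast
  show ?thesis
  proof
    assume ?l
    then have h: "h \<in> homs Sg A B" and c: "\<And>S s. S \<subseteq> carrier A \<Longrightarrow>
       (is_lub (lat_reduct Sg A) s S \<longrightarrow> is_lub (lat_reduct Sg B) (h s) (h ` S)) \<and>
       (is_glb (lat_reduct Sg A) s S \<longrightarrow> is_glb (lat_reduct Sg B) (h s) (h ` S))"
      by (simp_all add: complete_homs_def)
    have "is_bound (carrier B) (alg_meet Sg B) d (h s) (h ` S)"
      if "S \<subseteq> carrier A" "is_bound (carrier A) (alg_meet Sg A) d s S" for S s d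
      using c[OF that(1), of s] that sub[OF h that(1)]
      by (cases d) (simp_all add: lat_reduct_def is_lub_iff_is_bound is_glb_iff_is_bound)
    then show ?r using h by blast
  next
    assume r: ?r
    then show ?l
      using sub by (auto simp: complete_homs_def lat_reduct_def is_lub_iff_is_bound is_glb_iff_is_bound)
  qed
qed

lemma complete_homs_homs: "h \<in> complete_homs Sg A B \<Longrightarrow> h \<in> homs Sg A B"
  by (simp add: complete_homs_def)

lemma complete_homs_compose:
  assumes A: "is_algebra Sg A" and h: "h \<in> complete_homs Sg A B" and k: "k \<in> complete_homs Sg B C"
  shows "compose (carrier A) k h \<in> complete_homs Sg A C"
  unfolding complete_homs_iff
proof (intro conjI allI impI)
  have hh: "h \<in> homs Sg A B" and kk: "k \<in> homs Sg B C"
    using h k by (auto dest: complete_homs_homs)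
  show "compose (carrier A) k h \<in> homs Sg A C" by (rule homs_compose[OF A hh kk])
  fix S s d assume S: "S \<subseteq> carrier A" and s: "is_bound (carrier A) (alg_meet Sg A) d s S"
  have "h ` S \<subseteq> carrier B" using S homs_closed[OF hh] by blast
  then have "is_bound (carrier C) (alg_meet Sg C) d (k (h s)) (k ` h ` S)"
    using h k S s by (simp add: complete_homs_iff)
  moreover have "s \<in> carrier A" using s by (simp add: is_bound_def)
  moreover have "compose (carrier A) k h ` S = k ` h ` S"
    using S by (force simp: compose_def)
  ultimately show "is_bound (carrier C) (alg_meet Sg C) d (compose (carrier A) k h s)
      (compose (carrier A) k h ` S)" by (simp add: compose_eq)
qed

text \<open>Bounds in the factors assemble to a pointwise bound \<open>t\<close> in the product. Any
  other bound of the same set equals \<open>t\<close> by antisymmetry in each coordinate, so every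
  bound is pointwise.\<close>

lemma is_bound_PiE:
  assumes m: "\<And>x. x \<in> X \<Longrightarrow> semilattice_on (C x) m"
    and M: "\<And>g h. g \<in> Pi\<^sub>E X C \<Longrightarrow> h \<in> Pi\<^sub>E X C \<Longrightarrow> M g h = (\<lambda>x\<in>X. m (g x) (h x))"
    and ex: "\<And>x F. x \<in> X \<Longrightarrow> F \<subseteq> C x \<Longrightarrow> \<exists>s. is_bound (C x) m d s F"
    and S: "S \<subseteq> Pi\<^sub>E X C"
  shows "is_bound (Pi\<^sub>E X C) M d s S \<longleftrightarrow>
      s \<in> Pi\<^sub>E X C \<and> (\<forall>x\<in>X. is_bound (C x) m d (s x) ((\<lambda>g. g x) ` S))"
    and "\<exists>s. is_bound (Pi\<^sub>E X C) M d s S"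
proof -
  have ord: "ord M d g h \<longleftrightarrow> (\<forall>x\<in>X. ord m d (g x) (h x))" if gh: "g \<in> Pi\<^sub>E X C" "h \<in> Pi\<^sub>E X C" for g h
  proof -
    have eq: "(\<lambda>x\<in>X. m (f x) (f' x)) = f \<longleftrightarrow> (\<forall>x\<in>X. m (f x) (f' x) = f x)" if "f \<in> Pi\<^sub>E X C" for f f'
    proof
      assume "\<forall>x\<in>X. m (f x) (f' x) = f x"
      then show "(\<lambda>x\<in>X. m (f x) (f' x)) = f"
        using that by (intro extensionalityI[of _ X f]) (auto simp: PiE_iff)
    next
      assume e: "(\<lambda>x\<in>X. m (f x) (f' x)) = f"
      show "\<forall>x\<in>X. m (f x) (f' x) = f x"
      proof
        fix x assume "x \<in> X"
        then show "m (f x) (f' x) = f x" using fun_cong[OF e, of x] by simp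
      qed
    qed
    show ?thesis using eq gh by (simp add: ord_def M)
  qed
  have pt: "is_bound (Pi\<^sub>E X C) M d s S"
    if s: "s \<in> Pi\<^sub>E X C" "\<And>x. x \<in> X \<Longrightarrow> is_bound (C x) m d (s x) ((\<lambda>g. g x) ` S)" for s
    unfolding is_bound_def
  proof (intro conjI ballI impI)
    show "ord M d f s" if "f \<in> S" for f
      using that s S by (subst ord) (auto simp: is_bound_def)
    fix c assume c: "c \<in> Pi\<^sub>E X C" "\<forall>f\<in>S. ord M d f c"
    show "ord M d s c"
      unfolding ord[OF s(1) c(1)]
    proof
      fix x assume x: "x \<in> X"
      have "ord m d (f x) (c x)" if "f \<in> S" for f
        using c S that x ord[of f c] by blast
      then show "ord m d (s x) (c x)" using s(2)[OF x] PiE_mem[OF c(1) x] by (auto simp: is_bound_def)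
    qed
  qed (rule s(1))
  have "\<exists>s. is_bound (C x) m d s ((\<lambda>g. g x) ` S)" if "x \<in> X" for x
    using S that by (intro ex) auto
  then obtain t0 where t0: "\<And>x. x \<in> X \<Longrightarrow> is_bound (C x) m d (t0 x) ((\<lambda>g. g x) ` S)" by metis
  define t where "t = restrict t0 X"
  have tx: "\<And>x. x \<in> X \<Longrightarrow> is_bound (C x) m d (t x) ((\<lambda>g. g x) ` S)" using t0 by (simp add: t_def)
  then have tC: "t \<in> Pi\<^sub>E X C" by (auto simp: t_def is_bound_def)
  have t: "is_bound (Pi\<^sub>E X C) M d t S" by (rule pt[OF tC tx])
  then show "\<exists>s. is_bound (Pi\<^sub>E X C) M d s S" by blast
  show "is_bound (Pi\<^sub>E X C) M d s S \<longleftrightarrow>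
      s \<in> Pi\<^sub>E X C \<and> (\<forall>x\<in>X. is_bound (C x) m d (s x) ((\<lambda>g. g x) ` S))"
  proof
    assume s: "is_bound (Pi\<^sub>E X C) M d s S"
    then have sC: "s \<in> Pi\<^sub>E X C" by (simp add: is_bound_def)
    have "ord M d s t" "ord M d t s" using s t by (auto simp: is_bound_def)
    then have "s x = t x" if "x \<in> X" for x
      using that ord[OF sC tC] ord[OF tC sC]
      by (intro ord_antisym[OF m[OF that] PiE_mem[OF sC that] PiE_mem[OF tC that], of d]) auto
    then have "s = t" by (rule PiE_ext[OF sC tC])
    then show "s \<in> Pi\<^sub>E X C \<and> (\<forall>x\<in>X. is_bound (C x) m d (s x) ((\<lambda>g. g x) ` S))"
      using tC tx by simp
  qed (use pt in blast)
qed

lemma semilattice_on_PiE: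
  assumes m: "\<And>x. x \<in> X \<Longrightarrow> semilattice_on (C x) m"
    and M: "\<And>g h. g \<in> Pi\<^sub>E X C \<Longrightarrow> h \<in> Pi\<^sub>E X C \<Longrightarrow> M g h = (\<lambda>x\<in>X. m (g x) (h x))"
  shows "semilattice_on (Pi\<^sub>E X C) M"
proof -
  have cl: "M g h \<in> Pi\<^sub>E X C" if "g \<in> Pi\<^sub>E X C" "h \<in> Pi\<^sub>E X C" for g h
    using semilattice_onD(1)[OF m PiE_mem[OF that(1)] PiE_mem[OF that(2)]] by (simp add: M[OF that])
  have v: "M g h x = m (g x) (h x)" if "g \<in> Pi\<^sub>E X C" "h \<in> Pi\<^sub>E X C" "x \<in> X" for g h x
    using that by (simp add: M)
  show ?thesis
    unfolding semilattice_on_def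
  proof (intro ballI conjI)
    fix f g h assume f: "f \<in> Pi\<^sub>E X C" and g: "g \<in> Pi\<^sub>E X C" and h: "h \<in> Pi\<^sub>E X C"
    have mem: "f x \<in> C x" "g x \<in> C x" "h x \<in> C x" if "x \<in> X" for x
      using that f g h by auto
    show "M f g \<in> Pi\<^sub>E X C" by (rule cl[OF f g])
    show "M f f = f"
      by (rule PiE_ext[OF cl[OF f f] f]) (simp add: v f semilattice_onD(2)[OF m mem(1)])
    show "M f g = M g f"
      by (rule PiE_ext[OF cl[OF f g] cl[OF g f]])
        (simp add: v f g semilattice_onD(3)[OF m mem(1,2)])
    show "M (M f g) h = M f (M g h)"
      by (rule PiE_ext[OF cl[OF cl[OF f g] h] cl[OF f cl[OF g h]]])
        (simp add: v cl f g h semilattice_onD(4)[OF m mem])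
  qed
qed

section \<open>Suprema and infima in sublattices of L\<close>

context semi_primal_lattice_algebra
begin

text \<open>Subalgebras satisfy this, and so does {0, 1}, which need not be closed under the other
  operations but supplies the factors of a skeleton.\<close>

definition sublattice :: "'l set \<Rightarrow> bool" where
  "sublattice C \<longleftrightarrow> C \<subseteq> carrier L \<and> zero \<in> C \<and> one \<in> C \<and>
     (\<forall>a\<in>C. \<forall>b\<in>C. alg_meet Sg L a b \<in> C \<and> alg_join Sg L a b \<in> C)"

lemma sublattice_subalgebra: "C \<in> subalgebras Sg L \<Longrightarrow> sublattice C"
  using subalgebra_lattice_ops by (simp add: sublattice_def subalgebras_def)

lemma sublattice_carrier: "sublattice (carrier L)"
  by (rule sublattice_subalgebra[OF carrier_subalgebra])

lemma L_ops_closed: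
  "zero \<in> carrier L" "one \<in> carrier L"
  "a \<in> carrier L \<Longrightarrow> b \<in> carrier L \<Longrightarrow> alg_meet Sg L a b \<in> carrier L"
  "a \<in> carrier L \<Longrightarrow> b \<in> carrier L \<Longrightarrow> alg_join Sg L a b \<in> carrier L"
  using sublattice_carrier by (auto simp: sublattice_def)

lemma semilattice_L: "semilattice_on (carrier L) (alg_meet Sg L)"
proof -
  have "alg_meet Sg L x x = x" if "x \<in> carrier L" for x
    using lattice_L(5)[OF that L_ops_closed(1) that] lattice_L(8)[OF that that that] by simp
  then show ?thesis
    unfolding semilattice_on_def
    by (intro ballI conjI) (assumption | rule L_ops_closed(3) lattice_L(1,3) | simp)+
qed

lemma semilattice_on_sublattice:
  assumes "sublattice C" shows "semilattice_on C (alg_meet Sg L)"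
  unfolding semilattice_on_def
proof (intro ballI conjI)
  fix x y z assume "x \<in> C" "y \<in> C" "z \<in> C"
  moreover from this have "x \<in> carrier L" "y \<in> carrier L" "z \<in> carrier L"
    using assms unfolding sublattice_def by blast+
  moreover note D = semilattice_onD[OF semilattice_L]
  ultimately show "alg_meet Sg L x y \<in> C" "alg_meet Sg L x x = x" "alg_meet Sg L x y = alg_meet Sg L y x"
    "alg_meet Sg L (alg_meet Sg L x y) z = alg_meet Sg L x (alg_meet Sg L y z)"
    using assms D(2)[of x] D(3)[of x y] D(4)[of x y z] unfolding sublattice_def by blast+
qed

lemma meet_eq_iff_join_eq:
  assumes "a \<in> carrier L" "b \<in> carrier L"
  shows "alg_meet Sg L a b = a \<longleftrightarrow> alg_join Sg L a b = b"
proof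
  assume "alg_meet Sg L a b = a"
  then show "alg_join Sg L a b = b"
    using lattice_L(1,2)[OF assms(2,1,1)] lattice_L(6)[OF assms(2,1,1)] by metis
next
  assume "alg_join Sg L a b = b"
  then show "alg_meet Sg L a b = a" using lattice_L(5)[OF assms assms(1)] by simp
qed

text \<open>All subsets are finite, so induction from 0, 1 and the binary operations suffices. The
  bound lies in \<open>C\<close> but is taken with respect to all of L, which makes bounds in
  different sublattices comparable.\<close>

lemma sublattice_bounds:
  assumes C: "sublattice C" and F: "F \<subseteq> C"
  shows "\<exists>s\<in>C. is_bound (carrier L) (alg_meet Sg L) d s F"
proof -
  let ?m = "alg_meet Sg L" and ?L = "carrier L"
  note tr = ord_trans[OF semilattice_L] and CL = C[unfolded sublattice_def, THEN conjunct1]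
  have bin: "\<exists>s\<in>C. is_bound ?L ?m d s {a, b}" if ab: "a \<in> C" "b \<in> C" for a b
  proof (cases d)
    case True
    let ?j = "alg_join Sg L a b"
    note ab_L = subsetD[OF CL ab(1)] subsetD[OF CL ab(2)]
    note L = ab_L L_ops_closed(4)[OF ab_L]
    have "is_bound ?L ?m True ?j {a, b}"
      unfolding is_bound_def ord_def
    proof (simp, intro conjI ballI impI)
      show "?m a ?j = a" using lattice_L(5)[OF L(1,2,2)] .
      show "?m b ?j = b" using lattice_L(5)[OF L(2,1,1)] lattice_L(2)[OF L(1,2,2)] by simp
      fix c assume c: "c \<in> ?L" "?m a c = a \<and> ?m b c = b"
      then have "alg_join Sg L a c = c" "alg_join Sg L b c = c"
        using L meet_eq_iff_join_eq by auto
      then show "?m ?j c = ?j"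
        using lattice_L(4)[OF L(1,2) c(1)] meet_eq_iff_join_eq[OF L(3) c(1)] by simp
    qed (rule L(3))
    moreover have "?j \<in> C" using C ab by (simp add: sublattice_def)
    ultimately show ?thesis using True by auto
  next
    case False
    let ?j = "?m a b"
    note ab_L = subsetD[OF CL ab(1)] subsetD[OF CL ab(2)]
    note L = ab_L L_ops_closed(3)[OF ab_L]
    note idem = semilattice_onD(2)[OF semilattice_L]
    have "is_bound ?L ?m False ?j {a, b}"
      unfolding is_bound_def ord_def
    proof (simp, intro conjI ballI impI)
      show "?m ?j a = ?j"
        using lattice_L(3)[OF L(1,1,2)] lattice_L(1)[OF L(3,1,1)] idem[OF L(1)] by metis
      show "?m ?j b = ?j" using lattice_L(3)[OF L(1,2,2)] idem[OF L(2)] by simp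
      fix c assume c: "c \<in> ?L" "?m c a = c \<and> ?m c b = c"
      then show "?m c ?j = c" using lattice_L(3)[OF c(1) L(1,2)] by simp
    qed (rule L(3))
    moreover have "?j \<in> C" using C ab by (simp add: sublattice_def)
    ultimately show ?thesis using False by auto
  qed
  have "finite F" using F CL finite_carrier by (meson finite_subset)
  then show ?thesis using F
  proof (induction rule: finite_induct)
    case empty
    have "?m zero c = zero" "?m c one = c" if "c \<in> ?L" for c
      using that meet_eq_iff_join_eq[of zero c] lattice_L(2,8)[of c zero zero]
        lattice_L(7)[of c one one] L_ops_closed(1,2) by metis+
    then have "is_bound ?L ?m d (if d then zero else one) {}"
      using L_ops_closed by (auto simp: is_bound_def ord_def)
    moreover have "(if d then zero else one) \<in> C" using C by (simp add: sublattice_def)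
    ultimately show ?case by blast
  next
    case (insert a F)
    then obtain s where s: "s \<in> C" "is_bound ?L ?m d s F" by auto
    obtain t where t: "t \<in> C" "is_bound ?L ?m d t {a, s}" using bin[of a s] s insert by auto
    have at: "ord ?m d a t" "ord ?m d s t" "\<And>c. c \<in> ?L \<Longrightarrow> ord ?m d a c \<Longrightarrow> ord ?m d s c \<Longrightarrow> ord ?m d t c"
      using t(2) by (auto simp: is_bound_def)
    have inL: "s \<in> ?L" "t \<in> ?L" "\<And>f. f \<in> F \<Longrightarrow> f \<in> ?L" using s(1) t(1) insert.prems CL by blast+
    have "is_bound ?L ?m d t (insert a F)"
      unfolding is_bound_def
    proof (intro conjI ballI impI)
      show "ord ?m d f t" if "f \<in> insert a F" for f
        using that at s(2) tr[OF inL(3) inL(1,2), of f d] by (auto simp: is_bound_def)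
      show "ord ?m d t c" if "c \<in> ?L" "\<forall>f\<in>insert a F. ord ?m d f c" for c
        using that s(2) by (intro at(3)) (auto simp: is_bound_def)
    qed (rule inL(2))
    then show ?case using t(1) by blast
  qed
qed

text \<open>Reindexing moves a coordinate from one label into a larger one; the bounds survive
  because each label computes them as L does.\<close>

lemma is_bound_sublattice:
  assumes C: "sublattice C" and F: "F \<subseteq> C" and s: "s \<in> C"
  shows "is_bound C (alg_meet Sg L) d s F \<longleftrightarrow> is_bound (carrier L) (alg_meet Sg L) d s F"
proof
  have CL: "C \<subseteq> carrier L" using C by (simp add: sublattice_def)
  have res: "is_bound C (alg_meet Sg L) d t F"
    if "is_bound (carrier L) (alg_meet Sg L) d t F" "t \<in> C" for t
    using that CL by (auto simp: is_bound_def)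
  show "is_bound C (alg_meet Sg L) d s F" if "is_bound (carrier L) (alg_meet Sg L) d s F"
    by (rule res[OF that s])
  assume "is_bound C (alg_meet Sg L) d s F"
  moreover obtain t where "t \<in> C" "is_bound (carrier L) (alg_meet Sg L) d t F"
    using sublattice_bounds[OF C F] by blast
  ultimately show "is_bound (carrier L) (alg_meet Sg L) d s F"
    using res is_bound_unique[OF semilattice_on_sublattice[OF C]] by metis
qed

lemma sublattice_bounds_in:
  assumes "sublattice C" "F \<subseteq> C"
  shows "\<exists>s. is_bound C (alg_meet Sg L) d s F"
proof -
  obtain s where "s \<in> C" "is_bound (carrier L) (alg_meet Sg L) d s F"
    using sublattice_bounds[OF assms] by blast
  then show ?thesis using is_bound_sublattice[OF assms] by blast
qed

end

section \<open>Products of subalgebras\<close>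

context semi_primal_lattice_algebra
begin

text \<open>The projections are homomorphisms to L and separate points.\<close>

lemma subalgebra_of_power:
  assumes S: "S \<subseteq> X \<rightarrow>\<^sub>E carrier L" "closed_under_ops Sg (alg_power L X) S"
  shows "is_algebra Sg ((alg_power L X)\<lparr>carrier := S\<rparr>)"
    and "in_HSP Sg L ((alg_power L X)\<lparr>carrier := S\<rparr>)"
proof -
  let ?A = "(alg_power L X)\<lparr>carrier := S\<rparr>"
  show A: "is_algebra Sg ?A"
    using S by (intro is_algebra_carrier_update) (auto simp: subalgebras_def alg_power_def)
  show "in_HSP Sg L ?A"
  proof (rule in_HSP_if_separated[OF A])
    fix g h assume gh: "g \<in> carrier ?A" "h \<in> carrier ?A"
      and eq: "\<And>u. u \<in> homs Sg ?A L \<Longrightarrow> u g = u h"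
    have gh_S: "g \<in> S" "h \<in> S" using gh by simp_all
    have "g x = h x" if "x \<in> X" for x
      using eq[OF proj_homs[OF S that]] gh_S by simp
    then show "g = h" using gh_S S(1) by (intro PiE_ext[of g X "\<lambda>_. carrier L" h]) auto
  qed
qed

lemma PiE_subalgebras:
  assumes v: "v \<in> X \<rightarrow>\<^sub>E subalgebras Sg L"
  shows "Pi\<^sub>E X v \<subseteq> X \<rightarrow>\<^sub>E carrier L" "closed_under_ops Sg (alg_power L X) (Pi\<^sub>E X v)"
proof -
  have vx: "v x \<in> subalgebras Sg L" if "x \<in> X" for x using v that by auto
  show "Pi\<^sub>E X v \<subseteq> X \<rightarrow>\<^sub>E carrier L"
    using vx by (intro PiE_mono) (auto simp: subalgebras_def)
  show "closed_under_ops Sg (alg_power L X) (Pi\<^sub>E X v)"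
    unfolding closed_under_ops_def
  proof (intro allI impI)
    fix f gs assume gs: "length gs = arity Sg f \<and> set gs \<subseteq> Pi\<^sub>E X v"
    have "interp L f (map (\<lambda>g. g x) gs) \<in> v x" if "x \<in> X" for x
    proof -
      have "set (map (\<lambda>g. g x) gs) \<subseteq> v x" using gs that by auto
      then show ?thesis using vx[OF that] gs by (simp add: subalgebras_def closed_under_ops_def)
    qed
    then show "interp (alg_power L X) f gs \<in> Pi\<^sub>E X v" by (simp add: alg_power_def)
  qed
qed

lemma carrier_PiD_obj [simp]: "carrier (PiD_obj L (X, v)) = Pi\<^sub>E X v"
  by (simp add: PiD_obj_def)

lemma PiD_obj_algebra:
  assumes "v \<in> X \<rightarrow>\<^sub>E subalgebras Sg L"
  shows "is_algebra Sg (PiD_obj L (X, v))" "in_HSP Sg L (PiD_obj L (X, v))"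
  using subalgebra_of_power[OF PiE_subalgebras[OF assms]] by (simp_all add: PiD_obj_def)

lemma PiD_proj_homs:
  assumes "v \<in> X \<rightarrow>\<^sub>E subalgebras Sg L" "x \<in> X"
  shows "(\<lambda>g\<in>Pi\<^sub>E X v. g x) \<in> homs Sg (PiD_obj L (X, v)) L"
  using proj_homs[OF PiE_subalgebras[OF assms(1)] assms(2)] by (simp add: PiD_obj_def)

lemma PiD_meet: "alg_meet Sg (PiD_obj L (X, v)) g h = (\<lambda>x\<in>X. alg_meet Sg L (g x) (h x))"
  and PiD_join: "alg_join Sg (PiD_obj L (X, v)) g h = (\<lambda>x\<in>X. alg_join Sg L (g x) (h x))"
  and PiD_bot: "alg_bot Sg (PiD_obj L (X, v)) = (\<lambda>x\<in>X. zero)"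
  and PiD_top: "alg_top Sg (PiD_obj L (X, v)) = (\<lambda>x\<in>X. one)"
  by (simp_all add: PiD_obj_def alg_power_def alg_meet_def alg_join_def alg_bot_def alg_top_def)

lemma PiD_char_op:
  assumes v: "v \<in> X \<rightarrow>\<^sub>E subalgebras Sg L" and g: "g \<in> Pi\<^sub>E X v"
  shows "char_op Sg L (PiD_obj L (X, v)) l g = (\<lambda>x\<in>X. if g x = l then one else zero)"
proof -
  let ?A = "PiD_obj L (X, v)"
  have T: "char_op Sg L ?A l g \<in> Pi\<^sub>E X v"
    using char_op_closed[OF PiD_obj_algebra(1)[OF v], of g l] g by simp
  have "char_op Sg L ?A l g x = (if g x = l then one else zero)" if "x \<in> X" for x
    using char_op_hom[OF PiD_obj_algebra(1)[OF v] PiD_proj_homs[OF v that], of g l] g T by simp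
  then show ?thesis
    using T by (intro extensionalityI[of _ X]) (auto simp: PiE_iff)
qed

lemma sublattice_values: "v \<in> X \<rightarrow>\<^sub>E subalgebras Sg L \<Longrightarrow> x \<in> X \<Longrightarrow> sublattice (v x)"
  using PiE_mem sublattice_subalgebra by metis

lemma PiD_bounds:
  assumes v: "v \<in> X \<rightarrow>\<^sub>E subalgebras Sg L" and S: "S \<subseteq> Pi\<^sub>E X v"
  shows "is_bound (Pi\<^sub>E X v) (alg_meet Sg (PiD_obj L (X, v))) d s S \<longleftrightarrow>
    s \<in> Pi\<^sub>E X v \<and> (\<forall>x\<in>X. is_bound (carrier L) (alg_meet Sg L) d (s x) ((\<lambda>g. g x) ` S))"
proof -
  have "is_bound (Pi\<^sub>E X v) (alg_meet Sg (PiD_obj L (X, v))) d s S \<longleftrightarrow>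
    s \<in> Pi\<^sub>E X v \<and> (\<forall>x\<in>X. is_bound (v x) (alg_meet Sg L) d (s x) ((\<lambda>g. g x) ` S))"
    by (rule is_bound_PiE(1)[OF semilattice_on_sublattice _ sublattice_bounds_in])
      (use sublattice_values[OF v] S in \<open>auto simp: PiD_meet\<close>)
  moreover have "is_bound (v x) (alg_meet Sg L) d (s x) ((\<lambda>g. g x) ` S) \<longleftrightarrow>
      is_bound (carrier L) (alg_meet Sg L) d (s x) ((\<lambda>g. g x) ` S)"
    if "s \<in> Pi\<^sub>E X v" "x \<in> X" for x
    using that S by (intro is_bound_sublattice sublattice_values[OF v]) auto
  ultimately show ?thesis by blast
qed

text \<open>The factors \<open>C\<close> are independent of the labels \<open>v\<close> because the
  meet of the product is used on two carriers: the whole product, and the skeleton with all factors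
  {0, 1}.\<close>

lemma complete_lattice_PiE:
  assumes "\<And>x. x \<in> X \<Longrightarrow> sublattice (C x)"
  shows "complete_lattice (meet_order (Pi\<^sub>E X C) (alg_meet Sg (PiD_obj L (X, v))))"
proof (rule complete_lattice_meet_order)
  note m = semilattice_on_sublattice[OF assms]
  show "semilattice_on (Pi\<^sub>E X C) (alg_meet Sg (PiD_obj L (X, v)))"
    by (rule semilattice_on_PiE[where m = "alg_meet Sg L", OF m PiD_meet])
  show "\<exists>s. is_bound (Pi\<^sub>E X C) (alg_meet Sg (PiD_obj L (X, v))) d s S" if "S \<subseteq> Pi\<^sub>E X C" for S d
    by (rule is_bound_PiE(2)[where m = "alg_meet Sg L", OF m PiD_meet _ that])
      (assumption | rule sublattice_bounds_in[OF assms])+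
qed

section \<open>The Boolean skeleton of a product and its atoms\<close>

lemma L_zero_one:
  "alg_meet Sg L zero zero = zero" "alg_meet Sg L zero one = zero" "alg_meet Sg L one zero = zero"
  "alg_meet Sg L one one = one" "alg_join Sg L zero zero = zero" "alg_join Sg L zero one = one"
  "alg_join Sg L one zero = one" "alg_join Sg L one one = one"
proof -
  note z = L_ops_closed(1) and e = L_ops_closed(2)
  show "alg_meet Sg L zero zero = zero" "alg_meet Sg L one one = one"
    by (rule semilattice_onD(2)[OF semilattice_L z], rule semilattice_onD(2)[OF semilattice_L e])
  show zo: "alg_meet Sg L zero one = zero" by (rule lattice_L(7)[OF z z z])
  then show "alg_meet Sg L one zero = zero" using lattice_L(1)[OF z e e] by simp
  show "alg_join Sg L zero zero = zero" by (rule lattice_L(8)[OF z z z])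
  show oz: "alg_join Sg L one zero = one" by (rule lattice_L(8)[OF e e e])
  then show "alg_join Sg L zero one = one" using lattice_L(2)[OF z e e] by simp
  show "alg_join Sg L one one = one"
    using meet_eq_iff_join_eq[OF e e] semilattice_onD(2)[OF semilattice_L e] by simp
qed

lemma sublattice_zero_one: "sublattice {zero, one}"
  using L_ops_closed by (auto simp: sublattice_def L_zero_one)

text \<open>\<open>T_1 g\<close> is the indicator of the coordinates where \<open>g\<close> is 1, so
  its fixed points are the 0-1 valued functions. Each of these lies in the product since every label
  contains 0 and 1.\<close>

lemma skeleton_PiD:
  assumes v: "v \<in> X \<rightarrow>\<^sub>E subalgebras Sg L"
  shows "skeleton Sg L (PiD_obj L (X, v)) = X \<rightarrow>\<^sub>E {zero, one}"
proof
  show "skeleton Sg L (PiD_obj L (X, v)) \<subseteq> X \<rightarrow>\<^sub>E {zero, one}"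
  proof
    fix g assume "g \<in> skeleton Sg L (PiD_obj L (X, v))"
    then have "g \<in> Pi\<^sub>E X v" "char_op Sg L (PiD_obj L (X, v)) one g = g"
      by (auto simp: skeleton_def)
    then have "g = (\<lambda>x\<in>X. if g x = one then one else zero)" using PiD_char_op[OF v] by metis
    moreover have "(\<lambda>x\<in>X. if g x = one then one else zero) \<in> X \<rightarrow>\<^sub>E {zero, one}" by auto
    ultimately show "g \<in> X \<rightarrow>\<^sub>E {zero, one}" by metis
  qed
  show "X \<rightarrow>\<^sub>E {zero, one} \<subseteq> skeleton Sg L (PiD_obj L (X, v))"
  proof
    fix g assume g: "g \<in> X \<rightarrow>\<^sub>E {zero, one}"
    have "{zero, one} \<subseteq> v x" if "x \<in> X" for x
      using sublattice_values[OF v that] by (simp add: sublattice_def)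
    then have gv: "g \<in> Pi\<^sub>E X v" using g by (auto simp: PiE_iff)
    have "(\<lambda>x\<in>X. if g x = one then one else zero) = g"
      using g by (intro extensionalityI[of _ X g]) (auto simp: PiE_iff)
    then show "g \<in> skeleton Sg L (PiD_obj L (X, v))"
      using gv PiD_char_op[OF v gv] by (simp add: skeleton_def)
  qed
qed

text \<open>L need not be distributive. The laws hold because only the values 0 and 1 occur, so they
  are read off coordinatewise from \<open>L_zero_one\<close>.\<close>

lemma boolean_algebra_PiD:
  assumes v: "v \<in> X \<rightarrow>\<^sub>E subalgebras Sg L"
  defines "A \<equiv> PiD_obj L (X, v)"
  shows "boolean_algebra_on (X \<rightarrow>\<^sub>E {zero, one}) (alg_meet Sg A) (alg_join Sg A)
    (char_op Sg L A zero) (alg_bot Sg A) (alg_top Sg A)"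
proof -
  have eqI: "g = h" if "g \<in> extensional X" "h \<in> X \<rightarrow>\<^sub>E {zero, one}" "\<And>x. x \<in> X \<Longrightarrow> g x = h x" for g h
    using that by (intro extensionalityI[of g X h]) (auto simp: PiE_iff)
  have val: "g x = zero \<or> g x = one" if "g \<in> X \<rightarrow>\<^sub>E {zero, one}" "x \<in> X" for g x
    using PiE_mem[OF that] by auto
  have cl: "(\<lambda>x\<in>X. f (g x) (h x)) \<in> X \<rightarrow>\<^sub>E {zero, one}"
    if "g \<in> X \<rightarrow>\<^sub>E {zero, one}" "h \<in> X \<rightarrow>\<^sub>E {zero, one}" "f = alg_meet Sg L \<or> f = alg_join Sg L"
    for f g h
  proof -
    have "f (g x) (h x) \<in> {zero, one}" if "x \<in> X" for x
      using val[OF \<open>g \<in> _\<close> that] val[OF \<open>h \<in> _\<close> that] \<open>f = _ \<or> _\<close> L_zero_one by auto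
    then show ?thesis by simp
  qed
  have "X \<rightarrow>\<^sub>E {zero, one} \<subseteq> Pi\<^sub>E X v"
    using skeleton_PiD[OF v] by (auto simp: skeleton_def)
  then have T: "char_op Sg L A zero g = (\<lambda>x\<in>X. if g x = zero then one else zero)"
    if "g \<in> X \<rightarrow>\<^sub>E {zero, one}" for g
    using PiD_char_op[OF v] that unfolding A_def by blast
  have ops: "alg_meet Sg A = (\<lambda>g h. \<lambda>x\<in>X. alg_meet Sg L (g x) (h x))"
    "alg_join Sg A = (\<lambda>g h. \<lambda>x\<in>X. alg_join Sg L (g x) (h x))"
    by (intro ext, simp add: A_def PiD_meet PiD_join)+
  show ?thesis
    unfolding boolean_algebra_on_def ops
  proof (intro conjI ballI)
    show "alg_bot Sg A \<in> X \<rightarrow>\<^sub>E {zero, one}" "alg_top Sg A \<in> X \<rightarrow>\<^sub>E {zero, one}"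
      by (simp_all add: A_def PiD_bot PiD_top)
  next
    fix g h assume gh: "g \<in> X \<rightarrow>\<^sub>E {zero, one}" "h \<in> X \<rightarrow>\<^sub>E {zero, one}"
    show "(\<lambda>x\<in>X. alg_meet Sg L (g x) (h x)) \<in> X \<rightarrow>\<^sub>E {zero, one}"
      "(\<lambda>x\<in>X. alg_join Sg L (g x) (h x)) \<in> X \<rightarrow>\<^sub>E {zero, one}"
      using cl gh by auto
    have "alg_meet Sg L (g x) (h x) = alg_meet Sg L (h x) (g x)"
      "alg_join Sg L (g x) (h x) = alg_join Sg L (h x) (g x)" if "x \<in> X" for x
      using val[OF gh(1) that] val[OF gh(2) that] L_zero_one by auto
    then show "(\<lambda>x\<in>X. alg_meet Sg L (g x) (h x)) = (\<lambda>x\<in>X. alg_meet Sg L (h x) (g x))"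
      "(\<lambda>x\<in>X. alg_join Sg L (g x) (h x)) = (\<lambda>x\<in>X. alg_join Sg L (h x) (g x))"
      by (auto intro: restrict_ext)
  next
    fix f g h assume fgh: "f \<in> X \<rightarrow>\<^sub>E {zero, one}" "g \<in> X \<rightarrow>\<^sub>E {zero, one}" "h \<in> X \<rightarrow>\<^sub>E {zero, one}"
    note cases = val[OF fgh(1)] val[OF fgh(2)] val[OF fgh(3)]
    show "(\<lambda>x\<in>X. alg_meet Sg L (f x) ((\<lambda>x\<in>X. alg_join Sg L (g x) (h x)) x)) =
        (\<lambda>x\<in>X. alg_join Sg L ((\<lambda>x\<in>X. alg_meet Sg L (f x) (g x)) x)
          ((\<lambda>x\<in>X. alg_meet Sg L (f x) (h x)) x))"
      by (rule restrict_ext) (use cases in \<open>force simp: L_zero_one\<close>)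
    show "(\<lambda>x\<in>X. alg_join Sg L (f x) ((\<lambda>x\<in>X. alg_meet Sg L (g x) (h x)) x)) =
        (\<lambda>x\<in>X. alg_meet Sg L ((\<lambda>x\<in>X. alg_join Sg L (f x) (g x)) x)
          ((\<lambda>x\<in>X. alg_join Sg L (f x) (h x)) x))"
      by (rule restrict_ext) (use cases in \<open>force simp: L_zero_one\<close>)
  next
    fix g assume g: "g \<in> X \<rightarrow>\<^sub>E {zero, one}"
    note val = val[OF g]
    show "(\<lambda>x\<in>X. alg_meet Sg L (g x) (alg_top Sg A x)) = g"
      "(\<lambda>x\<in>X. alg_join Sg L (g x) (alg_bot Sg A x)) = g"
      by (rule eqI[OF _ g], simp, use val in \<open>force simp: A_def PiD_top PiD_bot L_zero_one\<close>)+
    show "char_op Sg L A zero g \<in> X \<rightarrow>\<^sub>E {zero, one}" by (simp add: T[OF g])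
    show "(\<lambda>x\<in>X. alg_meet Sg L (g x) (char_op Sg L A zero g x)) = alg_bot Sg A"
      unfolding A_def PiD_bot unfolding A_def[symmetric]
      by (rule restrict_ext) (use val bot_neq_top in \<open>force simp: T[OF g] L_zero_one\<close>)
    show "(\<lambda>x\<in>X. alg_join Sg L (g x) (char_op Sg L A zero g x)) = alg_top Sg A"
      unfolding A_def PiD_top unfolding A_def[symmetric]
      by (rule restrict_ext) (use val bot_neq_top in \<open>force simp: T[OF g] L_zero_one\<close>)
  qed
qed

text \<open>For \<open>y\<close> in \<open>X\<close> these indicators are the atoms of the skeleton
  of a product over \<open>X\<close>.\<close>

definition point :: "'x set \<Rightarrow> 'x \<Rightarrow> 'x \<Rightarrow> 'l" where
  "point X y = (\<lambda>x\<in>X. if x = y then one else zero)"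

lemma point_in_PiD:
  assumes "v \<in> X \<rightarrow>\<^sub>E subalgebras Sg L"
  shows "point X y \<in> Pi\<^sub>E X v"
proof -
  have "{zero, one} \<subseteq> v x" if "x \<in> X" for x
    using sublattice_values[OF assms that] by (simp add: sublattice_def)
  then show ?thesis by (auto simp: point_def)
qed

lemma in_CAA_PiD:
  assumes v: "v \<in> X \<rightarrow>\<^sub>E subalgebras Sg L"
  shows "in_CAA Sg L (PiD_obj L (X, v))"
proof -
  let ?A = "PiD_obj L (X, v)"
  have "complete_lattice (lat_reduct Sg ?A)"
    using complete_lattice_PiE[OF sublattice_values[OF v]] by (simp add: lat_reduct_def)
  moreover have "complete_lattice (meet_order (X \<rightarrow>\<^sub>E {zero, one}) (alg_meet Sg ?A))"
    by (rule complete_lattice_PiE[OF sublattice_zero_one])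
  moreover have "\<exists>a. atom_on (X \<rightarrow>\<^sub>E {zero, one}) (alg_meet Sg ?A) (alg_bot Sg ?A) a \<and> alg_meet Sg ?A a b = a"
    if b: "b \<in> X \<rightarrow>\<^sub>E {zero, one}" "b \<noteq> alg_bot Sg ?A" for b
  proof -
    have "\<exists>y\<in>X. b y \<noteq> zero"
    proof (rule ccontr)
      assume "\<not> ?thesis"
      then have "b = alg_bot Sg ?A"
        using b(1) unfolding PiD_bot by (intro extensionalityI[of b X]) (auto simp: PiE_iff)
      then show False using b(2) by simp
    qed
    \<comment> \<open>A nonzero coordinate of a 0-1 valued function is 1, so the atom at
      \<open>y\<close> lies below \<open>b\<close>.\<close>
    then obtain y where y: "y \<in> X" "b y = one" using PiE_mem[OF b(1)] by auto
    have p: "point X y \<in> X \<rightarrow>\<^sub>E {zero, one}" by (auto simp: point_def)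
    have below: "alg_meet Sg ?A (point X y) b = point X y"
      unfolding PiD_meet point_def
      by (rule restrict_ext) (use PiE_mem[OF b(1)] y L_zero_one in force)
    have "point X y y = one" using y(1) by (simp add: point_def)
    then have "point X y \<noteq> alg_bot Sg ?A" using y(1) bot_neq_top by (auto simp: PiD_bot)
    moreover have "c = alg_bot Sg ?A \<or> c = point X y"
      if c: "c \<in> X \<rightarrow>\<^sub>E {zero, one}" "alg_meet Sg ?A c (point X y) = c" for c
    proof -
      \<comment> \<open>An element of the skeleton below the atom at \<open>y\<close> vanishes off
        \<open>y\<close>; its value at \<open>y\<close> then decides between bottom and the
        atom.\<close>
      have cx: "c x = zero" if "x \<in> X" "x \<noteq> y" for x
      proof -
        have "c x = alg_meet Sg L (c x) zero"
          using fun_cong[OF c(2), of x] that by (simp add: PiD_meet point_def)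
        then show ?thesis using PiE_mem[OF c(1) that(1)] L_zero_one by auto
      qed
      have "c y = zero \<or> c y = one" using PiE_mem[OF c(1) y(1)] by auto
      then have "(\<forall>x\<in>X. c x = (\<lambda>x\<in>X. zero) x) \<or> (\<forall>x\<in>X. c x = point X y x)"
        using cx by (auto simp: point_def)
      moreover have "c = d" if "\<forall>x\<in>X. c x = d x" "d \<in> extensional X" for d
        using c(1) that by (intro extensionalityI[of c X d]) (auto simp: PiE_iff)
      moreover have "point X y \<in> extensional X" by (simp add: point_def)
      ultimately show ?thesis
        unfolding PiD_bot by (metis restrict_extensional)
    qed
    ultimately show ?thesis using p below by (auto simp: atom_on_def)
  qed
  ultimately show ?thesis
    using boolean_algebra_PiD[OF v] PiD_obj_algebra(2)[OF v]
    by (simp add: in_CAA_def complete_atomic_boolean_on_def skeleton_PiD[OF v])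
qed

end

section \<open>Functors\<close>

lemma covariant_functorD:
  assumes "covariant_functor C D F"
  shows "X \<in> Obj C \<Longrightarrow> on_obj F X \<in> Obj D"
    and "X \<in> Obj C \<Longrightarrow> on_mor F X X (ident C X) = ident D (on_obj F X)"
    and "X \<in> Obj C \<Longrightarrow> Y \<in> Obj C \<Longrightarrow> f \<in> Hom C X Y
      \<Longrightarrow> on_mor F X Y f \<in> Hom D (on_obj F X) (on_obj F Y)"
    and "X \<in> Obj C \<Longrightarrow> Y \<in> Obj C \<Longrightarrow> Z \<in> Obj C \<Longrightarrow> f \<in> Hom C X Y \<Longrightarrow> g \<in> Hom C Y Z
      \<Longrightarrow> on_mor F X Z (compose (Und C X) g f)
        = compose (Und D (on_obj F X)) (on_mor F Y Z g) (on_mor F X Y f)"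
  using assms unfolding covariant_functor_def by blast+

lemma contravariant_functorD:
  assumes "contravariant_functor C D F"
  shows "X \<in> Obj C \<Longrightarrow> on_obj F X \<in> Obj D"
    and "X \<in> Obj C \<Longrightarrow> on_mor F X X (ident C X) = ident D (on_obj F X)"
    and "X \<in> Obj C \<Longrightarrow> Y \<in> Obj C \<Longrightarrow> f \<in> Hom C X Y
      \<Longrightarrow> on_mor F X Y f \<in> Hom D (on_obj F Y) (on_obj F X)"
    and "X \<in> Obj C \<Longrightarrow> Y \<in> Obj C \<Longrightarrow> Z \<in> Obj C \<Longrightarrow> f \<in> Hom C X Y \<Longrightarrow> g \<in> Hom C Y Z
      \<Longrightarrow> on_mor F X Z (compose (Und C X) g f)
        = compose (Und D (on_obj F Z)) (on_mor F X Y f) (on_mor F Y Z g)"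
  using assms unfolding contravariant_functor_def by blast+

lemma contravariant_after_contravariant:
  assumes F: "contravariant_functor C D F" and G: "contravariant_functor D E G"
  shows "covariant_functor C E (after_contravariant G F)"
proof -
  note F' = contravariant_functorD[OF F] and G' = contravariant_functorD[OF G]
  show ?thesis
    unfolding covariant_functor_def after_contravariant_def
    by (simp add: F' G')
qed

lemma contravariant_after_covariant:
  assumes F: "covariant_functor C D F" and G: "contravariant_functor D E G"
  shows "contravariant_functor C E (after_covariant G F)"
proof -
  note F' = covariant_functorD[OF F] and G' = contravariant_functorD[OF G]
  show ?thesis
    unfolding contravariant_functor_def after_covariant_def
    by (simp add: F' G')
qed

lemma covariant_after_contravariant:
  assumes F: "contravariant_functor C D F" and G: "covariant_functor D E G"
  shows "contravariant_functor C E (after_contravariant G F)"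
proof -
  note F' = contravariant_functorD[OF F] and G' = covariant_functorD[OF G]
  show ?thesis
    unfolding contravariant_functor_def after_contravariant_def
    by (simp add: F' G')
qed

lemma iota_c_covariant: "covariant_functor (CAA_cat Sg L) (Var_cat Sg L) iota_c"
  by (auto simp: covariant_functor_def CAA_cat_def Var_cat_def iota_c_def ident_def in_CAA_def
      dest: complete_homs_homs)

section \<open>The product functor and the spectrum as contravariant functors\<close>

context semi_primal_lattice_algebra
begin

lemma SetL_simps:
  "(X, v) \<in> Obj (SetL_cat Sg L) \<longleftrightarrow> v \<in> X \<rightarrow>\<^sub>E subalgebras Sg L"
  "Und (SetL_cat Sg L) = fst"
  "m \<in> Hom (SetL_cat Sg L) (X, v) (Y, w) \<longleftrightarrow> m \<in> X \<rightarrow>\<^sub>E Y \<and> (\<forall>x\<in>X. w (m x) \<subseteq> v x)"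
  by (simp_all add: SetL_cat_def)

lemma PiD_on_mor:
  "on_mor (PiD L) (X, v) (Y, w) m = (\<lambda>g\<in>Pi\<^sub>E Y w. compose X g m)"
  "on_obj (PiD L) = PiD_obj L"
  by (simp_all add: PiD_def)

text \<open>Bounds are coordinatewise and computed in L, and coordinate \<open>x\<close> of a
  reindexed family is coordinate \<open>m x\<close> of the original one.\<close>

lemma PiD_mor_complete_homs:
  assumes v: "v \<in> X \<rightarrow>\<^sub>E subalgebras Sg L" and w: "w \<in> Y \<rightarrow>\<^sub>E subalgebras Sg L"
    and m: "m \<in> X \<rightarrow>\<^sub>E Y" and wm: "\<And>x. x \<in> X \<Longrightarrow> w (m x) \<subseteq> v x"
  shows "(\<lambda>g\<in>Pi\<^sub>E Y w. compose X g m) \<in> complete_homs Sg (PiD_obj L (Y, w)) (PiD_obj L (X, v))"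
    (is "?k \<in> _")
proof -
  have mx: "m x \<in> Y" if "x \<in> X" for x using PiE_mem[OF m that] .
  have in_v: "compose X g m \<in> Pi\<^sub>E X v" if "g \<in> Pi\<^sub>E Y w" for g
    using PiE_mem[OF that mx] wm by (auto simp: compose_def)
  have hom: "?k \<in> homs Sg (PiD_obj L (Y, w)) (PiD_obj L (X, v))"
    using reindex_homs[OF is_algebra_L PiE_subalgebras[OF w] mx in_v] by (simp add: PiD_obj_def)
  show ?thesis
    unfolding complete_homs_iff carrier_PiD_obj
  proof (intro conjI allI impI hom)
    fix S s d assume S: "S \<subseteq> Pi\<^sub>E Y w"
      and "is_bound (Pi\<^sub>E Y w) (alg_meet Sg (PiD_obj L (Y, w))) d s S"
    then have s: "s \<in> Pi\<^sub>E Y w"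
      and sy: "\<And>y. y \<in> Y \<Longrightarrow> is_bound (carrier L) (alg_meet Sg L) d (s y) ((\<lambda>g. g y) ` S)"
      using PiD_bounds[OF w S, of d s] by auto
    have kS: "?k ` S \<subseteq> Pi\<^sub>E X v" using in_v S by auto
    have "is_bound (carrier L) (alg_meet Sg L) d (?k s x) ((\<lambda>g. g x) ` ?k ` S)" if x: "x \<in> X" for x
    proof -
      have "(\<lambda>g. g x) ` ?k ` S = (\<lambda>g. g (m x)) ` S"
        unfolding image_image by (rule image_cong) (use S x in \<open>auto simp: compose_def\<close>)
      then show ?thesis using sy[OF mx[OF x]] s x by (simp add: compose_def)
    qed
    then show "is_bound (Pi\<^sub>E X v) (alg_meet Sg (PiD_obj L (X, v))) d (?k s) (?k ` S)"
      using PiD_bounds[OF v kS, of d "?k s"] in_v s by simp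
  qed
qed

text \<open>The hypothesis on \<open>f\<close> keeps \<open>compose B h g\<close> inside the set
  where it is not undefined.\<close>

lemma compose_assoc3:
  assumes "f \<in> A \<rightarrow> B" shows "compose A h (compose A g f) = compose A (compose B h g) f"
  using assms by (auto simp: compose_def intro!: restrict_ext)

lemma PiD_contravariant: "contravariant_functor (SetL_cat Sg L) (CAA_cat Sg L) (PiD L)"
  unfolding contravariant_functor_def split_paired_all
proof (intro conjI ballI; clarify?)
  fix X :: "'x set" and v assume X: "(X, v) \<in> Obj (SetL_cat Sg L)"
  then have v: "v \<in> X \<rightarrow>\<^sub>E subalgebras Sg L" by (simp add: SetL_simps)
  show "on_obj (PiD L) (X, v) \<in> Obj (CAA_cat Sg L)"
    using in_CAA_PiD[OF v] by (simp add: PiD_on_mor CAA_cat_def)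
  have "compose X g (\<lambda>x\<in>X. x) = g" if "g \<in> Pi\<^sub>E X v" for g
    using that by (intro extensionalityI[of _ X]) (auto simp: compose_def PiE_iff)
  then show "on_mor (PiD L) (X, v) (X, v) (ident (SetL_cat Sg L) (X, v)) =
      ident (CAA_cat Sg L) (on_obj (PiD L) (X, v))"
    by (auto simp: PiD_on_mor ident_def SetL_simps CAA_cat_def intro!: restrict_ext)
next
  fix X :: "'x set" and v and Y :: "'x set" and w f
  assume "(X, v) \<in> Obj (SetL_cat Sg L)" "(Y, w) \<in> Obj (SetL_cat Sg L)"
    "f \<in> Hom (SetL_cat Sg L) (X, v) (Y, w)"
  then show "on_mor (PiD L) (X, v) (Y, w) f
      \<in> Hom (CAA_cat Sg L) (on_obj (PiD L) (Y, w)) (on_obj (PiD L) (X, v))"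
    using PiD_mor_complete_homs[of v X w Y f] by (simp add: PiD_on_mor SetL_simps CAA_cat_def)
next
  fix X :: "'x set" and v and Y :: "'x set" and w and Z :: "'x set" and u f g
  assume f: "f \<in> Hom (SetL_cat Sg L) (X, v) (Y, w)" and g: "g \<in> Hom (SetL_cat Sg L) (Y, w) (Z, u)"
  have fY: "f \<in> X \<rightarrow> Y" using f by (auto simp: SetL_simps)
  have "compose Y k g \<in> Pi\<^sub>E Y w" if "k \<in> Pi\<^sub>E Z u" for k
    using g PiE_mem[OF that] by (fastforce simp: SetL_simps compose_def)
  then show "on_mor (PiD L) (X, v) (Z, u) (compose (Und (SetL_cat Sg L) (X, v)) g f) =
    compose (Und (CAA_cat Sg L) (on_obj (PiD L) (Z, u))) (on_mor (PiD L) (X, v) (Y, w) f)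
      (on_mor (PiD L) (Y, w) (Z, u) g)"
    using compose_assoc3[OF fY]
    by (auto simp: PiD_on_mor SetL_simps CAA_cat_def compose_eq compose_def[of "Pi\<^sub>E Z u"] intro!: restrict_ext)
qed

lemma PiD_contravariant_Var:
  "contravariant_functor (SetL_cat Sg L) (Var_cat Sg L) (after_contravariant iota_c (PiD L))"
  by (rule covariant_after_contravariant[OF PiD_contravariant iota_c_covariant])

text \<open>Grouping the dual space with the forgetful functor presents the canonical extension as a
  composite of just two contravariant functors.\<close>

definition spectrum where
  "spectrum = after_contravariant forget_topology (SigmaL Sg L)"

lemma spectrum_simps:
  "on_obj spectrum A = (homs Sg A L, \<lambda>h\<in>homs Sg A L. h ` carrier A)"
  "on_mor spectrum A B f = (\<lambda>h\<in>homs Sg B L. compose (carrier A) h f)"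
proof -
  \<comment> \<open>Hence the subtopology has all homomorphisms as its points.\<close>
  have "homs Sg A L \<subseteq> carrier A \<rightarrow>\<^sub>E carrier L" by (auto simp: homs_def)
  then show "on_obj spectrum A = (homs Sg A L, \<lambda>h\<in>homs Sg A L. h ` carrier A)"
    by (auto simp: spectrum_def after_contravariant_def forget_topology_def SigmaL_def)
  show "on_mor spectrum A B f = (\<lambda>h\<in>homs Sg B L. compose (carrier A) h f)"
    by (simp add: spectrum_def after_contravariant_def forget_topology_def SigmaL_def)
qed

lemma in_HSP_algebra: "in_HSP Sg L A \<Longrightarrow> is_algebra Sg A"
  by (simp add: in_HSP_def)

lemma spectrum_values:
  "is_algebra Sg A \<Longrightarrow> (\<lambda>h\<in>homs Sg A L. h ` carrier A) \<in> homs Sg A L \<rightarrow>\<^sub>E subalgebras Sg L"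
  using homs_image_subalgebra by auto

lemma spectrum_contravariant:
  "contravariant_functor (Var_cat Sg L :: (('a, 'op) op_algebra, 'a) concrete_category)
     (SetL_cat Sg L) spectrum"
  unfolding contravariant_functor_def
proof (intro conjI ballI)
  fix A :: "('a, 'op) op_algebra" assume "A \<in> Obj (Var_cat Sg L)"
  then have A: "is_algebra Sg A" by (simp add: Var_cat_def in_HSP_def)
  show "on_obj spectrum A \<in> Obj (SetL_cat Sg L)"
    using spectrum_values[OF A] by (simp add: spectrum_simps SetL_simps)
  have "compose (carrier A) h (\<lambda>x\<in>carrier A. x) = h" if "h \<in> homs Sg A L" for h
    using that by (intro extensionalityI[of _ "carrier A"]) (auto simp: compose_def homs_def PiE_iff)
  then show "on_mor spectrum A A (ident (Var_cat Sg L) A) = ident (SetL_cat Sg L) (on_obj spectrum A)"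
    by (auto simp: spectrum_simps SetL_simps ident_def Var_cat_def intro!: restrict_ext)
next
  fix A B :: "('a, 'op) op_algebra" and f
  assume "A \<in> Obj (Var_cat Sg L)" "f \<in> Hom (Var_cat Sg L) A B"
  then have A: "is_algebra Sg A" and f: "f \<in> homs Sg A B" by (simp_all add: Var_cat_def in_HSP_def)
  have c: "compose (carrier A) h f \<in> homs Sg A L" if "h \<in> homs Sg B L" for h
    by (rule homs_compose[OF A f that])
  moreover have "compose (carrier A) h f ` carrier A \<subseteq> h ` carrier B" if "h \<in> homs Sg B L" for h
    using homs_closed[OF f] by (auto simp: compose_def)
  ultimately show "on_mor spectrum A B f \<in> Hom (SetL_cat Sg L) (on_obj spectrum B) (on_obj spectrum A)"
    by (simp add: spectrum_simps SetL_simps)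
next
  fix A B C :: "('a, 'op) op_algebra" and f g
  assume "B \<in> Obj (Var_cat Sg L)" "f \<in> Hom (Var_cat Sg L) A B" "g \<in> Hom (Var_cat Sg L) B C"
  then have B: "is_algebra Sg B" and f: "f \<in> homs Sg A B" and g: "g \<in> homs Sg B C"
    by (simp_all add: Var_cat_def in_HSP_def)
  have fAB: "f \<in> carrier A \<rightarrow> carrier B" using homs_closed[OF f] by blast
  have "compose (carrier B) h g \<in> homs Sg B L" if "h \<in> homs Sg C L" for h
    by (rule homs_compose[OF B g that])
  then show "on_mor spectrum A C (compose (Und (Var_cat Sg L) A) g f) =
    compose (Und (SetL_cat Sg L) (on_obj spectrum C)) (on_mor spectrum A B f) (on_mor spectrum B C g)"
    using compose_assoc3[OF fAB]
    by (auto simp: spectrum_simps SetL_simps Var_cat_def compose_def[of "homs Sg C L"] intro!: restrict_ext)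
qed

lemma canonical_extension_covariant:
  "covariant_functor (Var_cat Sg L) (CAA_cat Sg L) (canonical_extension Sg L)"
  unfolding canonical_extension_def spectrum_def[symmetric]
  by (rule contravariant_after_contravariant[OF spectrum_contravariant PiD_contravariant])

end

section \<open>Representation of complete atomic algebras\<close>

text \<open>Preservation of meets together with injectivity preserves and reflects the order, and by
  surjectivity all competitors of a bound come from A.\<close>

lemma isos_complete_homs:
  assumes A: "is_algebra Sg A" and meet: "arity Sg (meet_sym Sg) = 2" and h: "h \<in> isos Sg A B"
  shows "h \<in> complete_homs Sg A B"
proof -
  have hom: "h \<in> homs Sg A B" and inj: "inj_on h (carrier A)" and img: "h ` carrier A = carrier B"
    using h by (auto simp: isos_def bij_betw_def)
  have cl: "alg_meet Sg A a b \<in> carrier A"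
    and hm: "h (alg_meet Sg A a b) = alg_meet Sg B (h a) (h b)"
    if "a \<in> carrier A" "b \<in> carrier A" for a b
    using is_algebra_interp[OF A, of "[a, b]"] homs_interp[OF hom, of "[a, b]"] that meet
    by (simp_all add: alg_meet_def)
  have ord: "ord (alg_meet Sg B) d (h a) (h b) \<longleftrightarrow> ord (alg_meet Sg A) d a b"
    if "a \<in> carrier A" "b \<in> carrier A" for a b d
    using that cl[OF that] cl[OF that(2,1)] hm[OF that] hm[OF that(2,1)] inj_on_eq_iff[OF inj]
    by (auto simp: ord_def)
  show ?thesis
    unfolding complete_homs_iff
  proof (intro conjI allI impI hom)
    fix S s d assume S: "S \<subseteq> carrier A" and s: "is_bound (carrier A) (alg_meet Sg A) d s S"
    then have "s \<in> carrier A" by (simp add: is_bound_def)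
    then show "is_bound (carrier B) (alg_meet Sg B) d (h s) (h ` S)"
      using S s unfolding is_bound_def img[symmetric] by (auto simp: ord subset_iff)
  qed
qed

section \<open>Evaluation points and coordinates from atoms\<close>

context semi_primal_lattice_algebra
begin

lemma L_bounds:
  assumes "c \<in> carrier L"
  shows "alg_meet Sg L c one = c" "alg_meet Sg L one c = c"
    "alg_meet Sg L c zero = zero" "alg_meet Sg L zero c = zero"
    "alg_join Sg L c zero = c" "alg_join Sg L zero c = c"
    "alg_join Sg L c one = one" "alg_join Sg L one c = one"
proof -
  note z = L_ops_closed(1) and e = L_ops_closed(2)
  show 1: "alg_meet Sg L c one = c" by (rule lattice_L(7)[OF assms assms assms])
  show 2: "alg_join Sg L c zero = c" by (rule lattice_L(8)[OF assms assms assms])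
  show "alg_meet Sg L one c = c" using 1 lattice_L(1)[OF e assms assms] by simp
  show 3: "alg_join Sg L zero c = c" using 2 lattice_L(2)[OF z assms assms] by simp
  show 4: "alg_meet Sg L zero c = zero" using 3 meet_eq_iff_join_eq[OF z assms] by simp
  show "alg_meet Sg L c zero = zero" using 4 lattice_L(1)[OF assms z z] by simp
  show 5: "alg_join Sg L c one = one" using 1 meet_eq_iff_join_eq[OF assms e] by simp
  show "alg_join Sg L one c = one" using 5 lattice_L(2)[OF e assms assms] by simp
qed

text \<open>The singletons of Y have supremum 1 in the product, so a complete homomorphism to L maps
  one of them to 1, and this determines all its values.\<close>

lemma complete_hom_is_evaluation:
  assumes w: "w \<in> Y \<rightarrow>\<^sub>E subalgebras Sg L" and v: "v \<in> X \<rightarrow>\<^sub>E subalgebras Sg L"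
    and k: "k \<in> complete_homs Sg (PiD_obj L (Y, w)) (PiD_obj L (X, v))" and x: "x \<in> X"
  shows "\<exists>y\<in>Y. \<forall>g\<in>Pi\<^sub>E Y w. k g x = g y"
proof -
  let ?A = "PiD_obj L (Y, w)"
  let ?P = "point Y ` Y"
  note A = PiD_obj_algebra(1)[OF w]
  have hom: "k \<in> homs Sg ?A (PiD_obj L (X, v))" by (rule complete_homs_homs[OF k])
  \<comment> \<open>The coordinate of \<open>k\<close> at \<open>x\<close>, a homomorphism to L;
    completeness is used through \<open>k\<close> itself.\<close>
  define u where "u = compose (Pi\<^sub>E Y w) (\<lambda>g\<in>Pi\<^sub>E X v. g x) k"
  have u: "u \<in> homs Sg ?A L"
    using homs_compose[OF A hom PiD_proj_homs[OF v x]] by (simp add: u_def)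
  have uk: "u g = k g x" if "g \<in> Pi\<^sub>E Y w" for g
    using homs_closed[OF hom, of g] that by (simp add: u_def compose_eq)
  have P: "?P \<subseteq> Pi\<^sub>E Y w" using point_in_PiD[OF w] by blast
  have top: "alg_top Sg ?A \<in> Pi\<^sub>E Y w" using algebra_lattice_ops(2)[OF A] by simp
  \<comment> \<open>At \<open>y\<close> the value 1 is attained by the point at \<open>y\<close>
    itself.\<close>
  have "is_bound (carrier L) (alg_meet Sg L) True (alg_top Sg ?A y) ((\<lambda>g. g y) ` ?P)"
    if y: "y \<in> Y" for y
  proof -
    have "(\<lambda>g. g y) ` ?P \<subseteq> carrier L"
      using L_ops_closed y by (auto simp: point_def)
    moreover have "one \<in> (\<lambda>g. g y) ` ?P"
      using y by (intro image_eqI[of _ _ "point Y y"]) (auto simp: point_def)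
    ultimately show ?thesis
      using y L_ops_closed(2) L_bounds(1) unfolding is_bound_def ord_def PiD_top by auto
  qed
  then have "is_bound (Pi\<^sub>E Y w) (alg_meet Sg ?A) True (alg_top Sg ?A) ?P"
    using PiD_bounds[OF w P] top by blast
  then have "is_bound (Pi\<^sub>E X v) (alg_meet Sg (PiD_obj L (X, v))) True (k (alg_top Sg ?A)) (k ` ?P)"
    using k P by (simp add: complete_homs_iff)
  moreover have "k ` ?P \<subseteq> Pi\<^sub>E X v" using homs_closed[OF hom] P unfolding carrier_PiD_obj by blast
  ultimately have "is_bound (carrier L) (alg_meet Sg L) True (k (alg_top Sg ?A) x) ((\<lambda>g. g x) ` k ` ?P)"
    using PiD_bounds[OF v] x by blast
  moreover have "k (alg_top Sg ?A) x = one"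
    using hom_top[OF hom] x by (simp add: PiD_top)
  ultimately have least: "\<And>c. c \<in> carrier L \<Longrightarrow> (\<And>y. y \<in> Y \<Longrightarrow> alg_meet Sg L (k (point Y y) x) c = k (point Y y) x)
      \<Longrightarrow> alg_meet Sg L one c = one"
    by (auto simp: is_bound_def ord_def)
  \<comment> \<open>Points are fixed by \<open>T_1\<close>, and homomorphisms to L send such
    elements to 0 or 1.\<close>
  have u01: "u (point Y y) = zero \<or> u (point Y y) = one" if "y \<in> Y" for y
  proof -
    have p: "point Y y \<in> Pi\<^sub>E Y w" by (rule point_in_PiD[OF w])
    have "char_op Sg L ?A one (point Y y) = point Y y"
      unfolding PiD_char_op[OF w p] by (auto simp: point_def)
    then show ?thesis using char_op_hom[OF A u, of "point Y y" one] p by (auto split: if_splits)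
  qed
  have "\<exists>y\<in>Y. u (point Y y) = one"
  proof (rule ccontr)
    \<comment> \<open>Then 0 would be an upper bound of a set whose supremum is 1; this also
      excludes an empty \<open>Y\<close>.\<close>
    assume "\<not> ?thesis"
    then have "k (point Y y) x = zero" if "y \<in> Y" for y
      using u01[OF that] that uk[OF point_in_PiD[OF w]] by auto
    then have "alg_meet Sg L one zero = one"
      using L_zero_one(1) L_ops_closed(1) by (intro least) auto
    then show False using L_zero_one(3) bot_neq_top by simp
  qed
  then obtain y where y: "y \<in> Y" "u (point Y y) = one" by blast
  have "k g x = g y" if g: "g \<in> Pi\<^sub>E Y w" for g
  proof -
    let ?T = "char_op Sg L ?A (g y) g"
    have T: "?T \<in> carrier ?A" using char_op_closed[OF A] g by simp
    \<comment> \<open>\<open>T_l g\<close> with \<open>l = g y\<close> is 1 at \<open>y\<close>,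
      hence above the point at \<open>y\<close>, which \<open>u\<close> sends to 1. So
      \<open>u\<close> sends it to 1 as well, which means \<open>u g = l\<close>.\<close>
    have "alg_meet Sg ?A (point Y y) ?T = point Y y"
      unfolding PiD_meet PiD_char_op[OF w g] point_def
      by (rule restrict_ext) (use L_zero_one in auto)
    then have "alg_meet Sg L one (u ?T) = one"
      using hom_meet[OF u, of "point Y y" ?T] T y(2) point_in_PiD[OF w] by simp
    then have "u g = g y"
      using char_op_hom[OF A u, of g "g y"] g L_zero_one(3) bot_neq_top by (auto split: if_splits)
    then show ?thesis using uk[OF g] by simp
  qed
  then show ?thesis using y(1) by blast
qed

text \<open>For each atom x of the skeleton choose a homomorphism \<open>\<pi> x\<close> to L which maps x to 1; these
  homomorphisms are the coordinates. An element with prescribed coordinates g is found as the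
  supremum of the elements \<open>b y \<and> y\<close> over the atoms y, where \<open>\<pi> y (b y) = g y\<close>; for each atom x
  it lies between \<open>b x \<and> x\<close> and \<open>b x \<or> T\<^sub>0 x\<close>, both of which \<open>\<pi> x\<close> sends to \<open>g x\<close>.\<close>

lemma in_CAA_representation:
  fixes B :: "('b, 'op) op_algebra"
  assumes B: "in_CAA Sg L B"
  obtains X :: "'b set" and v \<psi> where "v \<in> X \<rightarrow>\<^sub>E subalgebras Sg L"
    and "\<psi> \<in> isos Sg B (PiD_obj L (X, v))"
proof -
  let ?Sk = "skeleton Sg L B" and ?m = "alg_meet Sg B" and ?T = "char_op Sg L B"
  have hsp: "in_HSP Sg L B" and lat: "complete_lattice (lat_reduct Sg B)"
    and atomic: "\<And>b. b \<in> ?Sk \<Longrightarrow> b \<noteq> alg_bot Sg B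
      \<Longrightarrow> \<exists>a. atom_on ?Sk ?m (alg_bot Sg B) a \<and> ?m a b = a"
    using B by (auto simp: in_CAA_def complete_atomic_boolean_on_def)
  have A: "is_algebra Sg B" by (rule in_HSP_algebra[OF hsp])
  note ops = algebra_lattice_ops[OF A] and T = char_op_closed[OF A]
  have sep: "a = b" if "a \<in> carrier B" "b \<in> carrier B" "\<And>u. u \<in> homs Sg B L \<Longrightarrow> u a = u b" for a b
    using in_HSP_separated[OF hsp that(1,2)] that(3) by blast
  have Sk_carrier: "s \<in> carrier B" if "s \<in> ?Sk" for s
    using that by (simp add: skeleton_def)
  have Sk_val: "u s = zero \<or> u s = one" if "s \<in> ?Sk" "u \<in> homs Sg B L" for s u
    using char_op_hom[OF A that(2), of s one] that(1) by (auto simp: skeleton_def split: if_splits)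
  \<comment> \<open>Homomorphisms to L cannot tell \<open>T_1 s\<close> from \<open>s\<close>, so
    separation identifies the two.\<close>
  have SkI: "s \<in> ?Sk" if "s \<in> carrier B" "\<And>u. u \<in> homs Sg B L \<Longrightarrow> u s = zero \<or> u s = one" for s
  proof -
    have "?T one s = s"
      by (rule sep[OF T[OF that(1)] that(1)]) (use char_op_hom[OF A _ that(1)] that(2) in force)
    then show ?thesis using that(1) by (simp add: skeleton_def)
  qed
  define X where "X = {x. atom_on ?Sk ?m (alg_bot Sg B) x}"
  have X: "x \<in> ?Sk" "x \<in> carrier B" "x \<noteq> alg_bot Sg B"
    and X_min: "\<And>b. b \<in> ?Sk \<Longrightarrow> ?m b x = b \<Longrightarrow> b = alg_bot Sg B \<or> b = x" if "x \<in> X" for x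
    using that Sk_carrier by (auto simp: X_def atom_on_def)
  \<comment> \<open>Otherwise every homomorphism sends \<open>x\<close> to 0, as it does the bottom
    element, and separation gives \<open>x\<close> = bottom.\<close>
  have "\<exists>u. u \<in> homs Sg B L \<and> u x = one" if x: "x \<in> X" for x
  proof (rule ccontr)
    assume "\<not> ?thesis"
    then have "u x = u (alg_bot Sg B)" if "u \<in> homs Sg B L" for u
      using Sk_val[OF X(1)[OF x] that] hom_bot[OF that] that by auto
    then show False using sep[OF X(2)[OF x] ops(1)] X(3)[OF x] by blast
  qed
  then obtain \<pi> where \<pi>: "\<And>x. x \<in> X \<Longrightarrow> \<pi> x \<in> homs Sg B L" and \<pi>1: "\<And>x. x \<in> X \<Longrightarrow> \<pi> x x = one"
    by metis
  define v where "v = (\<lambda>x\<in>X. \<pi> x ` carrier B)"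
  have v: "v \<in> X \<rightarrow>\<^sub>E subalgebras Sg L"
    using homs_image_subalgebra[OF A \<pi>] by (simp add: v_def)
  define \<psi> where "\<psi> = (\<lambda>b\<in>carrier B. \<lambda>x\<in>X. \<pi> x b)"
  have \<psi>_v: "(\<lambda>x\<in>X. \<pi> x b) \<in> Pi\<^sub>E X v" if "b \<in> carrier B" for b
    using that by (auto simp: v_def)
  have hom: "\<psi> \<in> homs Sg B (PiD_obj L (X, v))"
    using tuple_homs[OF A \<pi> \<psi>_v] by (simp add: \<psi>_def PiD_obj_def)
  have inj: "inj_on \<psi> (carrier B)"
  proof (rule inj_onI, rule ccontr)
    fix b c assume bc: "b \<in> carrier B" "c \<in> carrier B" "\<psi> b = \<psi> c" "b \<noteq> c"
    then obtain u where u: "u \<in> homs Sg B L" "u b \<noteq> u c" using in_HSP_separated[OF hsp] by blast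
    \<comment> \<open>A skeleton element that a homomorphism \<open>u'\<close> sends to 1 exactly if
      \<open>u' b = u b\<close> and \<open>u' c \<noteq> u b\<close>. It is nonzero because of
      \<open>u\<close>, and an atom below it is a coordinate at which \<open>b\<close> and
      \<open>c\<close> differ.\<close>
    define e where "e = ?m (?T (u b) b) (?T zero (?T (u b) c))"
    have eB: "e \<in> carrier B" using bc T ops by (simp add: e_def)
    have e_val: "u' e = (if u' b = u b \<and> u' c \<noteq> u b then one else zero)" if u': "u' \<in> homs Sg B L" for u'
      using char_op_hom[OF A u'] hom_meet[OF u'] bc T L_zero_one bot_neq_top by (simp add: e_def)
    have "e \<in> ?Sk"
    proof (rule SkI[OF eB])
      show "u' e = zero \<or> u' e = one" if "u' \<in> homs Sg B L" for u'
        using e_val[OF that] by simp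
    qed
    moreover have "u e = one" using e_val[OF u(1)] u(2) by simp
    then have "e \<noteq> alg_bot Sg B" using hom_bot[OF u(1)] bot_neq_top by auto
    ultimately obtain x where x: "x \<in> X" "?m x e = x" using atomic by (auto simp: X_def)
    have "alg_meet Sg L one (\<pi> x e) = one"
      using hom_meet[OF \<pi>[OF x(1)] X(2)[OF x(1)] eB] \<pi>1[OF x(1)] x(2) by simp
    then have "\<pi> x b \<noteq> \<pi> x c"
      using e_val[OF \<pi>[OF x(1)]] L_zero_one(3) bot_neq_top by (auto split: if_splits)
    moreover have "\<psi> b x = \<psi> c x" using bc(3) by (rule fun_cong)
    ultimately show False using bc(1,2) x(1) by (simp add: \<psi>_def)
  qed
  have "g \<in> \<psi> ` carrier B" if g: "g \<in> Pi\<^sub>E X v" for g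
  proof -
    have "\<exists>b. b \<in> carrier B \<and> \<pi> x b = g x" if "x \<in> X" for x
      using PiE_mem[OF g that] that by (auto simp: v_def)
    then obtain b where b: "\<And>x. x \<in> X \<Longrightarrow> b x \<in> carrier B" and \<pi>b: "\<And>x. x \<in> X \<Longrightarrow> \<pi> x (b x) = g x"
      by metis
    define S where "S = (\<lambda>y. ?m (b y) y) ` X"
    have S: "S \<subseteq> carrier B" using b X(2) ops(3) by (auto simp: S_def)
    have "\<exists>s. is_lub (lat_reduct Sg B) s S"
      using lat S by (intro complete_lattice.sup_exists) (auto simp: lat_reduct_def meet_order_def)
    then obtain s where s: "is_bound (carrier B) ?m True s S"
      using S by (auto simp: lat_reduct_def is_lub_iff_is_bound)
    then have sB: "s \<in> carrier B" by (simp add: is_bound_def)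
    have "\<pi> x s = g x" if x: "x \<in> X" for x
    proof -
      note p = \<pi>[OF x] and bx = b[OF x] and xB = X(2)[OF x]
      have gx: "g x \<in> carrier L" "\<pi> x s \<in> carrier L"
        using homs_closed[OF p bx] \<pi>b[OF x] homs_closed[OF p sB] by auto
      have "?m (?m (b x) x) s = ?m (b x) x"
        using s x by (auto simp: is_bound_def ord_def S_def)
      then have "\<pi> x (?m (?m (b x) x) s) = \<pi> x (?m (b x) x)" by simp
      then have lower: "alg_meet Sg L (g x) (\<pi> x s) = g x"
        using hom_meet[OF p] ops bx xB sB \<pi>b[OF x] \<pi>1[OF x] L_bounds(1)[OF gx(1)] by simp
      define c where "c = alg_join Sg B (b x) (?T zero x)"
      have cB: "c \<in> carrier B" using bx T[OF xB] ops(4) by (simp add: c_def)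
      have "?m (?m (b y) y) c = ?m (b y) y" if y: "y \<in> X" for y
      proof (rule sep)
        note yB = X(2)[OF y] and byB = b[OF y]
        show "?m (b y) y \<in> carrier B" "?m (?m (b y) y) c \<in> carrier B"
          using yB byB cB ops(3) by auto
        fix u assume u: "u \<in> homs Sg B L"
        have L: "u (b y) \<in> carrier L" "u (b x) \<in> carrier L" "u c \<in> carrier L"
          using homs_closed[OF u] byB bx cB by auto
        have uc: "u c = alg_join Sg L (u (b x)) (if u x = zero then one else zero)"
          using hom_join[OF u bx T[OF xB]] char_op_hom[OF A u xB] by (simp add: c_def)
        have lhs: "u (?m (?m (b y) y) c) = alg_meet Sg L (alg_meet Sg L (u (b y)) (u y)) (u c)"
          and rhs: "u (?m (b y) y) = alg_meet Sg L (u (b y)) (u y)"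
          using hom_meet[OF u] ops(3) yB byB cB by simp_all
        \<comment> \<open>If \<open>u\<close> sends \<open>y\<close> to 0, the smaller element
          vanishes; if it sends \<open>x\<close> to 0, then \<open>c\<close> becomes 1. Only the
          third case uses that \<open>x\<close> and \<open>y\<close> are atoms.\<close>
        consider "u y = zero" | "u y = one" "u x = zero" | "u y = one" "u x = one"
          using Sk_val[OF X(1)[OF x] u] Sk_val[OF X(1)[OF y] u] by blast
        then show "u (?m (?m (b y) y) c) = u (?m (b y) y)"
        proof cases
          case 1
          then show ?thesis using L by (simp add: lhs rhs L_bounds)
        next
          case 2
          then show ?thesis using L by (simp add: lhs rhs uc L_bounds)
        next
          case 3
          \<comment> \<open>The meet of the two atoms lies in the skeleton, and it is not bottom
            since \<open>u\<close> sends it to 1. By minimality it equals both \<open>x\<close> and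
            \<open>y\<close>.\<close>
          define q where "q = ?m x y"
          have qB: "q \<in> carrier B" using xB yB ops(3) by (simp add: q_def)
          have q_val: "u' q = alg_meet Sg L (u' x) (u' y)" if "u' \<in> homs Sg B L" for u'
            using hom_meet[OF that xB yB] by (simp add: q_def)
          note xy01 = Sk_val[OF X(1)[OF x]] Sk_val[OF X(1)[OF y]]
          have "q \<in> ?Sk"
          proof (rule SkI[OF qB])
            fix u' assume "u' \<in> homs Sg B L"
            then show "u' q = zero \<or> u' q = one"
              using xy01[of u'] q_val[of u'] L_zero_one by auto
          qed
          moreover have "?m q x = q" "?m q y = q"
          proof -
            have "u' (?m q x) = u' q" "u' (?m q y) = u' q" if u': "u' \<in> homs Sg B L" for u'
              using xy01[OF u'] q_val[OF u'] L_zero_one hom_meet[OF u' qB xB] hom_meet[OF u' qB yB]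
              by auto
            then show "?m q x = q" "?m q y = q"
              using sep qB xB yB ops(3) by blast+
          qed
          ultimately have "q = alg_bot Sg B \<or> x = y"
            using X_min[OF x] X_min[OF y] by metis
          moreover have "q \<noteq> alg_bot Sg B"
            using q_val[OF u] 3 hom_bot[OF u] L_zero_one(4) bot_neq_top by auto
          ultimately have "x = y" by blast
          moreover have "u c = u (b x)" using uc 3(2) L bot_neq_top by (simp add: L_bounds)
          ultimately show ?thesis
            using 3 L semilattice_onD(2)[OF semilattice_L] by (simp add: lhs rhs L_bounds)
        qed
      qed
      then have "?m s c = s" using s cB by (auto simp: is_bound_def ord_def S_def)
      then have "\<pi> x (?m s c) = \<pi> x s" by simp
      moreover have "\<pi> x c = g x"
        using hom_join[OF p bx T[OF xB]] char_op_hom[OF A p xB] \<pi>b[OF x] \<pi>1[OF x] bot_neq_top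
          L_bounds(5)[OF gx(1)] by (simp add: c_def)
      ultimately have "alg_meet Sg L (\<pi> x s) (g x) = \<pi> x s"
        using hom_meet[OF p sB cB] by simp
      then show ?thesis using lower lattice_L(1)[OF gx(1) gx(2) gx(1)] by simp
    qed
    then have "\<psi> s = g"
      using sB g by (intro extensionalityI[of _ X g]) (auto simp: \<psi>_def PiE_iff)
    then show ?thesis using sB by blast
  qed
  then have "\<psi> ` carrier B = carrier (PiD_obj L (X, v))"
    using homs_closed[OF hom] by auto
  then have "\<psi> \<in> isos Sg B (PiD_obj L (X, v))"
    using hom inj by (simp add: isos_def bij_betw_def)
  with v show thesis by (rule that)
qed

end

section \<open>The adjunction\<close>

context semi_primal_lattice_algebra
begin

abbreviation "labels A \<equiv> \<lambda>h\<in>homs Sg A L. h ` carrier A"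

abbreviation "extension A \<equiv> PiD_obj L (homs Sg A L, labels A)"

lemma canonical_extension_simps:
  "on_obj (canonical_extension Sg L) A = extension A"
  "on_mor (canonical_extension Sg L) A B f =
    (\<lambda>g\<in>Pi\<^sub>E (homs Sg A L) (labels A). compose (homs Sg B L) g (\<lambda>h\<in>homs Sg B L. compose (carrier A) h f))"
  unfolding canonical_extension_def spectrum_def[symmetric]
  by (simp_all add: after_contravariant_def[of "PiD L"] spectrum_simps PiD_on_mor)

text \<open>Evaluation at all homomorphisms: the unit of the adjunction.\<close>

definition unit_map :: "('a, 'op) op_algebra \<Rightarrow> 'a \<Rightarrow> ('a \<Rightarrow> 'l) \<Rightarrow> 'l" where
  "unit_map A = (\<lambda>a\<in>carrier A. \<lambda>h\<in>homs Sg A L. h a)"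

lemma unit_map_homs:
  assumes A: "is_algebra Sg A"
  shows "unit_map A \<in> homs Sg A (extension A)"
proof -
  have "(\<lambda>h\<in>homs Sg A L. h a) \<in> Pi\<^sub>E (homs Sg A L) (labels A)" if "a \<in> carrier A" for a
    using that by auto
  from tuple_homs[of Sg A "homs Sg A L" "\<lambda>h. h", OF A _ this] show ?thesis
    by (simp add: unit_map_def PiD_obj_def)
qed

lemma unit_map_carrier:
  "is_algebra Sg A \<Longrightarrow> a \<in> carrier A \<Longrightarrow> unit_map A a \<in> Pi\<^sub>E (homs Sg A L) (labels A)"
  using homs_closed[OF unit_map_homs, of A a] by simp

text \<open>Once B is replaced by a product, \<open>complete_hom_is_evaluation\<close> attaches a
  homomorphism from A to L to each coordinate. Composition with the unit recovers these
  homomorphisms, so they neither lose nor add information.\<close>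

lemma restrict_unit_map_bij:
  fixes A :: "('a, 'op) op_algebra" and B :: "('b, 'op) op_algebra"
  assumes hsp: "in_HSP Sg L A" and B: "in_CAA Sg L B"
  shows "bij_betw (\<lambda>k. compose (carrier A) k (unit_map A))
    (complete_homs Sg (extension A) B) (homs Sg A B)"
proof -
  let ?H = "homs Sg A L" and ?E = "extension A"
  have A: "is_algebra Sg A" by (rule in_HSP_algebra[OF hsp])
  have algB: "is_algebra Sg B" using B by (simp add: in_CAA_def in_HSP_def)
  note \<eta> = unit_map_homs[OF A] and \<eta>_in = unit_map_carrier[OF A]
  note lab = spectrum_values[OF A]
  note algE = PiD_obj_algebra(1)[OF lab]
  have ar: "arity Sg (meet_sym Sg) = 2" using signature by (simp add: lat_signature_ok_def)
  obtain X :: "'b set" and v \<psi> where v: "v \<in> X \<rightarrow>\<^sub>E subalgebras Sg L"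
    and \<psi>: "\<psi> \<in> isos Sg B (PiD_obj L (X, v))"
    by (rule in_CAA_representation[OF B])
  let ?P = "PiD_obj L (X, v)"
  have \<psi>c: "\<psi> \<in> complete_homs Sg B ?P" by (rule isos_complete_homs[OF algB ar \<psi>])
  have \<psi>h: "\<psi> \<in> homs Sg B ?P" by (rule complete_homs_homs[OF \<psi>c])
  have \<psi>_inj: "inj_on \<psi> (carrier B)" using \<psi> by (simp add: isos_def bij_betw_def)
  have \<psi>_img: "\<psi> ` carrier B = Pi\<^sub>E X v" using \<psi> by (simp add: isos_def bij_betw_def)
  have eval: "\<exists>h\<in>?H. \<forall>g\<in>Pi\<^sub>E ?H (labels A). \<psi> (k g) x = g h"
    if k: "k \<in> complete_homs Sg ?E B" and x: "x \<in> X" for k x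
    using complete_hom_is_evaluation[OF lab v complete_homs_compose[OF algE k \<psi>c] x]
    by (simp add: compose_eq)
  have inj: "k = k'"
    if k: "k \<in> complete_homs Sg ?E B" and k': "k' \<in> complete_homs Sg ?E B"
      and eq: "compose (carrier A) k (unit_map A) = compose (carrier A) k' (unit_map A)" for k k'
  proof (rule homs_eqI[OF complete_homs_homs[OF k] complete_homs_homs[OF k']])
    fix g assume "g \<in> carrier ?E"
    then have g: "g \<in> Pi\<^sub>E ?H (labels A)" by simp
    have kg: "k g \<in> carrier B" "k' g \<in> carrier B"
      using homs_closed[OF complete_homs_homs[OF k]] homs_closed[OF complete_homs_homs[OF k']] g
      by simp_all
    have "\<psi> (k g) x = \<psi> (k' g) x" if x: "x \<in> X" for x
    proof -
      obtain h where h: "h \<in> ?H" "\<And>g. g \<in> Pi\<^sub>E ?H (labels A) \<Longrightarrow> \<psi> (k g) x = g h"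
        using eval[OF k x] by blast
      obtain h' where h': "h' \<in> ?H" "\<And>g. g \<in> Pi\<^sub>E ?H (labels A) \<Longrightarrow> \<psi> (k' g) x = g h'"
        using eval[OF k' x] by blast
      \<comment> \<open>On the image of the unit, evaluation at \<open>h\<close> returns
        \<open>h a\<close>, so agreement of \<open>k\<close> and \<open>k'\<close> there identifies
        the two evaluation points.\<close>
      have "h a = h' a" if a: "a \<in> carrier A" for a
      proof -
        have "k (unit_map A a) = k' (unit_map A a)"
          using fun_cong[OF eq, of a] a by (simp add: compose_eq)
        then have "unit_map A a h = unit_map A a h'"
          using h(2)[OF \<eta>_in[OF a]] h'(2)[OF \<eta>_in[OF a]] by simp
        then show ?thesis using a h(1) h'(1) by (simp add: unit_map_def)
      qed
      then have "h = h'" by (rule homs_eqI[OF h(1) h'(1)])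
      then show ?thesis using h(2)[OF g] h'(2)[OF g] by simp
    qed
    moreover have "\<psi> (k g) \<in> Pi\<^sub>E X v" "\<psi> (k' g) \<in> Pi\<^sub>E X v" using kg \<psi>_img by auto
    ultimately have "\<psi> (k g) = \<psi> (k' g)" by (metis PiE_ext)
    then show "k g = k' g" using kg inj_onD[OF \<psi>_inj] by blast
  qed
  have surj: "\<exists>k\<in>complete_homs Sg ?E B. compose (carrier A) k (unit_map A) = u"
    if u: "u \<in> homs Sg A B" for u
  proof -
    have "compose (carrier A) \<psi> u \<in> homs Sg A ?P" by (rule homs_compose[OF A u \<psi>h])
    then have m: "compose (carrier A) (\<lambda>g\<in>Pi\<^sub>E X v. g x) (compose (carrier A) \<psi> u) \<in> ?H"
      if "x \<in> X" for x
      by (rule homs_compose[OF A _ PiD_proj_homs[OF v that]])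
    \<comment> \<open>\<open>m x\<close> is coordinate \<open>x\<close> of \<open>u\<close> followed
      by \<psi>. It is a morphism of labelled sets from \<open>(X, v)\<close> to the spectrum of A,
      and reindexing along it yields the required complete homomorphism.\<close>
    define m where
      "m = (\<lambda>x\<in>X. compose (carrier A) (\<lambda>g\<in>Pi\<^sub>E X v. g x) (compose (carrier A) \<psi> u))"
    have \<psi>u: "\<psi> (u a) \<in> Pi\<^sub>E X v" if "a \<in> carrier A" for a
      using homs_closed[OF u that] \<psi>_img by blast
    have m_eq: "m x a = \<psi> (u a) x" if "x \<in> X" "a \<in> carrier A" for x a
      using \<psi>u[OF that(2)] that by (simp add: m_def compose_eq)
    have mH: "m \<in> X \<rightarrow>\<^sub>E ?H" using m by (simp add: m_def)
    have "labels A (m x) \<subseteq> v x" if x: "x \<in> X" for x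
      using PiE_mem[OF mH x] m_eq[OF x] PiE_mem[OF \<psi>u x] by auto
    then have \<kappa>: "(\<lambda>g\<in>Pi\<^sub>E ?H (labels A). compose X g m) \<in> complete_homs Sg ?E ?P"
      by (rule PiD_mor_complete_homs[OF v lab mH])
    let ?\<theta> = "restrict (inv_into (carrier B) \<psi>) (carrier ?P)"
    have "?\<theta> \<in> complete_homs Sg ?P B"
      by (rule isos_complete_homs[OF PiD_obj_algebra(1)[OF v] ar isos_inverse[OF algB \<psi>]])
    note k = complete_homs_compose[OF algE \<kappa> this]
    have "compose (carrier A) (compose (carrier ?E) ?\<theta> (\<lambda>g\<in>Pi\<^sub>E ?H (labels A). compose X g m)) (unit_map A) = u"
    proof (rule homs_eqI[OF homs_compose[OF A \<eta> complete_homs_homs[OF k]] u])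
      fix a assume a: "a \<in> carrier A"
      have "compose X (unit_map A a) m x = \<psi> (u a) x" if "x \<in> X" for x
        using m_eq[OF that a] PiE_mem[OF mH that] a that by (simp add: compose_eq unit_map_def)
      then have "compose X (unit_map A a) m = \<psi> (u a)"
        using \<psi>u[OF a] by (intro extensionalityI[of _ X]) (auto simp: PiE_iff compose_def)
      then show "compose (carrier A) (compose (carrier ?E) ?\<theta> (\<lambda>g\<in>Pi\<^sub>E ?H (labels A). compose X g m)) (unit_map A) a = u a"
        using a \<eta>_in[OF a] \<psi>u[OF a] homs_closed[OF u a] \<psi>_inj by (simp add: compose_eq)
    qed
    then show ?thesis using k by blast
  qed
  have "compose (carrier A) k (unit_map A) \<in> homs Sg A B" if "k \<in> complete_homs Sg ?E B" for k
    by (rule homs_compose[OF A \<eta> complete_homs_homs[OF that]])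
  then show ?thesis
    using inj surj unfolding bij_betw_def inj_on_def by blast
qed

lemma canonical_extension_left_adjoint:
  "left_adjoint Sg L
     (canonical_extension Sg L ::
        (('a, 'op) op_algebra, 'a, (('a \<Rightarrow> 'l) \<Rightarrow> 'l, 'op) op_algebra, ('a \<Rightarrow> 'l) \<Rightarrow> 'l) functr)
     (iota_c :: (('b, 'op) op_algebra, 'b, ('b, 'op) op_algebra, 'b) functr)"
  unfolding left_adjoint_def
proof (intro conjI canonical_extension_covariant iota_c_covariant
    exI[of _ "\<lambda>(A :: ('a, 'op) op_algebra) (B :: ('b, 'op) op_algebra) k. compose (carrier A) k (unit_map A)"]
    allI impI; (elim conjE)?)
  fix A :: "('a, 'op) op_algebra" and B :: "('b, 'op) op_algebra"
  assume "in_HSP Sg L A" "in_CAA Sg L B"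
  then show "bij_betw (\<lambda>k. compose (carrier A) k (unit_map A))
      (complete_homs Sg (on_obj (canonical_extension Sg L) A) B) (homs Sg A (on_obj iota_c B))"
    using restrict_unit_map_bij by (simp add: canonical_extension_simps iota_c_def)
next
  fix A A' :: "('a, 'op) op_algebra" and B :: "('b, 'op) op_algebra" and f k
  assume "in_HSP Sg L A" "in_HSP Sg L A'" and f: "f \<in> homs Sg A' A"
  then have A: "is_algebra Sg A" "is_algebra Sg A'" by (auto intro: in_HSP_algebra)
  show "compose (carrier A') (compose (carrier (on_obj (canonical_extension Sg L) A')) k
        (on_mor (canonical_extension Sg L) A' A f)) (unit_map A') =
      compose (carrier A') (compose (carrier A) k (unit_map A)) f"
    unfolding compose_def[of "carrier A'" "compose _ _ _"]
  proof (rule restrict_ext)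
    fix a assume a: "a \<in> carrier A'"
    \<comment> \<open>Naturality of the unit: evaluation at \<open>a\<close>, reindexed along
      composition with \<open>f\<close>, is evaluation at \<open>f a\<close>.\<close>
    have "compose (homs Sg A L) (unit_map A' a) (\<lambda>h\<in>homs Sg A L. compose (carrier A') h f) = unit_map A (f a)"
      using homs_compose[OF A(2) f, of _ L] a homs_closed[OF f a]
      by (auto simp: compose_def[of "homs Sg A L"] unit_map_def compose_eq intro!: restrict_ext)
    then show "compose (carrier (on_obj (canonical_extension Sg L) A')) k
        (on_mor (canonical_extension Sg L) A' A f) (unit_map A' a) = compose (carrier A) k (unit_map A) (f a)"
      using unit_map_carrier[OF A(2) a] homs_closed[OF f a]
      by (simp add: canonical_extension_simps compose_eq)
  qed
next
  fix A :: "('a, 'op) op_algebra" and B B' :: "('b, 'op) op_algebra" and g k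
  assume "in_HSP Sg L A"
  then have A: "is_algebra Sg A" by (rule in_HSP_algebra)
  show "compose (carrier A) (compose (carrier (on_obj (canonical_extension Sg L) A)) g k) (unit_map A) =
      compose (carrier A) (on_mor iota_c B B' g) (compose (carrier A) k (unit_map A))"
    unfolding compose_def[of "carrier A"]
    by (rule restrict_ext)
      (use unit_map_carrier[OF A] in \<open>simp add: canonical_extension_simps iota_c_def compose_eq\<close>)
qed

end

section \<open>The Stone-Cech compactification\<close>

text \<open>Both maps are locally constant, so any relation between their values is too. Applied to
  the negated relation this also gives closed sets; the relations that matter are inclusion of
  labels and membership of a value in a label.\<close>

lemma openin_discrete_valued:
  assumes g: "continuous_map T (discrete_topology C) g" and h: "continuous_map T (discrete_topology D) h"
  shows "openin T {x \<in> topspace T. P (g x) (h x)}"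
proof (subst openin_subopen, intro ballI)
  fix x assume x: "x \<in> {x \<in> topspace T. P (g x) (h x)}"
  then have "g x \<in> C" "h x \<in> D"
    using g h by (auto simp: continuous_map_def)
  then have "openin T {y \<in> topspace T. g y \<in> {g x}}" "openin T {y \<in> topspace T. h y \<in> {h x}}"
    using openin_continuous_map_preimage[OF g, of "{g x}"] openin_continuous_map_preimage[OF h, of "{h x}"]
    by simp_all
  then have "openin T ({y \<in> topspace T. g y \<in> {g x}} \<inter> {y \<in> topspace T. h y \<in> {h x}})"
    by (rule openin_Int)
  moreover have "{y \<in> topspace T. g y \<in> {g x}} \<inter> {y \<in> topspace T. h y \<in> {h x}}
      \<subseteq> {x \<in> topspace T. P (g x) (h x)}"
    using x by auto
  ultimately show "\<exists>N. openin T N \<and> x \<in> N \<and> N \<subseteq> {x \<in> topspace T. P (g x) (h x)}"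
    using x by (intro exI conjI) auto
qed

lemma closedin_discrete_valued:
  assumes "continuous_map T (discrete_topology C) g" "continuous_map T (discrete_topology D) h"
  shows "closedin T {x \<in> topspace T. P (g x) (h x)}"
proof -
  have "topspace T - {x \<in> topspace T. P (g x) (h x)} = {x \<in> topspace T. \<not> P (g x) (h x)}" by blast
  then show ?thesis
    using openin_discrete_valued[OF assms, of "\<lambda>a b. \<not> P a b"] by (simp add: closedin_def)
qed

text \<open>A function determined by finitely many locally constant ones is locally constant. This
  makes pointwise operations preserve continuity.\<close>

lemma continuous_map_into_discrete:
  assumes "finite G" and g: "\<And>g. g \<in> G \<Longrightarrow> continuous_map T (discrete_topology C) g"
    and dep: "\<And>x y. x \<in> topspace T \<Longrightarrow> y \<in> topspace T \<Longrightarrow> (\<And>g. g \<in> G \<Longrightarrow> g y = g x) \<Longrightarrow> h y = h x"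
    and h: "\<And>x. x \<in> topspace T \<Longrightarrow> h x \<in> D"
  shows "continuous_map T (discrete_topology D) h"
  unfolding continuous_map_def
proof (intro conjI allI impI)
  show "h \<in> topspace T \<rightarrow> topspace (discrete_topology D)" using h by simp
  fix V
  show "openin T {x \<in> topspace T. h x \<in> V}"
  proof (subst openin_subopen, intro ballI)
    fix x assume x: "x \<in> {x \<in> topspace T. h x \<in> V}"
    \<comment> \<open>The whole space is inserted to cover empty \<open>G\<close>, that is,
      constants of the signature.\<close>
    let ?N = "\<Inter>(insert (topspace T) ((\<lambda>g. {y \<in> topspace T. g y = g x}) ` G))"
    have "openin T {y \<in> topspace T. g y = g x}" if "g \<in> G" for g
      using openin_discrete_valued[OF g[OF that] g[OF that], of "\<lambda>a _. a = g x"] .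
    then have "openin T ?N"
      using assms(1) by (intro openin_Inter) auto
    moreover have "?N \<subseteq> {x \<in> topspace T. h x \<in> V}"
    proof
      fix y assume "y \<in> ?N"
      then have y: "y \<in> topspace T" "\<And>g. g \<in> G \<Longrightarrow> g y = g x" by auto
      have "h y = h x" by (rule dep) (use x y in auto)
      then show "y \<in> {x \<in> topspace T. h x \<in> V}" using x y(1) by simp
    qed
    ultimately show "\<exists>N. openin T N \<and> x \<in> N \<and> N \<subseteq> {x \<in> topspace T. h x \<in> V}"
      using x by (intro exI[of _ ?N]) auto
  qed
qed

text \<open>The complement of a basic set is the basic set of the complement.\<close>

lemma clopen_stone_cech_basic:
  assumes "A \<subseteq> X"
  shows "closedin (stone_cech X) {U \<in> ultrafilters_on X. A \<in> U}"
proof -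
  have "ultrafilters_on X - {U \<in> ultrafilters_on X. A \<in> U} = {U \<in> ultrafilters_on X. X - A \<in> U}"
    using ultrafilter_Compl_iff[OF _ assms] by blast
  then show ?thesis
    using openin_stone_cech_basic[of "X - A" X] by (auto simp: closedin_def topspace_stone_cech)
qed

lemma stone_space_stone_cech: "stone_space (stone_cech X)"
proof -
  have "neighbourhood_base_of (\<lambda>U. closedin (stone_cech X) U \<and> openin (stone_cech X) U) (stone_cech X)"
    unfolding neighbourhood_base_of
  proof (intro allI impI, elim conjE)
    fix W U assume "openin (stone_cech X) W" "U \<in> W"
    moreover from this have "U \<in> ultrafilters_on X"
      using openin_subset[of "stone_cech X" W] by (auto simp: topspace_stone_cech)
    moreover from calculation obtain A where "A \<subseteq> X" "A \<in> U" "{V \<in> ultrafilters_on X. A \<in> V} \<subseteq> W"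
      using openin_stone_cech_base[of X W U] by blast
    ultimately show "\<exists>V' V. openin (stone_cech X) V' \<and>
        (closedin (stone_cech X) V \<and> openin (stone_cech X) V) \<and> U \<in> V' \<and> V' \<subseteq> V \<and> V \<subseteq> W"
      using openin_stone_cech_basic[of A X] clopen_stone_cech_basic[of A X]
      by (intro exI[of _ "{V \<in> ultrafilters_on X. A \<in> V}"]) auto
  qed
  then show ?thesis
    by (simp add: stone_space_def compact_space_stone_cech Hausdorff_space_stone_cech
        dimension_le_0_neighbourhood_base_of_clopen)
qed

text \<open>A closed condition passes from the dense principal ultrafilters to all
  ultrafilters.\<close>

lemma stone_cech_dense_closed:
  assumes "closedin (stone_cech X) {U \<in> topspace (stone_cech X). P U}"
    and "\<And>x. x \<in> X \<Longrightarrow> P (stone_cech_unit X x)" and "U \<in> topspace (stone_cech X)"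
  shows "P U"
proof -
  have "stone_cech_unit X ` X \<subseteq> {U \<in> topspace (stone_cech X). P U}"
    using assms(2) stone_cech_unit_in[of _ X] by (auto simp: topspace_stone_cech)
  then have "topspace (stone_cech X) \<subseteq> {U \<in> topspace (stone_cech X). P U}"
    using closure_of_minimal[OF _ assms(1), of "stone_cech_unit X ` X"]
    by (simp only: stone_cech_unit_dense)
  then show ?thesis using assms(3) by blast
qed

lemma stone_cech_eqI:
  assumes T: "Hausdorff_space T" and g: "continuous_map (stone_cech X) T g"
    and h: "continuous_map (stone_cech X) T h"
    and ext: "g \<in> extensional (topspace (stone_cech X))" "h \<in> extensional (topspace (stone_cech X))"
    and eq: "\<And>x. x \<in> X \<Longrightarrow> g (stone_cech_unit X x) = h (stone_cech_unit X x)"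
  shows "g = h"
proof (rule extensionalityI[OF ext])
  fix U assume U: "U \<in> topspace (stone_cech X)"
  show "g U = h U"
  proof (rule forall_in_closure_of_eq[OF _ T g h])
    show "U \<in> stone_cech X closure_of (stone_cech_unit X ` X)"
      using U by (simp add: stone_cech_unit_dense)
    show "g y = h y" if "y \<in> stone_cech_unit X ` X" for y using that eq by auto
  qed
qed

section \<open>Functoriality of the labelled compactification\<close>

context semi_primal_lattice_algebra
begin

abbreviation "discrete_subalgebras \<equiv> discrete_topology (subalgebras Sg L)"

text \<open>Discrete spaces are Hausdorff, and this one is compact because L has finitely many
  subalgebras, so the universal property applies.\<close>

lemma label_ext:
  assumes v: "v \<in> X \<rightarrow>\<^sub>E subalgebras Sg L"
  shows "stone_cech_ext X discrete_subalgebras v \<in> topspace (stone_cech X) \<rightarrow>\<^sub>E subalgebras Sg L"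
    and "continuous_map (stone_cech X) discrete_subalgebras (stone_cech_ext X discrete_subalgebras v)"
    and "\<And>x. x \<in> X \<Longrightarrow> stone_cech_ext X discrete_subalgebras v (stone_cech_unit X x) = v x"
proof -
  have vx: "\<And>x. x \<in> X \<Longrightarrow> v x \<in> topspace discrete_subalgebras" using PiE_mem[OF v] by simp
  have fin: "compact_space discrete_subalgebras"
    by (simp add: compact_space_discrete_topology finite_subalgebras)
  note e = stone_cech_ext[where f = v and X = X, OF fin Hausdorff_space_discrete_topology vx]
  show "continuous_map (stone_cech X) discrete_subalgebras (stone_cech_ext X discrete_subalgebras v)"
    by (rule e(2))
  then show "stone_cech_ext X discrete_subalgebras v \<in> topspace (stone_cech X) \<rightarrow>\<^sub>E subalgebras Sg L"
    using e(1) by (auto simp: continuous_map_def PiE_def)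
  show "stone_cech_ext X discrete_subalgebras v (stone_cech_unit X x) = v x" if "x \<in> X" for x
    by (rule e(3)) (use that in simp_all)
qed

lemma map_ext:
  assumes f: "f \<in> X \<rightarrow>\<^sub>E Y"
  defines "\<beta>f \<equiv> stone_cech_ext X (stone_cech Y) (\<lambda>x. stone_cech_unit Y (f x))"
  shows "\<beta>f \<in> topspace (stone_cech X) \<rightarrow>\<^sub>E topspace (stone_cech Y)"
    and "continuous_map (stone_cech X) (stone_cech Y) \<beta>f"
    and "\<And>x. x \<in> X \<Longrightarrow> \<beta>f (stone_cech_unit X x) = stone_cech_unit Y (f x)"
proof -
  have unit: "stone_cech_unit Y (f x) \<in> topspace (stone_cech Y)" if "x \<in> X" for x
    using stone_cech_unit_in[OF PiE_mem[OF f that]] by (simp add: topspace_stone_cech)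
  note e = stone_cech_ext[where f = "\<lambda>x. stone_cech_unit Y (f x)" and X = X,
      OF compact_space_stone_cech Hausdorff_space_stone_cech unit, folded \<beta>f_def]
  show "continuous_map (stone_cech X) (stone_cech Y) \<beta>f" by (rule e(2))
  then show "\<beta>f \<in> topspace (stone_cech X) \<rightarrow>\<^sub>E topspace (stone_cech Y)"
    using e(1) by (auto simp: continuous_map_def PiE_def)
  show "\<beta>f (stone_cech_unit X x) = stone_cech_unit Y (f x)" if "x \<in> X" for x
    by (rule e(3)) (use that in simp_all)
qed

lemma StoneL_simps:
  "(T, v) \<in> Obj (StoneL_cat Sg L) \<longleftrightarrow> stone_space T \<and> v \<in> topspace T \<rightarrow>\<^sub>E subalgebras Sg L \<and>
     (\<forall>S\<in>subalgebras Sg L. closedin T {x \<in> topspace T. v x \<subseteq> S})"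
  "Und (StoneL_cat Sg L) (T, v) = topspace T"
  "m \<in> Hom (StoneL_cat Sg L) (T, v) (U, w) \<longleftrightarrow> m \<in> topspace T \<rightarrow>\<^sub>E topspace U \<and>
     continuous_map T U m \<and> (\<forall>x\<in>topspace T. w (m x) \<subseteq> v x)"
  by (simp_all add: StoneL_cat_def)

lemma betaL_simps:
  "on_obj (betaL Sg L) (X, v) = (stone_cech X, stone_cech_ext X discrete_subalgebras v)"
  "on_mor (betaL Sg L) (X, v) (Y, w) f = stone_cech_ext X (stone_cech Y) (\<lambda>x. stone_cech_unit Y (f x))"
  by (simp_all add: betaL_def)

lemma compose_extensional_continuous:
  assumes "continuous_map T U f" "continuous_map U V g"
  shows "continuous_map T V (compose (topspace T) g f)"
  using continuous_map_compose[OF assms]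
  by (rule continuous_map_eq) (simp add: compose_eq)

text \<open>Identities and composites are preserved by uniqueness of extensions. Inclusion of labels
  is a closed condition that holds at principal ultrafilters, so it holds everywhere.\<close>

lemma betaL_covariant: "covariant_functor (SetL_cat Sg L) (StoneL_cat Sg L) (betaL Sg L)"
  unfolding covariant_functor_def split_paired_all
proof (intro conjI ballI; clarify?)
  fix X :: "'x set" and v assume "(X, v) \<in> Obj (SetL_cat Sg L)"
  then have v: "v \<in> X \<rightarrow>\<^sub>E subalgebras Sg L" by (simp add: SetL_simps)
  show "on_obj (betaL Sg L) (X, v) \<in> Obj (StoneL_cat Sg L)"
    unfolding betaL_simps StoneL_simps
    using stone_space_stone_cech label_ext(1)[OF v] 
      closedin_discrete_valued[OF label_ext(2)[OF v] label_ext(2)[OF v], of "\<lambda>a _. a \<subseteq> S" for S]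
    by blast
  have id: "(\<lambda>x\<in>X. x) \<in> X \<rightarrow>\<^sub>E X" by simp
  have "stone_cech_ext X (stone_cech X) (\<lambda>x. stone_cech_unit X ((\<lambda>x\<in>X. x) x))
      = (\<lambda>U\<in>topspace (stone_cech X). U)"
  proof (rule stone_cech_eqI[OF Hausdorff_space_stone_cech map_ext(2)[OF id]])
    show "continuous_map (stone_cech X) (stone_cech X) (\<lambda>U\<in>topspace (stone_cech X). U)"
      by (rule continuous_map_eq[OF continuous_map_id]) simp
    show "stone_cech_ext X (stone_cech X) (\<lambda>x. stone_cech_unit X ((\<lambda>x\<in>X. x) x))
        \<in> extensional (topspace (stone_cech X))"
      using map_ext(1)[OF id] by (simp add: PiE_iff)
  qed (use map_ext(3)[OF id] stone_cech_unit_in[of _ X] in \<open>simp_all add: topspace_stone_cech\<close>)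
  then show "on_mor (betaL Sg L) (X, v) (X, v) (ident (SetL_cat Sg L) (X, v)) =
      ident (StoneL_cat Sg L) (on_obj (betaL Sg L) (X, v))"
    by (simp add: betaL_simps ident_def SetL_simps StoneL_simps)
next
  fix X Y :: "'x set" and v w f
  assume "(X, v) \<in> Obj (SetL_cat Sg L)" "(Y, w) \<in> Obj (SetL_cat Sg L)"
    "f \<in> Hom (SetL_cat Sg L) (X, v) (Y, w)"
  then have v: "v \<in> X \<rightarrow>\<^sub>E subalgebras Sg L" and w: "w \<in> Y \<rightarrow>\<^sub>E subalgebras Sg L"
    and f: "f \<in> X \<rightarrow>\<^sub>E Y" and wf: "\<And>x. x \<in> X \<Longrightarrow> w (f x) \<subseteq> v x" by (simp_all add: SetL_simps)
  let ?\<beta>f = "stone_cech_ext X (stone_cech Y) (\<lambda>x. stone_cech_unit Y (f x))"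
  let ?v = "stone_cech_ext X discrete_subalgebras v" and ?w = "stone_cech_ext Y discrete_subalgebras w"
  have "?w (?\<beta>f U) \<subseteq> ?v U" if "U \<in> topspace (stone_cech X)" for U
  proof (rule stone_cech_dense_closed[OF _ _ that])
    have "continuous_map (stone_cech X) discrete_subalgebras (\<lambda>U. ?w (?\<beta>f U))"
      using continuous_map_compose[OF map_ext(2)[OF f] label_ext(2)[OF w]] by (simp add: comp_def)
    from closedin_discrete_valued[OF this label_ext(2)[OF v]]
    show "closedin (stone_cech X) {U \<in> topspace (stone_cech X). ?w (?\<beta>f U) \<subseteq> ?v U}" .
    show "?w (?\<beta>f (stone_cech_unit X x)) \<subseteq> ?v (stone_cech_unit X x)" if "x \<in> X" for x
      using wf[OF that] label_ext(3)[OF w PiE_mem[OF f that]] label_ext(3)[OF v that]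
        map_ext(3)[OF f that] by simp
  qed
  then show "on_mor (betaL Sg L) (X, v) (Y, w) f
      \<in> Hom (StoneL_cat Sg L) (on_obj (betaL Sg L) (X, v)) (on_obj (betaL Sg L) (Y, w))"
    unfolding betaL_simps StoneL_simps using map_ext(1,2)[OF f] by blast
next
  fix X Y Z :: "'x set" and v w u f g
  assume "f \<in> Hom (SetL_cat Sg L) (X, v) (Y, w)" "g \<in> Hom (SetL_cat Sg L) (Y, w) (Z, u)"
  then have f: "f \<in> X \<rightarrow>\<^sub>E Y" and g: "g \<in> Y \<rightarrow>\<^sub>E Z" by (simp_all add: SetL_simps)
  have gf: "compose X g f \<in> X \<rightarrow>\<^sub>E Z" using PiE_mem[OF g PiE_mem[OF f]] by (simp add: compose_def)
  let ?B = "\<lambda>X Y f. stone_cech_ext X (stone_cech Y) (\<lambda>x. stone_cech_unit Y (f x))"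
  have "?B X Z (compose X g f) = compose (topspace (stone_cech X)) (?B Y Z g) (?B X Y f)"
  proof (rule stone_cech_eqI[OF Hausdorff_space_stone_cech map_ext(2)[OF gf]])
    show "continuous_map (stone_cech X) (stone_cech Z)
        (compose (topspace (stone_cech X)) (?B Y Z g) (?B X Y f))"
      by (rule compose_extensional_continuous[OF map_ext(2)[OF f] map_ext(2)[OF g]])
    show "?B X Z (compose X g f) \<in> extensional (topspace (stone_cech X))"
      using map_ext(1)[OF gf] by (simp add: PiE_iff)
    show "?B X Z (compose X g f) (stone_cech_unit X x) =
        compose (topspace (stone_cech X)) (?B Y Z g) (?B X Y f) (stone_cech_unit X x)" if "x \<in> X" for x
      using map_ext(3)[OF gf that] map_ext(3)[OF f that] map_ext(3)[OF g PiE_mem[OF f that]]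
        stone_cech_unit_in[OF that] that by (simp add: compose_eq topspace_stone_cech)
  qed (simp add: compose_def)
  then show "on_mor (betaL Sg L) (X, v) (Z, u) (compose (Und (SetL_cat Sg L) (X, v)) g f) =
      compose (Und (StoneL_cat Sg L) (on_obj (betaL Sg L) (X, v)))
        (on_mor (betaL Sg L) (Y, w) (Z, u) g) (on_mor (betaL Sg L) (X, v) (Y, w) f)"
    by (simp add: betaL_simps SetL_simps StoneL_simps)
qed

section \<open>Continuous sections and their restriction to principal ultrafilters\<close>

definition sections :: "'y topology \<Rightarrow> ('y \<Rightarrow> 'l set) \<Rightarrow> ('y \<Rightarrow> 'l) set" where
  "sections T v = {g \<in> Pi\<^sub>E (topspace T) v. continuous_map T (discrete_topology (carrier L)) g}"

lemma PiL_obj_sections: "PiL_obj L (T, v) = (alg_power L (topspace T))\<lparr>carrier := sections T v\<rparr>"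
  by (simp add: PiL_obj_def sections_def)

lemma sections_subpower:
  assumes v: "v \<in> topspace T \<rightarrow>\<^sub>E subalgebras Sg L"
  shows "sections T v \<subseteq> topspace T \<rightarrow>\<^sub>E carrier L"
    and "closed_under_ops Sg (alg_power L (topspace T)) (sections T v)"
proof -
  note P = PiE_subalgebras[OF v]
  show "sections T v \<subseteq> topspace T \<rightarrow>\<^sub>E carrier L" using P(1) by (auto simp: sections_def)
  show "closed_under_ops Sg (alg_power L (topspace T)) (sections T v)"
    unfolding closed_under_ops_def
  proof (intro allI impI)
    fix f gs assume gs: "length gs = arity Sg f \<and> set gs \<subseteq> sections T v"
    let ?h = "interp (alg_power L (topspace T)) f gs"
    have h: "?h \<in> Pi\<^sub>E (topspace T) v"
      using P(2) gs unfolding closed_under_ops_def sections_def by blast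
    have "continuous_map T (discrete_topology (carrier L)) ?h"
    \<comment> \<open>The result at a point depends only on the values there of the finitely many
      arguments.\<close>
    proof (rule continuous_map_into_discrete[of "set gs"])
      show "continuous_map T (discrete_topology (carrier L)) g" if "g \<in> set gs" for g
        using gs that by (auto simp: sections_def)
      show "?h x \<in> carrier L" if "x \<in> topspace T" for x using h P(1) that by (meson PiE_mem subsetD)
      fix x y assume xy: "x \<in> topspace T" "y \<in> topspace T" "\<And>g. g \<in> set gs \<Longrightarrow> g y = g x"
      then have eq: "map (\<lambda>g. g y) gs = map (\<lambda>g. g x) gs" by simp
      have "?h z = interp L f (map (\<lambda>g. g z) gs)" if "z \<in> topspace T" for z
        using that by (simp add: alg_power_def)
      then show "?h y = ?h x" by (simp only: xy(1,2) eq)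
    qed simp
    then show "?h \<in> sections T v" using h by (simp add: sections_def)
  qed
qed

lemma PiL_obj_algebra:
  assumes "v \<in> topspace T \<rightarrow>\<^sub>E subalgebras Sg L"
  shows "is_algebra Sg (PiL_obj L (T, v))" "in_HSP Sg L (PiL_obj L (T, v))"
  using subalgebra_of_power[OF sections_subpower[OF assms]] by (simp_all add: PiL_obj_sections)

lemma reindex_sections_homs:
  assumes w: "w \<in> topspace U \<rightarrow>\<^sub>E subalgebras Sg L" and m: "\<And>x. x \<in> X \<Longrightarrow> m x \<in> topspace U"
    and S: "\<And>g. g \<in> sections U w \<Longrightarrow> compose X g m \<in> S"
  shows "(\<lambda>g\<in>sections U w. compose X g m) \<in> homs Sg (PiL_obj L (U, w)) ((alg_power L X)\<lparr>carrier := S\<rparr>)"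
  using reindex_homs[OF is_algebra_L sections_subpower[OF w] m S] by (simp add: PiL_obj_sections)

lemma PiL_simps:
  "on_obj (PiL L) = PiL_obj L"
  "on_mor (PiL L) (T, v) (U, w) m = (\<lambda>g\<in>sections U w. compose (topspace T) g m)"
  by (simp_all add: PiL_def PiL_obj_sections)

lemma compose_sections:
  assumes "m \<in> Hom (StoneL_cat Sg L) (T, v) (U, w)" "g \<in> sections U w"
  shows "compose (topspace T) g m \<in> sections T v"
proof -
  have m: "m \<in> topspace T \<rightarrow>\<^sub>E topspace U" "continuous_map T U m"
    and wm: "\<And>x. x \<in> topspace T \<Longrightarrow> w (m x) \<subseteq> v x"
    using assms(1) by (simp_all add: StoneL_simps)
  have g: "g \<in> Pi\<^sub>E (topspace U) w" "continuous_map U (discrete_topology (carrier L)) g"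
    using assms(2) by (simp_all add: sections_def)
  have "g (m x) \<in> v x" if "x \<in> topspace T" for x
    using PiE_mem[OF g(1) PiE_mem[OF m(1) that]] wm[OF that] by blast
  then show ?thesis
    using compose_extensional_continuous[OF m(2) g(2)] by (simp add: sections_def compose_def)
qed

lemma PiL_contravariant: "contravariant_functor (StoneL_cat Sg L) (Var_cat Sg L) (PiL L)"
  unfolding contravariant_functor_def split_paired_all
proof (intro conjI ballI; clarify?)
  fix T :: "'y topology" and v assume "(T, v) \<in> Obj (StoneL_cat Sg L)"
  then have v: "v \<in> topspace T \<rightarrow>\<^sub>E subalgebras Sg L" by (simp add: StoneL_simps)
  show "on_obj (PiL L) (T, v) \<in> Obj (Var_cat Sg L)"
    using PiL_obj_algebra(2)[OF v] by (simp add: PiL_simps Var_cat_def)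
  have "compose (topspace T) g (\<lambda>x\<in>topspace T. x) = g" if "g \<in> sections T v" for g
    using that by (intro extensionalityI[of _ "topspace T"]) (auto simp: compose_def sections_def PiE_iff)
  then show "on_mor (PiL L) (T, v) (T, v) (ident (StoneL_cat Sg L) (T, v)) =
      ident (Var_cat Sg L) (on_obj (PiL L) (T, v))"
    by (auto simp: PiL_simps ident_def StoneL_simps Var_cat_def PiL_obj_sections intro!: restrict_ext)
next
  fix T U :: "'y topology" and v w m
  assume "(U, w) \<in> Obj (StoneL_cat Sg L)" and m: "m \<in> Hom (StoneL_cat Sg L) (T, v) (U, w)"
  then have w: "w \<in> topspace U \<rightarrow>\<^sub>E subalgebras Sg L" and mU: "\<And>x. x \<in> topspace T \<Longrightarrow> m x \<in> topspace U"
    by (auto simp: StoneL_simps)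
  show "on_mor (PiL L) (T, v) (U, w) m
      \<in> Hom (Var_cat Sg L) (on_obj (PiL L) (U, w)) (on_obj (PiL L) (T, v))"
    using reindex_sections_homs[OF w mU compose_sections[OF m]]
    by (simp add: PiL_simps Var_cat_def PiL_obj_sections)
next
  fix T U V :: "'y topology" and v w z m n
  assume m: "m \<in> Hom (StoneL_cat Sg L) (T, v) (U, w)" and n: "n \<in> Hom (StoneL_cat Sg L) (U, w) (V, z)"
  have mU: "m \<in> topspace T \<rightarrow> topspace U" using m by (auto simp: StoneL_simps)
  show "on_mor (PiL L) (T, v) (V, z) (compose (Und (StoneL_cat Sg L) (T, v)) n m) =
      compose (Und (Var_cat Sg L) (on_obj (PiL L) (V, z))) (on_mor (PiL L) (T, v) (U, w) m)
        (on_mor (PiL L) (U, w) (V, z) n)"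
    using compose_assoc3[OF mU] compose_sections[OF n]
    by (auto simp: PiL_simps StoneL_simps Var_cat_def PiL_obj_sections compose_def[of "sections V z"]
        intro!: restrict_ext)
qed

definition restrict_to_points ::
    "'x set \<times> ('x \<Rightarrow> 'l set) \<Rightarrow> ('x set set \<Rightarrow> 'l) \<Rightarrow> 'x \<Rightarrow> 'l" where
  "restrict_to_points = (\<lambda>(X, v). \<lambda>g\<in>sections (stone_cech X) (stone_cech_ext X discrete_subalgebras v).
     compose X g (stone_cech_unit X))"

lemma restrict_to_points_iso:
  assumes v: "v \<in> X \<rightarrow>\<^sub>E subalgebras Sg L"
  shows "restrict_to_points (X, v)
    \<in> isos Sg (PiL_obj L (stone_cech X, stone_cech_ext X discrete_subalgebras v)) (PiD_obj L (X, v))"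
proof -
  let ?v = "stone_cech_ext X discrete_subalgebras v" and ?u = "stone_cech_unit X"
  let ?D = "discrete_topology (carrier L)" and ?S = "sections (stone_cech X) ?v"
  have u_in: "?u x \<in> topspace (stone_cech X)" if "x \<in> X" for x
    using stone_cech_unit_in[OF that] by (simp add: topspace_stone_cech)
  have into: "compose X g ?u \<in> Pi\<^sub>E X v" if "g \<in> ?S" for g
  proof -
    have "g (?u x) \<in> v x" if "x \<in> X" for x
      using \<open>g \<in> ?S\<close> PiE_mem[OF _ u_in[OF that], of g ?v] label_ext(3)[OF v that]
      by (simp add: sections_def)
    then show ?thesis by (simp add: compose_def)
  qed
  have hom: "restrict_to_points (X, v) \<in> homs Sg (PiL_obj L (stone_cech X, ?v)) (PiD_obj L (X, v))"
    using reindex_sections_homs[OF label_ext(1)[OF v] u_in into]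
    by (simp add: restrict_to_points_def PiD_obj_def)
  have inj: "inj_on (restrict_to_points (X, v)) ?S"
  proof (rule inj_onI)
    fix g h assume gh: "g \<in> ?S" "h \<in> ?S" "restrict_to_points (X, v) g = restrict_to_points (X, v) h"
    show "g = h"
    proof (rule stone_cech_eqI[OF Hausdorff_space_discrete_topology])
      show "g (?u x) = h (?u x)" if "x \<in> X" for x
        using fun_cong[OF gh(3), of x] gh(1,2) that by (simp add: restrict_to_points_def compose_eq)
    qed (use gh(1,2) in \<open>auto simp: sections_def PiE_iff\<close>)
  qed
  have "g \<in> restrict_to_points (X, v) ` ?S" if g: "g \<in> Pi\<^sub>E X v" for g
  proof -
    have gL: "\<And>x. x \<in> X \<Longrightarrow> g x \<in> topspace ?D"
      using PiE_subalgebras(1)[OF v] g by auto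
    have "compact_space ?D" by (simp add: compact_space_discrete_topology finite_carrier)
    note e = stone_cech_ext[where f = g and X = X, OF this Hausdorff_space_discrete_topology gL]
    let ?g = "stone_cech_ext X ?D g"
    have ge: "?g (?u x) = g x" if "x \<in> X" for x
      by (rule e(3)) (use that in simp_all)
    \<comment> \<open>The extension exists because L is finite; that it respects the extended labels
      is a closed condition, known at principal ultrafilters.\<close>
    have "?g U \<in> ?v U" if "U \<in> topspace (stone_cech X)" for U
    proof (rule stone_cech_dense_closed[OF _ _ that])
      show "closedin (stone_cech X) {U \<in> topspace (stone_cech X). ?g U \<in> ?v U}"
        by (rule closedin_discrete_valued[OF e(2) label_ext(2)[OF v]])
      show "?g (?u x) \<in> ?v (?u x)" if "x \<in> X" for x
        using ge[OF that] label_ext(3)[OF v that] PiE_mem[OF g that] by simp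
    qed
    then have gS: "?g \<in> ?S" using e(1,2) by (simp add: sections_def PiE_iff)
    moreover have "compose X ?g ?u = g"
      using ge g by (intro extensionalityI[of _ X]) (auto simp: compose_def PiE_iff)
    ultimately show ?thesis
      by (intro image_eqI[of _ _ ?g]) (simp_all add: restrict_to_points_def)
  qed
  moreover have "restrict_to_points (X, v) g \<in> Pi\<^sub>E X v" if "g \<in> ?S" for g
    using into[OF that] that by (simp add: restrict_to_points_def)
  ultimately have "restrict_to_points (X, v) ` ?S = Pi\<^sub>E X v" by blast
  then show ?thesis
    using hom inj by (simp add: isos_def bij_betw_def PiL_obj_sections)
qed

lemma PiL_betaL_iso_PiD:
  "naturally_isomorphic Sg L
     (SetL_cat Sg L :: ('x set \<times> ('x \<Rightarrow> 'l set), 'x) concrete_category)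
     (after_covariant (PiL L) (betaL Sg L)) (after_contravariant iota_c (PiD L))"
  unfolding naturally_isomorphic_def split_paired_all
proof (intro conjI contravariant_after_covariant[OF betaL_covariant PiL_contravariant]
    PiD_contravariant_Var exI[of _ restrict_to_points] ballI; clarify?)
  fix X :: "'x set" and v assume "(X, v) \<in> Obj (SetL_cat Sg L)"
  then show "restrict_to_points (X, v) \<in> isos Sg (on_obj (after_covariant (PiL L) (betaL Sg L)) (X, v))
      (on_obj (after_contravariant iota_c (PiD L)) (X, v))"
    using restrict_to_points_iso
    by (simp add: SetL_simps after_covariant_def after_contravariant_def iota_c_def PiL_simps
        betaL_simps PiD_on_mor)
next
  fix X Y :: "'x set" and v w f
  assume X: "(X, v) \<in> Obj (SetL_cat Sg L)" and Y: "(Y, w) \<in> Obj (SetL_cat Sg L)"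
    and f: "f \<in> Hom (SetL_cat Sg L) (X, v) (Y, w)"
  let ?F = "after_covariant (PiL L) (betaL Sg L)"
  let ?v = "stone_cech_ext X discrete_subalgebras v" and ?w = "stone_cech_ext Y discrete_subalgebras w"
  let ?\<beta>f = "stone_cech_ext X (stone_cech Y) (\<lambda>x. stone_cech_unit Y (f x))"
  have w: "w \<in> Y \<rightarrow>\<^sub>E subalgebras Sg L" and fXY: "f \<in> X \<rightarrow>\<^sub>E Y" using Y f by (simp_all add: SetL_simps)
  have \<beta>f: "?\<beta>f \<in> Hom (StoneL_cat Sg L) (stone_cech X, ?v) (stone_cech Y, ?w)"
    using covariant_functorD(3)[OF betaL_covariant X Y f] by (simp add: betaL_simps)
  have F: "carrier (on_obj ?F (Y, w)) = sections (stone_cech Y) ?w"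
    "on_mor ?F (X, v) (Y, w) f =
      (\<lambda>g\<in>sections (stone_cech Y) ?w. compose (topspace (stone_cech X)) g ?\<beta>f)"
    "on_mor (after_contravariant iota_c (PiD L)) (X, v) (Y, w) f = (\<lambda>g\<in>Pi\<^sub>E Y w. compose X g f)"
    by (simp_all add: after_covariant_def after_contravariant_def iota_c_def PiL_simps PiD_on_mor
        betaL_simps PiL_obj_sections)
  show "compose (carrier (on_obj ?F (Y, w))) (restrict_to_points (X, v)) (on_mor ?F (X, v) (Y, w) f) =
      compose (carrier (on_obj ?F (Y, w)))
        (on_mor (after_contravariant iota_c (PiD L)) (X, v) (Y, w) f) (restrict_to_points (Y, w))"
    unfolding F compose_def[of "sections _ _"]
  proof (rule restrict_ext)
    fix g assume g: "g \<in> sections (stone_cech Y) ?w"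
    have "restrict_to_points (Y, w) \<in> homs Sg (PiL_obj L (stone_cech Y, ?w)) (PiD_obj L (Y, w))"
      using restrict_to_points_iso[OF w] by (simp add: isos_def)
    from homs_closed[OF this, of g] have rg: "restrict_to_points (Y, w) g \<in> Pi\<^sub>E Y w"
      using g by (simp add: PiL_obj_sections)
    \<comment> \<open>At \<open>x\<close> both sides are the value of \<open>g\<close> at the
      principal ultrafilter of \<open>f x\<close>, since the extension of \<open>f\<close> maps
      principal ultrafilters to principal ones.\<close>
    have "compose X (compose (topspace (stone_cech X)) g ?\<beta>f) (stone_cech_unit X) =
        compose X (compose Y g (stone_cech_unit Y)) f"
    proof (rule extensionalityI[of _ X])
      fix x assume x: "x \<in> X"
      then show "compose X (compose (topspace (stone_cech X)) g ?\<beta>f) (stone_cech_unit X) x =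
          compose X (compose Y g (stone_cech_unit Y)) f x"
        using map_ext(3)[OF fXY x] PiE_mem[OF fXY x] stone_cech_unit_in[OF x]
        by (simp add: compose_eq topspace_stone_cech)
    qed (simp_all add: compose_def)
    then show "restrict_to_points (X, v)
        ((\<lambda>g\<in>sections (stone_cech Y) ?w. compose (topspace (stone_cech X)) g ?\<beta>f) g) =
      (\<lambda>g\<in>Pi\<^sub>E Y w. compose X g f) (restrict_to_points (Y, w) g)"
      using g rg compose_sections[OF \<beta>f g] by (simp add: restrict_to_points_def)
  qed
qed

end

theorem proposition5p11:
  fixes Sg :: "'op lat_signature" and L :: "('l, 'op) op_algebra"
  assumes "lat_signature_ok Sg"
    and "bounded_lattice_algebra Sg L"
    and "finite (carrier L)"
    and "alg_bot Sg L \<noteq> alg_top Sg L"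
    and "semi_primal Sg L"
  shows "covariant_functor
           (SetL_cat Sg L :: ('x set \<times> ('x \<Rightarrow> 'l set), 'x) concrete_category)
           (StoneL_cat Sg L) (betaL Sg L)
       \<and> naturally_isomorphic Sg L
           (SetL_cat Sg L :: ('x set \<times> ('x \<Rightarrow> 'l set), 'x) concrete_category)
           (after_covariant (PiL L) (betaL Sg L))
           (after_contravariant iota_c (PiD L))
       \<and> left_adjoint Sg L
           (canonical_extension Sg L ::
              (('a, 'op) op_algebra, 'a, (('a \<Rightarrow> 'l) \<Rightarrow> 'l, 'op) op_algebra, ('a \<Rightarrow> 'l) \<Rightarrow> 'l) functr)
           (iota_c :: (('b, 'op) op_algebra, 'b, ('b, 'op) op_algebra, 'b) functr)"
proof -
  interpret semi_primal_lattice_algebra Sg L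
    using assms by unfold_locales
  show ?thesis
    by (intro conjI betaL_covariant PiL_betaL_iso_PiD canonical_extension_left_adjoint)
qed

end
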